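(* Let $h_1,h_2:\mathbb{R}\to\mathbb{R}$ be continuous piecewise linear functions with $h_i'(x)=\kappa_i^0$ for $x<0$ and $h_i'(x)=\kappa_i^1$ for $x>0$, $i=1,2$, where $(\kappa_1^0,\kappa_2^0)\in\mathcal{A}_5\cup\mathcal{A}_6$, $(\kappa_1^1,\kappa_2^1)\in\mathcal{A}_1\cup\mathcal{A}_2$, and $$\frac{\kappa_2^1}{\kappa_1^1}\neq\frac{\kappa_2^0}{\kappa_1^0}.$$ Then the system $$u_1(x)=h_1(x)-u_1'u_2'-\tfrac{(u_1')^2}{2},\qquad u_2(x)=h_2(x)-u_1'u_2'-\tfrac{(u_2')^2}{2}$$ has infinitely many admissible solutions $u=(u_1,u_2):\mathbb{R}\to\mathbb{R}^2$, and for each of them the functions $\alpha_i^*=-u_i'$, $i=1,2$, provide a Nash equilibrium solution in feedback form to the differential game with dynamics $\dot x=\alpha_1+\alpha_2$, $x(0)=y$, and costs $J_i=\int_0^\infty e^{-t}\big[h_i(x(t))+\alpha_i^2(t)/2\big]\,dt$, $i=1,2$ (so that the game has infinitely many Nash equilibria).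
   Context: Sectors: for $k=1,\dots,8$, $\mathcal{A}_k=\{\rho(\cos\theta,\sin\theta)\in\mathbb{R}^2 : \rho>0,\ \theta\in\,](k-1)\pi/4,\ k\pi/4[\,\}$. Admissible solution: a function $u=(u_1,u_2):\mathbb{R}\to\mathbb{R}^2$ is an admissible solution of the displayed system if: (A1) $u$ is absolutely continuous (on bounded intervals) and its derivative $u'$ satisfies the system at a.e. $x\in\mathbb{R}$; (A2) there is a constant $C$ such that $|u(x)|\le C(1+|x|)$ for all $x\in\mathbb{R}$; (A3) at every $y\in\mathbb{R}$ the derivative $u'$ admits right and left limits $u'(y+)$, $u'(y-)$, and at points where $u'$ is discontinuous these limits satisfy at least one of the conditions $u_1'(y+)+u_2'(y+)\le 0$ or $u_1'(y-)+u_2'(y-)\ge 0$. Game: two players; player $i$ chooses a control $t\mapsto\alpha_i(t)$, $t\in[0,\infty[$, with values in a compact set $U_i\subset\mathbb{R}$ of admissible control values (taken large enough to contain all values $-u_i'(x)$ of the feedback under consideration), so as to minimize $J_i$. A pair of feedback strategies $(\alpha_1^*(x),\alpha_2^*(x))$ is a Nash equilibrium solution in feedback form if, for every initial datum $y\in\mathbb{R}$, the Cauchy problem $\dot x=\alpha_1^*(x)+\alpha_2^*(x)$, $x(0)=y$, has at least one Carathéodory solution (an absolutely continuous function satisfying the equation for a.e. $t>0$) defined for all $t\in[0,\infty[$, and, for every such solution and each $i\in\{1,2\}$, the cost to player $i$ along it equals the minimum of $J_i$ over controls $\alpha_i(\cdot)$ with values in $U_i$ for the dynamics $\dot x=\alpha_i(t)+\alpha_j^*(x)$,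 $x(0)=y$, $j\ne i$. *)

theory Defs
  imports "HOL-Analysis.Analysis"
begin

definition sector :: "nat \<Rightarrow> (real \<times> real) set" where
  "sector k = {(\<rho> * cos \<theta>, \<rho> * sin \<theta>) | \<rho> \<theta>.
     \<rho> > 0 \<and> (real k - 1) * pi / 4 < \<theta> \<and> \<theta> < real k * pi / 4}"

(* Absolute continuity of a function (the library has it only for measures). The elements of
   a division are nonoverlapping compact intervals [Inf k, Sup k]. *)
definition abs_continuous_on :: "real set \<Rightarrow> (real \<Rightarrow> 'a::real_normed_vector) \<Rightarrow> bool" where
  "abs_continuous_on S f \<longleftrightarrow>
     (\<forall>\<epsilon>>0. \<exists>\<delta>>0. \<forall>D. D division_of (\<Union>D) \<and> \<Union>D \<subseteq> S \<and> (\<Sum>k\<in>D. Sup k - Inf k) < \<delta>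
        \<longrightarrow> (\<Sum>k\<in>D. norm (f (Sup k) - f (Inf k))) < \<epsilon>)"

(* u'(y+) = l and u'(y-) = l, where u' is defined only at the points of differentiability of u.
   For absolutely continuous u these points are dense, so that l is unique. *)
definition deriv_limit_right :: "(real \<Rightarrow> 'a::real_normed_vector) \<Rightarrow> real \<Rightarrow> 'a \<Rightarrow> bool" where
  "deriv_limit_right u y l \<longleftrightarrow>
     ((\<lambda>x. vector_derivative u (at x)) \<longlongrightarrow> l) (at y within {x. y < x \<and> u differentiable (at x)})"

definition deriv_limit_left :: "(real \<Rightarrow> 'a::real_normed_vector) \<Rightarrow> real \<Rightarrow> 'a \<Rightarrow> bool" where
  "deriv_limit_left u y l \<longleftrightarrow>
     ((\<lambda>x. vector_derivative u (at x)) \<longlongrightarrow> l) (at y within {x. x < y \<and> u differentiable (at x)})"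

(* In the last clause, u' is discontinuous at y when its two one-sided limits differ: if they
   coincide, an absolutely continuous u is differentiable at y and its derivative there is
   their common value. *)
definition admissible_solution ::
  "(real \<Rightarrow> real) \<Rightarrow> (real \<Rightarrow> real) \<Rightarrow> (real \<Rightarrow> real \<times> real) \<Rightarrow> bool" where
  "admissible_solution h1 h2 u \<longleftrightarrow>
     (\<forall>a b. abs_continuous_on {a..b} u) \<and>
     (AE x in lebesgue. \<exists>p1 p2. (u has_vector_derivative (p1, p2)) (at x) \<and>
        fst (u x) = h1 x - p1 * p2 - p1\<^sup>2 / 2 \<and>
        snd (u x) = h2 x - p1 * p2 - p2\<^sup>2 / 2) \<and>
     (\<exists>C. \<forall>x. norm (u x) \<le> C * (1 + \<bar>x\<bar>)) \<and>
     (\<forall>y. \<exists>l1 l2 r1 r2. deriv_limit_left u y (l1, l2) \<and> deriv_limit_right u y (r1, r2) \<and>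
        ((l1, l2) \<noteq> (r1, r2) \<longrightarrow> r1 + r2 \<le> 0 \<or> l1 + l2 \<ge> 0))"

(* The feedback (alpha1, alpha2) = -u'. At a point where u' jumps, u' stands for either of its
   one-sided limits (the same one for both components); elsewhere the two alternatives agree.
   The values at the jumps matter, because a trajectory may rest there. *)
definition feedback_of ::
  "(real \<Rightarrow> real \<times> real) \<Rightarrow> (real \<Rightarrow> real) \<Rightarrow> (real \<Rightarrow> real) \<Rightarrow> bool" where
  "feedback_of u \<alpha>1 \<alpha>2 \<longleftrightarrow>
     (\<forall>x. deriv_limit_left u x (- \<alpha>1 x, - \<alpha>2 x) \<or> deriv_limit_right u x (- \<alpha>1 x, - \<alpha>2 x))"

definition caratheodory_solution ::
  "(real \<Rightarrow> real \<Rightarrow> real) \<Rightarrow> real \<Rightarrow> (real \<Rightarrow> real) \<Rightarrow> bool" where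
  "caratheodory_solution f y x \<longleftrightarrow>
     x 0 = y \<and> (\<forall>T. abs_continuous_on {0..T} x) \<and>
     (AE t in lebesgue. t > 0 \<longrightarrow> (x has_real_derivative f t (x t)) (at t))"

definition control :: "real set \<Rightarrow> (real \<Rightarrow> real) \<Rightarrow> bool" where
  "control U a \<longleftrightarrow> set_borel_measurable lebesgue {0..} a \<and> (\<forall>t\<ge>0. a t \<in> U)"

definition cost :: "(real \<Rightarrow> real) \<Rightarrow> (real \<Rightarrow> real) \<Rightarrow> (real \<Rightarrow> real) \<Rightarrow> real" where
  "cost h a x = (LINT t:{0..}|lebesgue. exp (- t) * (h (x t) + (a t)\<^sup>2 / 2))"

(* Costs that a player with running cost h and control set U can achieve from y when the other
   player uses the feedback \<beta>. As \<beta> may be discontinuous, a control may have no trajectory or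
   several ones; all pairs of a control and a trajectory are taken into account. *)
definition attainable_costs ::
  "(real \<Rightarrow> real) \<Rightarrow> real set \<Rightarrow> (real \<Rightarrow> real) \<Rightarrow> real \<Rightarrow> real set" where
  "attainable_costs h U \<beta> y =
     {cost h a x | a x. control U a \<and> caratheodory_solution (\<lambda>t z. a t + \<beta> z) y x}"

definition is_minimum :: "real \<Rightarrow> real set \<Rightarrow> bool" where
  "is_minimum m S \<longleftrightarrow> m \<in> S \<and> (\<forall>c\<in>S. m \<le> c)"

definition nash_feedback ::
  "(real \<Rightarrow> real) \<Rightarrow> (real \<Rightarrow> real) \<Rightarrow> real set \<Rightarrow> real set \<Rightarrow> (real \<Rightarrow> real) \<Rightarrow> (real \<Rightarrow> real) \<Rightarrow> bool" where
  "nash_feedback h1 h2 U1 U2 \<alpha>1 \<alpha>2 \<longleftrightarrow>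
     (\<forall>x. \<alpha>1 x \<in> U1 \<and> \<alpha>2 x \<in> U2) \<and>
     (\<forall>y. (\<exists>x. caratheodory_solution (\<lambda>t z. \<alpha>1 z + \<alpha>2 z) y x) \<and>
       (\<forall>x. caratheodory_solution (\<lambda>t z. \<alpha>1 z + \<alpha>2 z) y x \<longrightarrow>
          is_minimum (cost h1 (\<lambda>t. \<alpha>1 (x t)) x) (attainable_costs h1 U1 \<alpha>2 y) \<and>
          is_minimum (cost h2 (\<lambda>t. \<alpha>2 (x t)) x) (attainable_costs h2 U2 \<alpha>1 y)))"

end

theory Submission
  imports Defs
begin

text \<open>Write \<open>p = u'\<close> and \<open>w = h - u = (p\<^sub>1 p\<^sub>2 + p\<^sub>1\<^sup>2/2, p\<^sub>1 p\<^sub>2 + p\<^sub>2\<^sup>2/2)\<close>. This quadratic map is two-to-one, so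
  \<open>p\<close> can only jump to \<open>- p\<close>, jumps are isolated, and \<open>\<bar>p\<bar>\<close> is continuous. On each half-line
  \<open>w' = \<kappa> - p\<close>, so for large \<open>\<bar>p\<bar>\<close> the sum \<open>p\<^sub>1 + p\<^sub>2\<close> decreases at a definite rate, and admissible
  jumps decrease it further. If it became too negative, \<open>u\<close> would grow quadratically; hence \<open>\<bar>p\<bar>\<close>
  is large only on intervals of bounded length, and every admissible \<open>u\<close> has bounded derivative.

  The equilibrium property is a completion of squares: along any trajectory of \<open>x' = a + \<alpha>\<^sub>2(x)\<close>,
  \<open>e\<^sup>-\<^sup>t (h\<^sub>1 + a\<^sup>2/2) = - (e\<^sup>-\<^sup>t u\<^sub>1)' + e\<^sup>-\<^sup>t (a - \<alpha>\<^sub>1)\<^sup>2/2\<close> almost everywhere, including the times spent at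
  a jump, where \<open>x' = 0\<close>. Closed-loop trajectories come from separation of variables, the
  admissibility condition forcing a trajectory that reaches a jump to be able to rest there.

  For existence, \<open>p\<close> solves a planar ODE on each half-line with a sink at \<open>\<kappa>\<close> and, after a time
  change, a saddle at the origin. The stable directions of the two saddles depend on
  \<open>\<kappa>\<^sub>2/\<kappa>\<^sub>1\<close> only and are different by assumption, so there is a sector of small initial values
  \<open>p(0)\<close> that lies on the good side of both, and each of them yields a \<open>C\<^sup>1\<close> solution.\<close>

section \<open>Absolutely continuous functions\<close>

text \<open>Two obstacles shape the route. The derivative is prescribed only almost everywhere and
  may jump, so \<open>p\<close> cannot be treated as the solution of an ODE. The limits in (A3) do
  force one-sided derivatives at every point, and all estimates are run on right derivatives and
  right increments, with jumps entering as a one-sided inequality. The equilibrium needs a bounded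
  derivative: it provides compact control sets and globally Lipschitz values, whereas linear growth
  of \<open>u\<close> alone gives only \<open>p\<close> of order \<open>sqrt \<bar>x\<bar>\<close>.
  On a stretch of bounded length the estimate closes on itself: \<open>w\<close> moves by at most a
  multiple of the maximum of \<open>p\<close>, while the square of that maximum is at most linear in
  \<open>w\<close>. The form \<open>p1\<^sup>2 + p1 * p2 + p2\<^sup>2\<close> recurs because it is
  the Jacobian determinant of \<open>p \<mapsto> w\<close>. Up to a constant it is a modulus of
  \<open>w\<close>, it is the denominator in the formula for the derivative of \<open>p\<close>, and
  it is the time change that makes the origin a saddle. Two symmetries halve the work: reflection of
  the line, which negates \<open>p\<close>, and exchange of the players.\<close>

lemma sum_content_division_le_measure:
  fixes T :: "real set"
  assumes "\<D> division_of \<Union>\<D>" "\<Union>\<D> \<subseteq> T" "T \<in> lmeasurable"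
  shows "sum (measure lborel) \<D> \<le> measure lebesgue T"
proof -
  note d = division_ofD[OF assms(1)]
  have conv: "convex K" and meas: "K \<in> lmeasurable" if "K \<in> \<D>" for K
    using d(4)[OF that] by auto
  have "(\<Sum>K\<in>\<D>. measure lebesgue K) = measure lebesgue (\<Union>\<D>)"
  proof (rule measure_negligible_finite_Union[symmetric])
    show "pairwise (\<lambda>S T. negligible (S \<inter> T)) \<D>"
    proof (clarsimp simp: pairwise_def)
      fix K L assume "K \<in> \<D>" "L \<in> \<D>" "K \<noteq> L"
      then show "negligible (K \<inter> L)"
        using d(5)[of K L] conv by (simp add: negligible_convex_interior convex_Int)
    qed
  qed (use d meas in auto)
  also have "\<dots> \<le> measure lebesgue T"
  proof (rule measure_mono_fmeasurable[OF assms(2) _ assms(3)])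
    show "\<Union>\<D> \<in> sets lebesgue"
      using fmeasurable.finite_Union[OF d(1)] meas by (meson fmeasurableD subsetI)
  qed
  moreover have "measure lborel K = measure lebesgue K" if "K \<in> \<D>" for K
    using d(4)[OF that] by auto
  ultimately show ?thesis by simp
qed

lemma negligible_outer_open:
  fixes N :: "real set"
  assumes "negligible N" "0 < \<delta>"
  obtains T where "open T" "N \<subseteq> T" "T \<in> lmeasurable" "measure lebesgue T < \<delta>"
proof -
  have "N \<in> sets lebesgue"
    using assms(1) negligible_imp_sets by blast
  then obtain T where T: "open T" "N \<subseteq> T" "T - N \<in> lmeasurable"
      "emeasure lebesgue (T - N) < ennreal \<delta>"
    using sets_lebesgue_outer_open assms(2) by blast
  have N: "N \<in> null_sets lebesgue"
    using assms(1) negligible_iff_null_sets by blast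
  have "(T - N) \<union> N \<in> lmeasurable"
    using T(3) fmeasurableI_null_sets[OF N] by (rule fmeasurable.Un)
  moreover have "(T - N) \<union> N = T" using T(2) by auto
  ultimately have "T \<in> lmeasurable" by simp
  moreover have "measure lebesgue T = measure lebesgue (T - N)"
    using N \<open>T \<in> lmeasurable\<close> by (simp add: measure_Diff_null_set fmeasurableD)
  moreover have "measure lebesgue (T - N) < \<delta>"
    using T(4) assms(2) unfolding emeasure_eq_measure2[OF T(3)] by (simp add: ennreal_less_iff)
  ultimately show thesis using T that by auto
qed

lemma division_of_Inf_Sup:
  fixes \<D> :: "real set set"
  assumes "\<D> division_of S" "K \<in> \<D>"
  shows "K = {Inf K..Sup K}" "Inf K \<le> Sup K"
proof -
  obtain a b where "K = cbox a b"
    using division_ofD(4)[OF assms] by blast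
  then have "K = {a..b}" "a \<le> b"
    using division_ofD(3)[OF assms] by auto
  then show "K = {Inf K..Sup K}" "Inf K \<le> Sup K" by auto
qed

text \<open>A gauge argument, in which integrability of \<open>f'\<close> is part of the conclusion.
  Off \<open>N\<close> the gauge is the radius of differentiability. At tags in \<open>N\<close> it
  is an open set of small measure around \<open>N\<close>, and absolute continuity makes the
  increments of \<open>f\<close> over those intervals small in total. \<open>g\<close> is 0 on
  \<open>N\<close>, so such tags contribute nothing but these increments.\<close>

theorem abs_continuous_on_FTC:
  fixes f :: "real \<Rightarrow> 'a::banach"
  assumes ab: "a \<le> b" and ac: "abs_continuous_on {a..b} f" and N: "negligible N"
    and der: "\<And>x. x \<in> {a..b} - N \<Longrightarrow> (f has_vector_derivative f' x) (at x within {a..b})"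
  shows "(f' has_integral (f b - f a)) {a..b}"
proof -
  define g where "g x = (if x \<in> N then 0 else f' x)" for x
  have "(g has_integral (f b - f a)) {a..b}"
    unfolding has_integral_real
  proof (intro allI impI)
    fix e :: real assume e: "e > 0"
    \<comment> \<open>The added 1 keeps the denominator positive when \<open>a = b\<close>.\<close>
    define \<eta> where "\<eta> = e / (4 * (b - a + 1))"
    have \<eta>: "\<eta> > 0" using e ab by (simp add: \<eta>_def)
    have "\<exists>d>0. \<forall>y\<in>{a..b}. \<bar>y - x\<bar> < d \<longrightarrow> norm (f y - f x - (y - x) *\<^sub>R f' x) \<le> \<eta> * \<bar>y - x\<bar>"
      if "x \<in> {a..b} - N" for x
      using der[OF that] \<eta>
      unfolding has_vector_derivative_def has_derivative_within_alt by auto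
    then obtain d where d: "\<And>x. x \<in> {a..b} - N \<Longrightarrow> d x > 0"
      "\<And>x y. x \<in> {a..b} - N \<Longrightarrow> y \<in> {a..b} \<Longrightarrow> \<bar>y - x\<bar> < d x
         \<Longrightarrow> norm (f y - f x - (y - x) *\<^sub>R f' x) \<le> \<eta> * \<bar>y - x\<bar>"
      by metis
    obtain \<delta> where \<delta>: "\<delta> > 0"
      "\<And>D. D division_of (\<Union>D) \<Longrightarrow> \<Union>D \<subseteq> {a..b} \<Longrightarrow> (\<Sum>k\<in>D. Sup k - Inf k) < \<delta>
        \<Longrightarrow> (\<Sum>k\<in>D. norm (f (Sup k) - f (Inf k))) < e / 2"
      using ac e unfolding abs_continuous_on_def by (meson half_gt_zero)
    obtain T where T: "open T" "N \<subseteq> T" "T \<in> lmeasurable" "measure lebesgue T < \<delta>"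
      using negligible_outer_open[OF N \<delta>(1)] .
    define \<gamma> where "\<gamma> x = (if x \<in> N then T else ball x (if x \<in> {a..b} then d x else 1))" for x
    have gauge: "gauge \<gamma>"
      using T d(1) unfolding gauge_def \<gamma>_def by auto
    have "norm ((\<Sum>(x, K)\<in>p. measure lborel K *\<^sub>R g x) - (f b - f a)) < e"
      if p: "p tagged_division_of {a..b}" and fine: "\<gamma> fine p" for p
    proof -
      note pd = tagged_division_ofD[OF p]
      have intv: "K = {Inf K..Sup K} \<and> Inf K \<le> x \<and> x \<le> Sup K \<and> Inf K \<in> {a..b} \<and> Sup K \<in> {a..b} \<and> measure lborel K = Sup K - Inf K"
        if xK: "(x, K) \<in> p" for x K
      proof -
        obtain u v where uv: "K = {u..v}" using pd(4)[OF xK] by (metis box_real(2))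
        with pd(2)[OF xK] pd(3)[OF xK] show ?thesis by auto
      qed
      let ?d = "\<lambda>K. f (Sup K) - f (Inf K)"
      define q where "q = {(x, K) \<in> p. x \<in> N}"
      have qp: "q \<subseteq> p" and fq: "finite q" using pd(1) by (auto simp: q_def intro: finite_subset)
      have tq: "q tagged_partial_division_of {a..b}"
        using p qp by (meson tagged_division_of_def tagged_partial_division_subset)
      let ?D = "snd ` q"
      have Ddiv: "?D division_of \<Union>?D" by (rule partial_division_of_tagged_division[OF tq])
      have DT: "\<Union>?D \<subseteq> T"
        using fine qp by (fastforce simp: q_def fine_def \<gamma>_def)
      have Dab: "\<Union>?D \<subseteq> {a..b}" using pd(3) qp by fastforce
      have "(\<Sum>K\<in>?D. Sup K - Inf K) = sum (measure lborel) ?D"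
        using intv qp by (intro sum.cong) auto
      also have "\<dots> < \<delta>"
        using sum_content_division_le_measure[OF Ddiv DT T(3)] T(4) by simp
      finally have "(\<Sum>K\<in>?D. norm (?d K)) < e / 2"
        using \<delta>(2)[OF Ddiv Dab] by simp
      moreover have "(\<Sum>(x, K)\<in>q. norm (?d K)) = (\<Sum>K\<in>?D. norm (?d K))"
      proof -
        \<comment> \<open>Passing from tagged pairs to intervals requires a summand that vanishes on
          every box with empty interior, including the empty one, where \<open>Inf\<close> and
          \<open>Sup\<close> carry no information.\<close>
        let ?e = "\<lambda>K. if K = {} then 0 else norm (?d K)"
        have "(\<Sum>(x, K)\<in>q. norm (?d K)) = (\<Sum>(x, K)\<in>q. ?e K)"
          using qp pd(2) by (intro sum.cong) (auto, metis empty_iff subsetD)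
        also have "\<dots> = (\<Sum>K\<in>?D. ?e K)"
          by (rule sum.over_tagged_division_lemma[OF tagged_partial_division_of_Union_self[OF tq]])
             (auto simp: box_eq_empty not_less)
        also have "\<dots> = (\<Sum>K\<in>?D. norm (?d K))"
          using qp pd(2) by (intro sum.cong) (auto, metis empty_iff subsetD)
        finally show ?thesis .
      qed
      ultimately have 1: "(\<Sum>(x, K)\<in>q. norm (?d K)) < e / 2" by simp
      have 2: "(\<Sum>(x, K)\<in>p - q. norm (measure lborel K *\<^sub>R g x - ?d K)) \<le> (\<Sum>(x, K)\<in>p - q. \<eta> * measure lborel K)"
      proof (rule sum_mono, clarify)
        fix x K assume xK: "(x, K) \<in> p" "(x, K) \<notin> q"
        then have x: "x \<notin> N" "x \<in> {a..b}" using pd(2,3)[OF xK(1)] by (auto simp: q_def)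
        define u v where "u = Inf K" and "v = Sup K"
        have i: "K = {u..v}" "u \<le> x" "x \<le> v" "u \<in> {a..b}" "v \<in> {a..b}" "measure lborel K = v - u"
          using intv[OF xK(1)] by (simp_all add: u_def v_def)
        have "{u..v} \<subseteq> ball x (d x)" using fineD[OF fine xK(1)] x i(1) by (simp add: \<gamma>_def)
        then have "v \<in> ball x (d x)" "u \<in> ball x (d x)"
          using i(2,3) by (meson atLeastAtMost_iff order_refl order_trans subsetD)+
        then have "\<bar>v - x\<bar> < d x" "\<bar>u - x\<bar> < d x"
          by (auto simp: dist_real_def)
        then have "norm (f v - f x - (v - x) *\<^sub>R f' x) \<le> \<eta> * (v - x)"
            "norm (f u - f x - (u - x) *\<^sub>R f' x) \<le> \<eta> * (x - u)"
          using d(2)[of x v] d(2)[of x u] x i(2-5) by auto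
        moreover have "measure lborel K *\<^sub>R g x - ?d K
            = (f u - f x - (u - x) *\<^sub>R f' x) - (f v - f x - (v - x) *\<^sub>R f' x)"
          by (simp add: g_def x i(6) flip: u_def v_def) (simp add: algebra_simps)
        ultimately have "norm (measure lborel K *\<^sub>R g x - ?d K) \<le> \<eta> * (x - u) + \<eta> * (v - x)"
          by (simp only:, intro norm_triangle_le_diff, linarith)
        moreover have "\<eta> * (x - u) + \<eta> * (v - x) = \<eta> * measure lborel K"
          unfolding i(6) by (simp add: algebra_simps)
        ultimately show "norm (measure lborel K *\<^sub>R g x - ?d K) \<le> \<eta> * measure lborel K"
          by simp
      qed
      have tot: "(\<Sum>(x, K)\<in>p. measure lborel K) = b - a"
        unfolding additive_content_tagged_division[of p a b, unfolded box_real, OF p] using ab by simp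
      have "(\<Sum>(x, K)\<in>p - q. \<eta> * measure lborel K) \<le> (\<Sum>(x, K)\<in>p. \<eta> * measure lborel K)"
        using pd(1) \<eta> by (intro sum_mono2) auto
      also have "\<dots> = \<eta> * (\<Sum>(x, K)\<in>p. measure lborel K)"
        by (simp add: sum_distrib_left case_prod_beta)
      also have "\<dots> = \<eta> * (b - a)" unfolding tot ..
      also have "\<dots> \<le> \<eta> * (b - a + 1)" using \<eta> by (intro mult_left_mono) auto
      also have "\<dots> = e / 4"
      proof -
        have "e / (4 * c) * c = e / 4" if "c > 0" for c using that by simp
        from this[of "b - a + 1"] show ?thesis using ab by (simp add: \<eta>_def del: times_divide_eq_left)
      qed
      also have "\<dots> < e / 2" using e by simp
      finally have 3: "(\<Sum>(x, K)\<in>p - q. norm (measure lborel K *\<^sub>R g x - ?d K)) < e / 2"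
        using 2 by simp
      have 4: "(\<Sum>(x, K)\<in>q. norm (measure lborel K *\<^sub>R g x - ?d K)) = (\<Sum>(x, K)\<in>q. norm (?d K))"
        by (rule sum.cong) (auto simp: q_def g_def norm_minus_commute)
      have "(\<Sum>(x, K)\<in>p. measure lborel K *\<^sub>R g x) - (f b - f a)
          = (\<Sum>(x, K)\<in>p. measure lborel K *\<^sub>R g x - ?d K)"
        using additive_tagged_division_1[OF ab p, of f] by (simp add: sum_subtractf case_prod_beta)
      also have "norm \<dots> \<le> (\<Sum>(x, K)\<in>p. norm (measure lborel K *\<^sub>R g x - ?d K))"
        using norm_sum[of "\<lambda>(x, K). measure lborel K *\<^sub>R g x - ?d K" p] by (simp add: case_prod_beta)
      also have "\<dots> = (\<Sum>(x, K)\<in>p - q. norm (measure lborel K *\<^sub>R g x - ?d K)) + (\<Sum>(x, K)\<in>q. norm (measure lborel K *\<^sub>R g x - ?d K))"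
        using sum.subset_diff[OF qp pd(1)] .
      also have "\<dots> < e" using 1 3 4 by simp
      finally show ?thesis .
    qed
    then show "\<exists>\<gamma>. gauge \<gamma> \<and> (\<forall>\<D>. \<D> tagged_division_of {a..b} \<and> \<gamma> fine \<D> \<longrightarrow>
        norm ((\<Sum>(x, k)\<in>\<D>. measure lborel k *\<^sub>R g x) - (f b - f a)) < e)"
      using gauge by blast
  qed
  then show ?thesis
    by (rule has_integral_spike[OF N, rotated]) (auto simp: g_def)
qed

lemma lipschitz_on_imp_abs_continuous_on:
  fixes f :: "real \<Rightarrow> 'a::real_normed_vector"
  assumes L: "\<And>x y. x \<in> S \<Longrightarrow> y \<in> S \<Longrightarrow> norm (f x - f y) \<le> L * \<bar>x - y\<bar>"
  shows "abs_continuous_on S f"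
  unfolding abs_continuous_on_def
proof (intro allI impI)
  fix \<epsilon> :: real assume "\<epsilon> > 0"
  define M where "M = \<bar>L\<bar> + 1"
  have M: "M > 0" "L \<le> M" by (auto simp: M_def)
  have "(\<Sum>k\<in>D. norm (f (Sup k) - f (Inf k))) < \<epsilon>"
    if D: "D division_of (\<Union>D)" "\<Union>D \<subseteq> S" "(\<Sum>k\<in>D. Sup k - Inf k) < \<epsilon> / M" for D
  proof -
    have "(\<Sum>k\<in>D. norm (f (Sup k) - f (Inf k))) \<le> (\<Sum>k\<in>D. M * (Sup k - Inf k))"
    proof (rule sum_mono)
      fix k assume k: "k \<in> D"
      note i = division_of_Inf_Sup[OF D(1) k]
      then have "Sup k \<in> S" "Inf k \<in> S" using D(2) k by (metis Sup_upper atLeastAtMost_iff in_mono order_refl)+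
      then have "norm (f (Sup k) - f (Inf k)) \<le> L * (Sup k - Inf k)"
        using L[of "Sup k" "Inf k"] i by simp
      also have "\<dots> \<le> M * (Sup k - Inf k)" using M i by (intro mult_right_mono) auto
      finally show "norm (f (Sup k) - f (Inf k)) \<le> M * (Sup k - Inf k)" .
    qed
    also have "\<dots> = M * (\<Sum>k\<in>D. Sup k - Inf k)" by (simp add: sum_distrib_left)
    also have "\<dots> < \<epsilon>" using D(3) M by (simp add: field_simps)
    finally show ?thesis .
  qed
  then show "\<exists>\<delta>>0. \<forall>D. D division_of \<Union> D \<and> \<Union> D \<subseteq> S \<and> (\<Sum>k\<in>D. Sup k - Inf k) < \<delta> \<longrightarrow>
      (\<Sum>k\<in>D. norm (f (Sup k) - f (Inf k))) < \<epsilon>"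
    using \<open>\<epsilon> > 0\<close> M by (intro exI[of _ "\<epsilon> / M"]) auto
qed

lemma abs_continuous_on_subset:
  "abs_continuous_on S f \<Longrightarrow> T \<subseteq> S \<Longrightarrow> abs_continuous_on T f"
  unfolding abs_continuous_on_def by (meson order_trans)

lemma abs_continuous_on_imp_continuous_on:
  fixes f :: "real \<Rightarrow> 'a::real_normed_vector"
  assumes ac: "abs_continuous_on {a..b} f"
  shows "continuous_on {a..b} f"
  unfolding continuous_on_iff
proof (intro ballI allI impI)
  fix x e assume x: "x \<in> {a..b}" and e: "(0::real) < e"
  obtain \<delta> where \<delta>: "\<delta> > 0"
      "\<And>D. D division_of (\<Union>D) \<Longrightarrow> \<Union>D \<subseteq> {a..b} \<Longrightarrow> (\<Sum>k\<in>D. Sup k - Inf k) < \<delta>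
        \<Longrightarrow> (\<Sum>k\<in>D. norm (f (Sup k) - f (Inf k))) < e"
    using ac e unfolding abs_continuous_on_def by meson
  have *: "norm (f v - f u) < e" if "u \<in> {a..b}" "v \<in> {a..b}" "u \<le> v" "v - u < \<delta>" for u v
  proof -
    have "{{u..v}} division_of \<Union>{{u..v}}"
      using that division_of_self[of u v] by simp
    then show ?thesis using \<delta>(2)[of "{{u..v}}"] that by auto
  qed
  show "\<exists>d>0. \<forall>x'\<in>{a..b}. dist x' x < d \<longrightarrow> dist (f x') (f x) < e"
  proof (intro exI conjI ballI impI)
    show "\<delta> > 0" by fact
    fix x' assume "x' \<in> {a..b}" "dist x' x < \<delta>"
    then show "dist (f x') (f x) < e"
      using *[of x x'] *[of x' x] x
      by (cases "x \<le> x'") (auto simp: dist_norm norm_minus_commute)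
  qed
qed

text \<open>Integrates \<open>f' - c\<close>. With \<open>c = 0\<close> this is the Lipschitz bound
  for trajectories; with \<open>c\<close> a limit of derivatives it controls the increments of
  \<open>u\<close> on one side of a point.\<close>

lemma abs_continuous_on_derivative_bound:
  fixes f :: "real \<Rightarrow> 'a::euclidean_space"
  assumes ab: "a \<le> b" and ac: "abs_continuous_on {a..b} f"
    and der: "AE x in lebesgue. x \<in> {a<..<b} \<longrightarrow>
      (\<exists>d. (f has_vector_derivative d) (at x) \<and> norm (d - c) \<le> B)"
    and B: "0 \<le> B"
  shows "norm (f b - f a - (b - a) *\<^sub>R c) \<le> B * (b - a)"
proof -
  obtain N where N: "N \<in> null_sets lebesgue"
    "\<And>x. x \<notin> N \<Longrightarrow> x \<in> {a<..<b} \<Longrightarrow> \<exists>d. (f has_vector_derivative d) (at x) \<and> norm (d - c) \<le> B"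
    using AE_E3[OF der] by (auto simp: space_completion)
  define N' where "N' = N \<union> {a, b}"
  have N': "negligible N'"
    using N(1) unfolding N'_def negligible_iff_null_sets[symmetric] by (intro negligible_Un) auto
  obtain f' where f': "\<And>x. x \<notin> N' \<Longrightarrow> x \<in> {a<..<b} \<Longrightarrow>
      (f has_vector_derivative f' x) (at x) \<and> norm (f' x - c) \<le> B"
    using N(2) unfolding N'_def by (metis UnCI)
  have ran: "x \<in> {a<..<b}" if "x \<in> {a..b} - N'" for x
    using that by (auto simp: N'_def less_le)
  have "(f' has_integral (f b - f a)) {a..b}"
    by (rule abs_continuous_on_FTC[OF ab ac N'])
       (use f' ran in \<open>auto intro: has_vector_derivative_at_within\<close>)
  moreover have "((\<lambda>x. c) has_integral (b - a) *\<^sub>R c) {a..b}"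
    using has_integral_const_real[of c a b] ab by simp
  ultimately have "((\<lambda>x. f' x - c) has_integral (f b - f a - (b - a) *\<^sub>R c)) {a..b}"
    by (rule has_integral_diff)
  then have I: "((\<lambda>x. if x \<in> N' then 0 else f' x - c) has_integral (f b - f a - (b - a) *\<^sub>R c)) {a..b}"
    by (rule has_integral_spike[OF N', rotated]) auto
  have bnd: "norm (if x \<in> N' then 0 else f' x - c) \<le> B" if "x \<in> {a..b} - {}" for x
    using f'[of x] ran[of x] B that by (cases "x \<in> N'") auto
  show ?thesis using has_integral_bound_real[OF B finite.emptyI I bnd] ab by simp
qed

section \<open>Flows of Lipschitz vector fields\<close>

text \<open>The weight \<open>exp (- 2 L t)\<close> makes the Picard operator a contraction on the whole
  half-line, so that no continuation argument is needed.\<close>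

theorem lipschitz_flow_exists:
  fixes f :: "'a::euclidean_space \<Rightarrow> 'a"
  assumes f: "\<And>x y. norm (f x - f y) \<le> L * norm (x - y)" and L: "L > 0"
  obtains x where "x 0 = x0" "\<And>t. t \<ge> 0 \<Longrightarrow> (x has_vector_derivative f (x t)) (at t within {0..})"
proof -
  define \<alpha> where "\<alpha> = 2 * L"
  have \<alpha>: "\<alpha> > 0" using L by (simp add: \<alpha>_def)
  have contf: "continuous_on UNIV f"
  proof (rule lipschitz_on_continuous_on[of L])
    show "L-lipschitz_on UNIV f" using f L by (auto simp: lipschitz_on_def dist_norm)
  qed
  \<comment> \<open>The unknown is \<open>g t = exp (- \<alpha> * t) *\<^sub>R x t\<close>, hence
    the factor in front of \<open>g s\<close>. Since \<open>\<alpha> = 2 * L\<close>, integrating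
    the Lipschitz bound against \<open>exp (\<alpha> * s)\<close> produces the contraction constant
    \<open>L / \<alpha> = 1 / 2\<close>.\<close>
  define G where "G g t = integral {0..t} (\<lambda>s. f (exp (\<alpha> * s) *\<^sub>R apply_bcontfun g s))" for g :: "real \<Rightarrow>\<^sub>C 'a" and t
  have contI: "continuous_on {0..t} (\<lambda>s. f (exp (\<alpha> * s) *\<^sub>R apply_bcontfun g s))" for g t
    by (intro continuous_on_compose2[OF contf] continuous_intros) auto
  have expint: "((\<lambda>s. c * exp (\<alpha> * s)) has_integral (c / \<alpha> * (exp (\<alpha> * t) - 1))) {0..t}" if "0 \<le> t" for t c
  proof -
    have "((\<lambda>s. c * exp (\<alpha> * s)) has_integral (c / \<alpha> * exp (\<alpha> * t) - c / \<alpha> * exp (\<alpha> * 0))) {0..t}"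
      using \<alpha> that by (intro fundamental_theorem_of_calculus)
        (auto intro!: derivative_eq_intros simp flip: has_real_derivative_iff_has_vector_derivative)
    then show ?thesis by (simp add: algebra_simps)
  qed
  have Gdiff: "norm (G g t - G g' t) \<le> 1/2 * dist g g' * exp (\<alpha> * t)" if t: "0 \<le> t" for g g' t
  proof -
    have "norm (G g t - G g' t) = norm (integral {0..t} (\<lambda>s. f (exp (\<alpha> * s) *\<^sub>R apply_bcontfun g s) - f (exp (\<alpha> * s) *\<^sub>R apply_bcontfun g' s)))"
      unfolding G_def
      by (subst Henstock_Kurzweil_Integration.integral_diff) (auto intro: integrable_continuous_real contI)
    also have "\<dots> \<le> integral {0..t} (\<lambda>s. L * dist g g' * exp (\<alpha> * s))"
    proof (rule integral_norm_bound_integral)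
      fix s assume "s \<in> {0..t}"
      have "norm (f (exp (\<alpha> * s) *\<^sub>R apply_bcontfun g s) - f (exp (\<alpha> * s) *\<^sub>R apply_bcontfun g' s))
          \<le> L * (exp (\<alpha> * s) * norm (apply_bcontfun g s - apply_bcontfun g' s))"
        by (rule order_trans[OF f]) (simp flip: scaleR_diff_right)
      also have "\<dots> \<le> L * (exp (\<alpha> * s) * dist g g')"
        using L dist_bounded[of g s g'] by (intro mult_left_mono) (auto simp: dist_norm)
      finally show "norm (f (exp (\<alpha> * s) *\<^sub>R apply_bcontfun g s) - f (exp (\<alpha> * s) *\<^sub>R apply_bcontfun g' s))
          \<le> L * dist g g' * exp (\<alpha> * s)" by (simp add: mult_ac)
    qed (auto intro!: integrable_continuous_real continuous_intros contI)
    also have "\<dots> = L * dist g g' / \<alpha> * (exp (\<alpha> * t) - 1)"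
      by (rule integral_unique[OF expint[OF t]])
    also have "L * dist g g' / \<alpha> = 1/2 * dist g g'"
      using L by (simp add: \<alpha>_def)
    also have "1/2 * dist g g' * (exp (\<alpha> * t) - 1) \<le> 1/2 * dist g g' * exp (\<alpha> * t)"
      by (intro mult_left_mono) auto
    finally show ?thesis .
  qed
  have G0: "G 0 t = t *\<^sub>R f 0" if "0 \<le> t" for t
    unfolding G_def zero_bcontfun.rep_eq using that by simp
  have contG: "continuous_on {0..} (G g)" for g
  proof (rule continuous_on_subset[of "{-1<..}"])
    show "continuous_on {-1<..} (G g)"
      unfolding continuous_on_eq_continuous_at[OF open_greaterThan]
    proof
      fix t :: real assume "t \<in> {-1<..}"
      have "continuous_on {0..t+1} (G g)"
        unfolding G_def by (intro indefinite_integral_continuous_1 integrable_continuous_real contI)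
      have zero: "G g s = 0" if "s \<le> 0" for s using that by (cases "s = 0") (auto simp: G_def)
      have "continuous_on {..0} (G g)"
        by (rule continuous_on_eq[of _ "\<lambda>_. 0"]) (auto simp: zero)
      have "continuous_on ({..0} \<union> {0..t+1}) (G g)"
        by (intro continuous_on_closed_Un) (use \<open>continuous_on {0..t+1} (G g)\<close> \<open>continuous_on {..0} (G g)\<close> in auto)
      then have "continuous_on {..<t+1} (G g)" by (rule continuous_on_subset) auto
      then show "isCont (G g) t" by (simp add: continuous_on_eq_continuous_at)
    qed
  qed auto
  \<comment> \<open>Clamping time at 0 lets the operator act on bounded continuous functions of the
    whole line, a complete space.\<close>
  define \<Phi> where "\<Phi> g t = exp (- \<alpha> * max 0 t) *\<^sub>R (x0 + G g (max 0 t))" for g t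
  have \<Phi>: "\<Phi> g \<in> bcontfun" for g
  proof (rule bcontfun_normI)
    show "continuous_on UNIV (\<Phi> g)" unfolding \<Phi>_def
      by (intro continuous_intros continuous_on_compose2[OF contG[of g]]) auto
    fix t :: real
    define m where "m = max 0 t"
    have m: "m \<ge> 0" unfolding m_def by (rule max.cobounded1)
    have "norm (x0 + G g m) \<le> norm x0 + norm (G g m - G 0 m) + norm (G 0 m)"
      using norm_triangle_ineq[of x0 "G g m"] norm_triangle_ineq[of "G g m - G 0 m" "G 0 m"] by simp
    also have "\<dots> \<le> norm x0 + 1/2 * dist g 0 * exp (\<alpha> * m) + m * norm (f 0)"
      using Gdiff[OF m, of g 0] G0[OF m] m by simp
    also have "\<dots> \<le> exp (\<alpha> * m) * norm x0 + 1/2 * dist g 0 * exp (\<alpha> * m) + exp (\<alpha> * m) * (norm (f 0) / \<alpha>)"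
    proof -
      have "1 * norm x0 \<le> exp (\<alpha> * m) * norm x0" using m \<alpha> by (intro mult_right_mono) auto
      moreover have "\<alpha> * m \<le> exp (\<alpha> * m)" using exp_ge_add_one_self[of "\<alpha> * m"] by linarith
      then have "m \<le> exp (\<alpha> * m) / \<alpha>" using \<alpha> by (simp add: field_simps)
      then have "m * norm (f 0) \<le> exp (\<alpha> * m) / \<alpha> * norm (f 0)" by (intro mult_right_mono) auto
      ultimately show ?thesis by simp
    qed
    also have "\<dots> = exp (\<alpha> * m) * (norm x0 + 1/2 * dist g 0 + norm (f 0) / \<alpha>)"
      by (simp add: algebra_simps)
    finally have *: "norm (x0 + G g m) \<le> exp (\<alpha> * m) * (norm x0 + 1/2 * dist g 0 + norm (f 0) / \<alpha>)" .
    have "norm (\<Phi> g t) = exp (- \<alpha> * m) * norm (x0 + G g m)" by (simp add: \<Phi>_def m_def)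
    also have "\<dots> \<le> exp (- \<alpha> * m) * (exp (\<alpha> * m) * (norm x0 + 1/2 * dist g 0 + norm (f 0) / \<alpha>))"
      using * by (intro mult_left_mono) auto
    also have "\<dots> = norm x0 + 1/2 * dist g 0 + norm (f 0) / \<alpha>"
      by (simp flip: exp_add mult.assoc)
    finally show "norm (\<Phi> g t) \<le> norm x0 + 1/2 * dist g 0 + norm (f 0) / \<alpha>" .
  qed
  have "\<exists>!g. Bcontfun (\<Phi> g) = g"
  proof (rule banach_fix_type[of "1/2"])
    show "\<forall>g h. dist (Bcontfun (\<Phi> g)) (Bcontfun (\<Phi> h)) \<le> 1/2 * dist g h"
    proof (intro allI dist_bound)
      fix g h :: "real \<Rightarrow>\<^sub>C 'a" and t :: real
      define m where "m = max 0 t"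
      have m: "m \<ge> 0" unfolding m_def by (rule max.cobounded1)
      have "dist (\<Phi> g t) (\<Phi> h t) = exp (- \<alpha> * m) * norm (G g m - G h m)"
        by (simp add: \<Phi>_def m_def dist_norm flip: scaleR_diff_right)
      also have "\<dots> \<le> exp (- \<alpha> * m) * (1/2 * dist g h * exp (\<alpha> * m))"
        by (intro mult_left_mono Gdiff m) auto
      also have "\<dots> = (exp (- \<alpha> * m) * exp (\<alpha> * m)) * (1/2 * dist g h)" by simp
      also have "\<dots> = 1/2 * dist g h" by (simp flip: exp_add)
      finally show "dist (apply_bcontfun (Bcontfun (\<Phi> g)) t) (apply_bcontfun (Bcontfun (\<Phi> h)) t) \<le> 1/2 * dist g h"
        by (simp add: Bcontfun_inverse[OF \<Phi>])
    qed
  qed auto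
  then obtain g where g: "Bcontfun (\<Phi> g) = g" by blast
  then have g': "apply_bcontfun g = \<Phi> g" using Bcontfun_inverse[OF \<Phi>] by metis
  define x where "x t = exp (\<alpha> * t) *\<^sub>R apply_bcontfun g t" for t
  have x: "x t = x0 + integral {0..t} (\<lambda>s. f (x s))" if "t \<ge> 0" for t
  proof -
    have "x t = (exp (\<alpha> * t) * exp (- \<alpha> * t)) *\<^sub>R (x0 + G g t)"
      using that unfolding x_def g' \<Phi>_def by (simp add: max_def)
    also have "\<dots> = x0 + G g t" by (simp flip: exp_add)
    finally show ?thesis by (simp add: G_def x_def)
  qed
  show thesis
  proof
    show "x 0 = x0" using x[of 0] by simp
    fix t :: real assume t: "t \<ge> 0"
    have "continuous_on {0..t+1} (\<lambda>s. f (x s))" unfolding x_def by (rule contI)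
    then have "((\<lambda>u. integral {0..u} (\<lambda>s. f (x s))) has_vector_derivative f (x t)) (at t within {0..t+1})"
      using t by (intro integral_has_vector_derivative) auto
    then have "((\<lambda>u. x0 + integral {0..u} (\<lambda>s. f (x s))) has_vector_derivative f (x t)) (at t within {0..t+1})"
      by (auto intro!: derivative_eq_intros)
    then have "(x has_vector_derivative f (x t)) (at t within {0..t+1})"
      by (rule has_vector_derivative_transform[rotated 2]) (use t x in auto)
    moreover have "at t within {0..t+1} = at t within {0..}"
      by (rule at_within_nhd[of t "{..<t+1}"]) auto
    ultimately show "(x has_vector_derivative f (x t)) (at t within {0..})" by simp
  qed
qed

text \<open>Outside the region the field is extended through the nearest-point projection \<open>\<pi>\<close>,
  written so that \<open>(n i \<bullet> p - c i)' \<ge> - L (n i \<bullet> p - c i)\<close> holds everywhere.\<close>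

theorem polyhedron_flow_exists:
  fixes G :: "'a::euclidean_space \<Rightarrow> 'a" and n :: "'i \<Rightarrow> 'a" and c :: "'i \<Rightarrow> real" and I :: "'i set"
  defines "K \<equiv> {p. \<forall>i\<in>I. c i \<le> n i \<bullet> p}"
  assumes lip: "\<And>p q. p \<in> K \<Longrightarrow> q \<in> K \<Longrightarrow> norm (G p - G q) \<le> L * norm (p - q)" and L: "L > 0"
    and inward: "\<And>p i. p \<in> K \<Longrightarrow> i \<in> I \<Longrightarrow> n i \<bullet> G p \<ge> - L * (n i \<bullet> p - c i)"
    and p0: "p0 \<in> K"
  obtains p where "p 0 = p0" "\<And>t. t \<ge> 0 \<Longrightarrow> p t \<in> K"
    "\<And>t. t \<ge> 0 \<Longrightarrow> (p has_vector_derivative G (p t)) (at t within {0..})"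
proof -
  have K_eq: "K = (\<Inter>i\<in>I. {p. c i \<le> n i \<bullet> p})" by (auto simp: K_def)
  have closed: "closed K" unfolding K_eq by (intro closed_INT ballI closed_halfspace_ge)
  have conv: "convex K" unfolding K_eq
    by (intro convex_INT convex_halfspace_ge)
  have ne: "K \<noteq> {}" using p0 by auto
  define \<pi> where "\<pi> = closest_point K"
  have \<pi>K: "\<pi> p \<in> K" for p unfolding \<pi>_def by (rule closest_point_in_set[OF closed ne])
  have \<pi>id: "\<pi> p = p" if "p \<in> K" for p unfolding \<pi>_def by (rule closest_point_self[OF that])
  have \<pi>lip: "norm (\<pi> p - \<pi> q) \<le> norm (p - q)" for p q
    using closest_point_lipschitz[OF conv closed ne, of p q] by (simp add: \<pi>_def dist_norm)
  \<comment> \<open>With this correction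
    \<open>n i \<bullet> f p + L * (n i \<bullet> p - c i)\<close> equals \<open>n i \<bullet> G
    (\<pi> p) + L * (n i \<bullet> \<pi> p - c i)\<close>, which \<open>inward\<close> makes
    nonnegative even for \<open>p\<close> outside \<open>K\<close>.\<close>
  define f where "f p = G (\<pi> p) + L *\<^sub>R (\<pi> p - p)" for p
  have "norm (f p - f q) \<le> (3 * L) * norm (p - q)" for p q
  proof -
    have "f p - f q = (G (\<pi> p) - G (\<pi> q)) + L *\<^sub>R ((\<pi> p - \<pi> q) - (p - q))"
      by (simp add: f_def algebra_simps)
    also have "norm \<dots> \<le> norm (G (\<pi> p) - G (\<pi> q)) + norm (L *\<^sub>R ((\<pi> p - \<pi> q) - (p - q)))"
      by (rule norm_triangle_ineq)
    also have "\<dots> \<le> L * norm (\<pi> p - \<pi> q) + L * (norm (\<pi> p - \<pi> q) + norm (p - q))"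
      using lip[OF \<pi>K \<pi>K, of p q] L norm_triangle_ineq4[of "\<pi> p - \<pi> q" "p - q"]
      by (intro add_mono) auto
    also have "\<dots> \<le> L * norm (p - q) + L * (norm (p - q) + norm (p - q))"
      using L \<pi>lip[of p q] by (intro add_mono mult_left_mono) auto
    finally show ?thesis by simp
  qed
  from lipschitz_flow_exists[OF this, of p0] L obtain p where p: "p 0 = p0"
    "\<And>t. t \<ge> 0 \<Longrightarrow> (p has_vector_derivative f (p t)) (at t within {0..})" by auto
  have inK: "p t \<in> K" if t: "t \<ge> 0" for t
    unfolding K_def
  proof safe
    fix i assume i: "i \<in> I"
    \<comment> \<open>An integrating factor: \<open>m\<close> is nondecreasing, so a constraint that
      holds at time 0 is never lost.\<close>
    define m where "m t = exp (L * t) * (n i \<bullet> p t - c i)" for t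
    have "m 0 \<le> m t"
    proof (rule DERIV_nonneg_imp_increasing_open[OF t])
      show "continuous_on {0..t} m"
      proof -
        have "continuous_on {0..} p"
          by (rule continuous_on_vector_derivative) (use p(2) in auto)
        then have "continuous_on {0..t} p" by (rule continuous_on_subset) auto
        then show ?thesis unfolding m_def by (intro continuous_intros)
      qed
      fix s :: real assume s: "0 < s" "s < t"
      have "(p has_vector_derivative f (p s)) (at s)"
        using p(2)[of s] s at_within_interior[of s "{0..}"] by (simp add: interior_real_atLeast)
      then have "((\<lambda>s. n i \<bullet> p s) has_vector_derivative n i \<bullet> f (p s)) (at s)"
        by (rule bounded_linear.has_vector_derivative[OF bounded_linear_inner_right])
      then have "((\<lambda>s. n i \<bullet> p s) has_real_derivative n i \<bullet> f (p s)) (at s)"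
        by (simp add: has_real_derivative_iff_has_vector_derivative)
      then have "(m has_real_derivative exp (L * s) * (n i \<bullet> f (p s) + L * (n i \<bullet> p s - c i))) (at s)"
        unfolding m_def by (auto intro!: derivative_eq_intros simp: algebra_simps)
      moreover have "n i \<bullet> f (p s) + L * (n i \<bullet> p s - c i) \<ge> 0"
        using inward[OF \<pi>K i, of "p s"] by (simp add: f_def inner_add_right inner_diff_right algebra_simps)
      ultimately show "\<exists>y. (m has_real_derivative y) (at s) \<and> 0 \<le> y" by fastforce
    qed
    moreover have "m 0 \<ge> 0" using p0 i p(1) by (simp add: m_def K_def)
    ultimately have "0 \<le> m t" by simp
    then show "c i \<le> n i \<bullet> p t" by (simp add: m_def zero_le_mult_iff)
  qed
  show thesis
  proof
    show "p 0 = p0" by fact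
    fix t :: real assume "t \<ge> 0"
    then show "p t \<in> K" by (rule inK)
    with p(2)[OF \<open>t \<ge> 0\<close>] show "(p has_vector_derivative G (p t)) (at t within {0..})"
      by (simp add: f_def \<pi>id)
  qed
qed

section \<open>One-sided limits of derivatives\<close>

text \<open>In the differences \<open>a\<close>, \<open>b\<close> and the sums \<open>s\<close>,
  \<open>t\<close> the equations form a homogeneous linear system for \<open>(a, b)\<close> with
  determinant \<open>s\<^sup>2 + s * t + t\<^sup>2\<close>. This form is positive definite, so
  either both sums vanish or both differences do.\<close>

lemma quadratic_pair_eq_imp_eq_or_neg:
  fixes p1 p2 q1 q2 :: real
  assumes "p1 * p2 + p1\<^sup>2 / 2 = q1 * q2 + q1\<^sup>2 / 2" "p1 * p2 + p2\<^sup>2 / 2 = q1 * q2 + q2\<^sup>2 / 2"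
  shows "(q1 = p1 \<and> q2 = p2) \<or> (q1 = - p1 \<and> q2 = - p2)"
proof -
  define a b s t where "a = p1 - q1" "b = p2 - q2" "s = p1 + q1" "t = p2 + q2"
  note d = this
  have e: "(s + t) * a + s * b = 0" "t * a + (s + t) * b = 0"
    using assms unfolding d by (simp_all add: power2_eq_square field_simps)
  have "(s\<^sup>2 + s * t + t\<^sup>2) * a = (s + t) * ((s + t) * a + s * b) - s * (t * a + (s + t) * b)"
    by (simp add: power2_eq_square algebra_simps)
  then have 1: "(s\<^sup>2 + s * t + t\<^sup>2) * a = 0" unfolding e by simp
  have "(s\<^sup>2 + s * t + t\<^sup>2) * b = (s + t) * (t * a + (s + t) * b) - t * ((s + t) * a + s * b)"
    by (simp add: power2_eq_square algebra_simps)
  then have 2: "(s\<^sup>2 + s * t + t\<^sup>2) * b = 0" unfolding e by simp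
  have 3: "s\<^sup>2 + s * t + t\<^sup>2 = (s + t / 2)\<^sup>2 + 3 / 4 * t\<^sup>2"
    by (simp add: power2_eq_square field_simps)
  show ?thesis
  proof (cases "s\<^sup>2 + s * t + t\<^sup>2 = 0")
    case True
    then have "(s + t / 2)\<^sup>2 = 0 \<and> t\<^sup>2 = 0"
      using 3 zero_le_power2[of "s + t / 2"] zero_le_power2[of t] by linarith
    then have "t = 0" "s = 0" by auto
    then show ?thesis unfolding d by linarith
  next
    case False
    then have "a = 0" "b = 0" using 1 2 by auto
    then show ?thesis unfolding d by linarith
  qed
qed

lemma derivative_close_imp_increment_close:
  fixes u :: "real \<Rightarrow> 'a::euclidean_space"
  assumes "a \<le> b" "abs_continuous_on {a..b} u" "AE x in lebesgue. u differentiable (at x)"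
    and "\<And>x. a < x \<Longrightarrow> x < b \<Longrightarrow> u differentiable (at x) \<Longrightarrow> norm (vector_derivative u (at x) - l) \<le> e"
    and "0 \<le> e"
  shows "norm (u b - u a - (b - a) *\<^sub>R l) \<le> e * (b - a)"
proof (rule abs_continuous_on_derivative_bound)
  show "AE x in lebesgue. x \<in> {a<..<b} \<longrightarrow> (\<exists>d. (u has_vector_derivative d) (at x) \<and> norm (d - l) \<le> e)"
    using assms(3)
  proof eventually_elim
    case (elim x)
    then show ?case
      using assms(4)[of x] by (auto simp: vector_derivative_works)
  qed
qed (use assms in auto)

text \<open>With \<open>S\<close> a half-line, this turns an increment estimate into a bound on
  one-sided derivatives, also at points where \<open>u\<close> may fail to be
  differentiable.\<close>

lemma has_vector_derivative_close:
  fixes u :: "real \<Rightarrow> 'a::real_normed_vector"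
  assumes D: "(u has_vector_derivative D) (at y within S)" and y: "y islimpt S" and \<delta>: "\<delta> > 0"
    and close: "\<And>b. b \<in> S \<Longrightarrow> \<bar>b - y\<bar> < \<delta> \<Longrightarrow> norm (u b - u y - (b - y) *\<^sub>R l) \<le> e * \<bar>b - y\<bar>"
  shows "norm (D - l) \<le> e"
proof (rule field_le_epsilon)
  fix \<epsilon> :: real assume "\<epsilon> > 0"
  then obtain d where d: "d > 0" "\<And>b. b \<in> S \<Longrightarrow> \<bar>b - y\<bar> < d \<Longrightarrow> norm (u b - u y - (b - y) *\<^sub>R D) \<le> \<epsilon> * \<bar>b - y\<bar>"
    using D unfolding has_vector_derivative_def has_derivative_within_alt by auto
  obtain b where b: "b \<in> S" "b \<noteq> y" "\<bar>b - y\<bar> < min d \<delta>"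
    using y \<delta> d(1) unfolding islimpt_approachable by (auto simp: dist_real_def) (metis min_less_iff_conj)
  have "\<bar>b - y\<bar> * norm (D - l) = norm ((b - y) *\<^sub>R (D - l))" by simp
  also have "(b - y) *\<^sub>R (D - l) = (u b - u y - (b - y) *\<^sub>R l) - (u b - u y - (b - y) *\<^sub>R D)"
    by (simp add: algebra_simps)
  also have "norm \<dots> \<le> e * \<bar>b - y\<bar> + \<epsilon> * \<bar>b - y\<bar>"
    using close[of b] d(2)[of b] b by (intro norm_triangle_le_diff) simp
  finally have "\<bar>b - y\<bar> * norm (D - l) \<le> \<bar>b - y\<bar> * (e + \<epsilon>)" by (simp add: algebra_simps)
  then show "norm (D - l) \<le> e + \<epsilon>" using b(2) by simp
qed

lemma islimpt_half_line: "(y::real) islimpt {y..}" "(y::real) islimpt {..y}"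
proof -
  have "y islimpt {y<..<y+1}" by (rule islimpt_greaterThanLessThan1) simp
  moreover have "y islimpt {y-1<..<y}" by (rule islimpt_greaterThanLessThan2) simp
  ultimately show "y islimpt {y..}" "y islimpt {..y}"
    by (fastforce elim: islimpt_subset)+
qed

text \<open>A set of full measure meets every open interval, so limits along it determine one-sided
  limits uniquely.\<close>

lemma AE_lebesgue_islimpt:
  fixes y :: real
  assumes "AE x in lebesgue. x \<in> G"
  shows "y islimpt (G \<inter> {y<..})" "y islimpt (G \<inter> {..<y})"
proof -
  have ex: "\<exists>x\<in>G. a < x \<and> x < b" if "a < b" for a b :: real
  proof (rule ccontr)
    assume *: "\<not> ?thesis"
    obtain N where N: "N \<in> null_sets lebesgue" "\<And>x. x \<notin> N \<Longrightarrow> x \<in> G"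
      using AE_E3[OF assms] by (auto simp: space_completion)
    have "{a<..<b} \<subseteq> N" using * N(2) greaterThanLessThan_iff by blast
    then have "{a<..<b} \<in> null_sets lebesgue"
      using N(1) by (metis negligible_iff_null_sets negligible_subset)
    then have "emeasure lebesgue {a<..<b} = 0" by auto
    then show False using that by simp
  qed
  show "y islimpt (G \<inter> {y<..})"
    unfolding islimpt_approachable
  proof (intro allI impI)
    fix e :: real assume "e > 0"
    with ex[of y "y + e"] show "\<exists>x'\<in>G \<inter> {y<..}. x' \<noteq> y \<and> dist x' y < e"
      by (force simp: dist_real_def)
  qed
  show "y islimpt (G \<inter> {..<y})"
    unfolding islimpt_approachable
  proof (intro allI impI)
    fix e :: real assume "e > 0"
    with ex[of "y - e" y] show "\<exists>x'\<in>G \<inter> {..<y}. x' \<noteq> y \<and> dist x' y < e"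
      by (force simp: dist_real_def)
  qed
qed

context
  fixes u :: "real \<Rightarrow> 'a::euclidean_space"
  assumes ac: "\<And>a b. abs_continuous_on {a..b} u"
    and ae: "AE x in lebesgue. u differentiable (at x)"
begin

text \<open>Only the open interval between \<open>a\<close> and \<open>b\<close> has to lie in
  \<open>S\<close>, so an endpoint may be \<open>y\<close> itself; leaving the order of
  \<open>a\<close> and \<open>b\<close> free lets one statement serve both sides of
  \<open>y\<close>.\<close>

lemma deriv_limit_increment:
  assumes lim: "((\<lambda>x. vector_derivative u (at x)) \<longlongrightarrow> l) (at y within {x. x \<in> S \<and> u differentiable (at x)})"
    and y: "y \<notin> S" and e: "0 < e"
  obtains \<delta> where "0 < \<delta>" "\<And>a b. {min a b<..<max a b} \<subseteq> S \<Longrightarrow> \<bar>a - y\<bar> < \<delta> \<Longrightarrow> \<bar>b - y\<bar> < \<delta> \<Longrightarrow>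
    norm (u b - u a - (b - a) *\<^sub>R l) \<le> e * \<bar>b - a\<bar>"
proof -
  have "eventually (\<lambda>x. dist (vector_derivative u (at x)) l < e) (at y within {x. x \<in> S \<and> u differentiable (at x)})"
    using lim e by (rule tendstoD)
  then obtain \<delta> where \<delta>: "0 < \<delta>" "\<And>x. x \<in> S \<Longrightarrow> u differentiable (at x) \<Longrightarrow> \<bar>x - y\<bar> < \<delta> \<Longrightarrow> dist (vector_derivative u (at x)) l < e"
    unfolding eventually_at dist_real_def using y by auto
  have ordered: "norm (u b - u a - (b - a) *\<^sub>R l) \<le> e * (b - a)"
    if ab: "a \<le> b" "{a<..<b} \<subseteq> S" "\<bar>a - y\<bar> < \<delta>" "\<bar>b - y\<bar> < \<delta>" for a b
  proof (rule derivative_close_imp_increment_close[OF ab(1) ac ae])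
    fix x assume x: "a < x" "x < b" "u differentiable (at x)"
    then have "x \<in> S" "\<bar>x - y\<bar> < \<delta>" using ab by auto
    then show "norm (vector_derivative u (at x) - l) \<le> e"
      using \<delta>(2)[of x] x by (simp add: dist_norm)
  qed (use e in simp)
  show thesis
  proof (rule that[OF \<delta>(1)])
    fix a b assume ab: "{min a b<..<max a b} \<subseteq> S" "\<bar>a - y\<bar> < \<delta>" "\<bar>b - y\<bar> < \<delta>"
    show "norm (u b - u a - (b - a) *\<^sub>R l) \<le> e * \<bar>b - a\<bar>"
    proof (cases "a \<le> b")
      case True
      then show ?thesis using ordered[of a b] ab by simp
    next
      case False
      then have "norm (u a - u b - (a - b) *\<^sub>R l) \<le> e * (a - b)" using ordered[of b a] ab by simp
      moreover have "u b - u a - (b - a) *\<^sub>R l = - (u a - u b - (a - b) *\<^sub>R l)" by (simp add: algebra_simps)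
      ultimately show ?thesis using False by (simp only: norm_minus_cancel) simp
    qed
  qed
qed

lemma deriv_limit_imp_has_vector_derivative:
  assumes lim: "((\<lambda>x. vector_derivative u (at x)) \<longlongrightarrow> l) (at y within {x. x \<in> S \<and> u differentiable (at x)})"
    and y: "y \<notin> S" and T: "\<And>b. b \<in> T \<Longrightarrow> {min y b<..<max y b} \<subseteq> S"
  shows "(u has_vector_derivative l) (at y within T)"
  unfolding has_vector_derivative_def has_derivative_within_alt
proof (intro conjI allI impI)
  fix e :: real assume "0 < e"
  from deriv_limit_increment[OF lim y this] obtain \<delta> where \<delta>: "0 < \<delta>"
    "\<And>a b. {min a b<..<max a b} \<subseteq> S \<Longrightarrow> \<bar>a - y\<bar> < \<delta> \<Longrightarrow> \<bar>b - y\<bar> < \<delta> \<Longrightarrow>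
      norm (u b - u a - (b - a) *\<^sub>R l) \<le> e * \<bar>b - a\<bar>" by blast
  show "\<exists>d>0. \<forall>x\<in>T. norm (x - y) < d \<longrightarrow> norm (u x - u y - (x - y) *\<^sub>R l) \<le> e * norm (x - y)"
    using \<delta>(1) \<delta>(2)[OF T] by (intro exI[of _ \<delta>]) auto
qed (rule bounded_linear_scaleR_left)

text \<open>The limits in (A3) run along points of differentiability only. Near \<open>y\<close> all
  increments on that side have slope close to \<open>l\<close>, so the one-sided derivatives at
  every nearby point are close to \<open>l\<close> too, whichever side is selected at each of
  them.\<close>

lemma one_sided_derivatives_tendsto:
  assumes lim: "((\<lambda>x. vector_derivative u (at x)) \<longlongrightarrow> l) (at y within {x. x \<in> S \<and> u differentiable (at x)})"
    and y: "y \<notin> S" and S: "open S"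
    and q: "\<And>x. (u has_vector_derivative q x) (at x within {x..}) \<or> (u has_vector_derivative q x) (at x within {..x})"
  shows "(q \<longlongrightarrow> l) (at y within S)"
proof (rule tendstoI)
  fix e :: real assume e: "0 < e"
  then have "0 < e / 2" by simp
  from deriv_limit_increment[OF lim y this] obtain \<delta> where \<delta>: "0 < \<delta>"
    "\<And>a b. {min a b<..<max a b} \<subseteq> S \<Longrightarrow> \<bar>a - y\<bar> < \<delta> \<Longrightarrow> \<bar>b - y\<bar> < \<delta> \<Longrightarrow>
      norm (u b - u a - (b - a) *\<^sub>R l) \<le> e / 2 * \<bar>b - a\<bar>" by blast
  have "dist (q x) l < e" if x: "x \<in> S" "\<bar>x - y\<bar> < \<delta>" for x
  proof -
    have "x \<in> S \<inter> {y - \<delta><..<y + \<delta>}" using x by (auto simp: abs_less_iff)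
    then obtain \<rho> where \<rho>: "0 < \<rho>" "ball x \<rho> \<subseteq> S \<inter> {y - \<delta><..<y + \<delta>}"
      using openE[OF open_Int[OF S open_greaterThanLessThan]] by blast
    have close: "norm (u b - u x - (b - x) *\<^sub>R l) \<le> e / 2 * \<bar>b - x\<bar>" if b: "\<bar>b - x\<bar> < \<rho>" for b
    proof (rule \<delta>(2))
      have sub: "z \<in> S \<inter> {y - \<delta><..<y + \<delta>}" if "\<bar>z - x\<bar> < \<rho>" for z
        using \<rho>(2) that by (auto simp: dist_real_def abs_minus_commute subset_iff)
      show "{min x b<..<max x b} \<subseteq> S" using sub b by (auto simp: min_def max_def split: if_splits)
      show "\<bar>x - y\<bar> < \<delta>" "\<bar>b - y\<bar> < \<delta>" using x(2) sub[OF b] by auto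
    qed
    have "norm (q x - l) \<le> e / 2"
      using q[of x] has_vector_derivative_close[OF _ islimpt_half_line(1) \<rho>(1) close]
        has_vector_derivative_close[OF _ islimpt_half_line(2) \<rho>(1) close] by blast
    then show ?thesis using e by (simp add: dist_norm)
  qed
  then show "eventually (\<lambda>x. dist (q x) l < e) (at y within S)"
    unfolding eventually_at dist_real_def using \<delta>(1) by blast
qed

end

section \<open>Boundedness of the derivatives\<close>

text \<open>Continuous induction on the supremum of the points up to which the bound holds. The
  condition \<open>right\<close> is asked only where the bound holds already, so it may depend on
  the decrease that is being proved. The condition \<open>left\<close> forbids upward jumps and
  permits downward ones.\<close>

lemma right_increments_bounded:
  fixes f :: "real \<Rightarrow> real"
  assumes ab: "a \<le> b"
    and right: "\<And>x. a \<le> x \<Longrightarrow> x < b \<Longrightarrow> f x \<le> f a + c * (x - a)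
      \<Longrightarrow> \<exists>\<delta>>0. \<forall>y. x < y \<and> y < x + \<delta> \<longrightarrow> f y \<le> f x + c * (y - x)"
    and left: "\<And>x e. a < x \<Longrightarrow> x \<le> b \<Longrightarrow> 0 < e \<Longrightarrow> \<exists>\<delta>>0. \<forall>y. x - \<delta> < y \<and> y < x \<longrightarrow> f x \<le> f y + e"
  shows "f b \<le> f a + c * (b - a)"
proof -
  define S where "S = {x \<in> {a..b}. \<forall>y\<in>{a..x}. f y \<le> f a + c * (y - a)}"
  have aS: "a \<in> S" using ab by (auto simp: S_def)
  have bdd: "bdd_above S" by (rule bdd_aboveI[of _ b]) (auto simp: S_def)
  define z where "z = Sup S"
  have "a \<le> z" unfolding z_def by (rule cSup_upper[OF aS bdd])
  moreover have "z \<le> b"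
    unfolding z_def
  proof (rule cSup_least)
    show "S \<noteq> {}" using aS by blast
  qed (simp add: S_def)
  ultimately have z: "a \<le> z" "z \<le> b" by auto
  have below: "f y \<le> f a + c * (y - a)" if y: "a \<le> y" "y < z" for y
  proof -
    obtain x where "x \<in> S" "y < x" using y(2) less_cSup_iff[of S] aS bdd unfolding z_def by blast
    then show ?thesis using y by (auto simp: S_def)
  qed
  have fz: "f z \<le> f a + c * (z - a)"
  proof (cases "z = a")
    case False
    then have az: "a < z" using z by simp
    show ?thesis
    proof (rule field_le_epsilon)
      fix e :: real assume e: "e > 0"
      obtain \<delta> where \<delta>: "\<delta> > 0" "\<And>y. z - \<delta> < y \<Longrightarrow> y < z \<Longrightarrow> f z \<le> f y + e / 2"
        using left[OF az z(2), of "e/2"] e by auto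
      \<comment> \<open>Small enough that the left estimate applies at \<open>z - \<eta>\<close> and
        that the line of slope \<open>c\<close> changes by at most \<open>e / 2\<close> between
        \<open>z - \<eta>\<close> and \<open>z\<close>.\<close>
      define \<eta> where "\<eta> = min (\<delta> / 2) (min ((z - a) / 2) (e / (2 * (\<bar>c\<bar> + 1))))"
      have \<eta>: "\<eta> > 0" using \<delta> az e by (auto simp: \<eta>_def)
      have "\<eta> \<le> \<delta> / 2" "\<eta> \<le> (z - a) / 2" and \<eta>e: "\<eta> \<le> e / (2 * (\<bar>c\<bar> + 1))"
        unfolding \<eta>_def by linarith+
      then have y: "z - \<delta> < z - \<eta>" "a \<le> z - \<eta>" "z - \<eta> < z" using \<delta> az \<eta> by auto
      have "f z \<le> f a + c * (z - \<eta> - a) + e / 2"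
        using \<delta>(2)[OF y(1,3)] below[OF y(2,3)] by linarith
      moreover have "c * (z - \<eta> - a) = c * (z - a) + - c * \<eta>" by (simp add: algebra_simps)
      moreover have "- c * \<eta> \<le> e / 2"
      proof -
        have "- c * \<eta> \<le> (\<bar>c\<bar> + 1) * \<eta>" using \<eta> by (intro mult_right_mono) auto
        also have "\<dots> \<le> (\<bar>c\<bar> + 1) * (e / (2 * (\<bar>c\<bar> + 1)))" using \<eta>e by (intro mult_left_mono) auto
        also have "\<dots> = e / 2" by (simp add: divide_simps)
        finally show ?thesis .
      qed
      ultimately show "f z \<le> f a + c * (z - a) + e" by linarith
    qed
  qed simp
  have "z = b"
  proof (rule ccontr)
    assume "z \<noteq> b"
    then have zb: "z < b" using z by simp
    obtain \<delta> where \<delta>: "\<delta> > 0" "\<And>y. z < y \<Longrightarrow> y < z + \<delta> \<Longrightarrow> f y \<le> f z + c * (y - z)"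
      using right[OF z(1) zb fz] by auto
    define x where "x = min b (z + \<delta> / 2)"
    have x: "z < x" "x \<le> b" "x < z + \<delta>" using zb \<delta> by (auto simp: x_def)
    have "f y \<le> f a + c * (y - a)" if y: "a \<le> y" "y \<le> x" for y
    proof -
      consider "y < z" | "y = z" | "z < y" by linarith
      then show ?thesis
      proof cases
        case 3
        then have "f y \<le> f z + c * (y - z)" using \<delta>(2) x y by auto
        then show ?thesis using fz by (simp add: algebra_simps)
      qed (use below fz y in auto)
    qed
    then have "x \<in> S" using x z unfolding S_def by auto
    then have "x \<le> z" unfolding z_def by (rule cSup_upper[OF _ bdd])
    then show False using x by simp
  qed
  then show ?thesis using fz by simp
qed

lemma right_derivative_imp_increment_le:
  fixes f :: "real \<Rightarrow> real"
  assumes "(f has_real_derivative D) (at x within {x..})" "D < c"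
  shows "\<exists>\<delta>>0. \<forall>y. x < y \<and> y < x + \<delta> \<longrightarrow> f y \<le> f x + c * (y - x)"
proof -
  obtain \<delta> where \<delta>: "\<delta> > 0" "\<And>y. y \<in> {x..} \<Longrightarrow> \<bar>y - x\<bar> < \<delta> \<Longrightarrow> \<bar>f y - f x - D * (y - x)\<bar> \<le> (c - D) * \<bar>y - x\<bar>"
    using assms unfolding has_field_derivative_def has_derivative_within_alt
    by (metis diff_gt_0_iff_gt real_norm_def)
  show ?thesis
  proof (intro exI conjI allI impI)
    show "\<delta> > 0" by fact
    fix y assume y: "x < y \<and> y < x + \<delta>"
    then have "\<bar>f y - f x - D * (y - x)\<bar> \<le> (c - D) * (y - x)" using \<delta>(2)[of y] by auto
    then show "f y \<le> f x + c * (y - x)" by (simp add: algebra_simps abs_le_iff)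
  qed
qed

lemma right_derivative_bound:
  fixes f :: "real \<Rightarrow> real"
  assumes ab: "a \<le> b" and cont: "continuous_on {a..b} f"
    and der: "\<And>x. a \<le> x \<Longrightarrow> x < b \<Longrightarrow> (f has_real_derivative D x) (at x within {x..})"
    and bound: "\<And>x. a \<le> x \<Longrightarrow> x < b \<Longrightarrow> \<bar>D x\<bar> < c"
  shows "\<bar>f b - f a\<bar> \<le> c * (b - a)"
proof -
  have left: "\<exists>\<delta>>0. \<forall>y. x - \<delta> < y \<and> y < x \<longrightarrow> \<bar>f x - f y\<bar> < e" if "a < x" "x \<le> b" "0 < e" for x e
  proof -
    have "x \<in> {a..b}" using that by simp
    then obtain d where d: "d > 0" "\<And>y. y \<in> {a..b} \<Longrightarrow> dist y x < d \<Longrightarrow> dist (f y) (f x) < e"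
      using cont \<open>0 < e\<close> unfolding continuous_on_iff by blast
    show ?thesis
    proof (intro exI[of _ "min d (x - a)"] conjI allI impI)
      show "0 < min d (x - a)" using d that by auto
      fix y assume y: "x - min d (x - a) < y \<and> y < x"
      then have "dist (f y) (f x) < e" using d(2)[of y] that by (auto simp: dist_real_def)
      then show "\<bar>f x - f y\<bar> < e" by (simp add: dist_real_def abs_minus_commute)
    qed
  qed
  have "f b \<le> f a + c * (b - a)"
  proof (rule right_increments_bounded[OF ab])
    fix x assume "a \<le> x" "x < b"
    then show "\<exists>\<delta>>0. \<forall>y. x < y \<and> y < x + \<delta> \<longrightarrow> f y \<le> f x + c * (y - x)"
      using right_derivative_imp_increment_le[OF der] bound[of x] by auto
  next
    fix x e assume "a < x" "x \<le> b" "0 < (e::real)"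
    from left[OF this] show "\<exists>\<delta>>0. \<forall>y. x - \<delta> < y \<and> y < x \<longrightarrow> f x \<le> f y + e" by force
  qed
  moreover have "- f b \<le> - f a + c * (b - a)"
  proof (rule right_increments_bounded[OF ab])
    fix x assume x: "a \<le> x" "x < b"
    then have "((\<lambda>x. - f x) has_real_derivative - D x) (at x within {x..})"
      by (intro DERIV_minus der)
    from right_derivative_imp_increment_le[OF this, of c]
    show "\<exists>\<delta>>0. \<forall>y. x < y \<and> y < x + \<delta> \<longrightarrow> - f y \<le> - f x + c * (y - x)"
      using bound[of x] x by auto
  next
    fix x e assume "a < x" "x \<le> b" "0 < (e::real)"
    from left[OF this] show "\<exists>\<delta>>0. \<forall>y. x - \<delta> < y \<and> y < x \<longrightarrow> - f x \<le> - f y + e" by force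
  qed
  ultimately show ?thesis by (simp add: abs_le_iff)
qed

text \<open>If \<open>w = (p\<^sub>1 p\<^sub>2 + p\<^sub>1\<^sup>2/2, p\<^sub>1 p\<^sub>2 + p\<^sub>2\<^sup>2/2)\<close>, then \<open>w\<^sub>1 + \<omega> w\<^sub>2 = (p\<^sub>1 - \<omega>\<^sup>2 p\<^sub>2)\<^sup>2 / 2\<close> for a primitive cube
  root of unity \<open>\<omega>\<close>; taking moduli, the size of \<open>p\<close> is a function of \<open>w\<close> alone, hence
  continuous across jumps.\<close>

lemma quadratic_pair_modulus:
  fixes p1 p2 :: real
  defines "w1 \<equiv> p1 * p2 + p1\<^sup>2 / 2" and "w2 \<equiv> p1 * p2 + p2\<^sup>2 / 2"
  shows "p1\<^sup>2 + p1 * p2 + p2\<^sup>2 = 2 * sqrt (w1\<^sup>2 - w1 * w2 + w2\<^sup>2)"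
proof -
  have pos: "p1\<^sup>2 + p1 * p2 + p2\<^sup>2 = (p1 + p2 / 2)\<^sup>2 + 3 / 4 * p2\<^sup>2"
    by (simp add: power2_eq_square field_simps)
  have "w1\<^sup>2 - w1 * w2 + w2\<^sup>2 = ((p1\<^sup>2 + p1 * p2 + p2\<^sup>2) / 2)\<^sup>2"
    by (simp add: w1_def w2_def power2_eq_square field_simps)
  then have "sqrt (w1\<^sup>2 - w1 * w2 + w2\<^sup>2) = (p1\<^sup>2 + p1 * p2 + p2\<^sup>2) / 2"
    unfolding pos by (simp add: real_sqrt_abs)
  then show ?thesis by simp
qed

lemma right_derivative_of_sum:
  fixes w1 w2 p1 p2 :: "real \<Rightarrow> real"
  assumes w1: "\<And>y. x \<le> y \<Longrightarrow> w1 y = p1 y * p2 y + (p1 y)\<^sup>2 / 2"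
    and w2: "\<And>y. x \<le> y \<Longrightarrow> w2 y = p1 y * p2 y + (p2 y)\<^sup>2 / 2"
    and d1: "(w1 has_real_derivative k1 - p1 x) (at x within {x..})"
    and d2: "(w2 has_real_derivative k2 - p2 x) (at x within {x..})"
    and l1: "(p1 \<longlongrightarrow> p1 x) (at_right x)" and l2: "(p2 \<longlongrightarrow> p2 x) (at_right x)"
    and nz: "(p1 x)\<^sup>2 + p1 x * p2 x + (p2 x)\<^sup>2 \<noteq> 0"
  shows "((\<lambda>y. p1 y + p2 y) has_real_derivative
     (k1 * p1 x + k2 * p2 x - (p1 x)\<^sup>2 - (p2 x)\<^sup>2) / ((p1 x)\<^sup>2 + p1 x * p2 x + (p2 x)\<^sup>2)) (at x within {x..})"
proof -
  have eq: "at x within {x..} = at_right x"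
    by (simp add: at_within_Ici_at_right)
  have q1: "((\<lambda>y. (w1 y - w1 x) / (y - x)) \<longlongrightarrow> k1 - p1 x) (at_right x)"
    using d1 unfolding has_field_derivative_iff eq .
  have q2: "((\<lambda>y. (w2 y - w2 x) / (y - x)) \<longlongrightarrow> k2 - p2 x) (at_right x)"
    using d2 unfolding has_field_derivative_iff eq .
  define m1 m2 where "m1 y = (p1 y + p1 x) / 2" and "m2 y = (p2 y + p2 x) / 2" for y
  have m: "(m1 \<longlongrightarrow> p1 x) (at_right x)" "(m2 \<longlongrightarrow> p2 x) (at_right x)"
    unfolding m1_def m2_def by (auto intro!: tendsto_eq_intros l1 l2)
  define D where "D y = (m1 y)\<^sup>2 + m1 y * m2 y + (m2 y)\<^sup>2" for y
  have D: "(D \<longlongrightarrow> (p1 x)\<^sup>2 + p1 x * p2 x + (p2 x)\<^sup>2) (at_right x)"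
    unfolding D_def by (intro tendsto_intros m)
  have "eventually (\<lambda>y. D y \<noteq> 0) (at_right x)"
    using D nz by (rule tendsto_imp_eventually_ne)
  moreover have "eventually (\<lambda>y. x < y) (at_right x)" by (simp add: eventually_at_filter)
  ultimately have ev: "eventually (\<lambda>y. (m1 y * ((w1 y - w1 x) / (y - x)) + m2 y * ((w2 y - w2 x) / (y - x))) / D y
      = (p1 y + p2 y - (p1 x + p2 x)) / (y - x)) (at_right x)"
  proof eventually_elim
    case (elim y)
    have "m1 y * (w1 y - w1 x) + m2 y * (w2 y - w2 x) = D y * (p1 y + p2 y - (p1 x + p2 x))"
      using elim by (simp add: w1 w2 m1_def m2_def D_def power2_eq_square field_simps)
    moreover have "m1 y * ((w1 y - w1 x) / (y - x)) + m2 y * ((w2 y - w2 x) / (y - x))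
        = (m1 y * (w1 y - w1 x) + m2 y * (w2 y - w2 x)) / (y - x)"
      by (simp add: add_divide_distrib)
    ultimately show ?case using elim by simp
  qed
  have "((\<lambda>y. (m1 y * ((w1 y - w1 x) / (y - x)) + m2 y * ((w2 y - w2 x) / (y - x))) / D y) \<longlongrightarrow>
     (p1 x * (k1 - p1 x) + p2 x * (k2 - p2 x)) / ((p1 x)\<^sup>2 + p1 x * p2 x + (p2 x)\<^sup>2)) (at_right x)"
    by (intro tendsto_intros m q1 q2 D nz)
  then have "((\<lambda>y. (p1 y + p2 y - (p1 x + p2 x)) / (y - x)) \<longlongrightarrow>
     (p1 x * (k1 - p1 x) + p2 x * (k2 - p2 x)) / ((p1 x)\<^sup>2 + p1 x * p2 x + (p2 x)\<^sup>2)) (at_right x)"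
    by (rule Lim_transform_eventually) (rule ev)
  then show ?thesis
    unfolding has_field_derivative_iff eq
    by (simp add: power2_eq_square algebra_simps)
qed

text \<open>Two quantities share the work: \<open>D\<close> is continuous and measures the size of
  \<open>p\<close>, but obeys no monotonicity; \<open>s\<close> jumps, but only downward, and
  decreases wherever \<open>D\<close> is large. Thus \<open>s\<close> limits the duration of an
  excursion and \<open>D\<close> then limits its height.\<close>

lemma half_line_bounded:
  fixes w1 w2 p1 p2 :: "real \<Rightarrow> real" and k1 k2 C :: real
  assumes w1: "\<And>x. 0 \<le> x \<Longrightarrow> w1 x = p1 x * p2 x + (p1 x)\<^sup>2 / 2"
    and w2: "\<And>x. 0 \<le> x \<Longrightarrow> w2 x = p1 x * p2 x + (p2 x)\<^sup>2 / 2"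
    and d1: "\<And>x. 0 \<le> x \<Longrightarrow> (w1 has_real_derivative k1 - p1 x) (at x within {x..})"
    and d2: "\<And>x. 0 \<le> x \<Longrightarrow> (w2 has_real_derivative k2 - p2 x) (at x within {x..})"
    and c1: "continuous_on {0..} w1" and c2: "continuous_on {0..} w2"
    and l1: "\<And>x. 0 \<le> x \<Longrightarrow> (p1 \<longlongrightarrow> p1 x) (at_right x)"
    and l2: "\<And>x. 0 \<le> x \<Longrightarrow> (p2 \<longlongrightarrow> p2 x) (at_right x)"
    and left: "\<And>x. 0 < x \<Longrightarrow> \<exists>L \<ge> p1 x + p2 x. ((\<lambda>y. p1 y + p2 y) \<longlongrightarrow> L) (at_left x)"
    and growth: "\<And>x. 0 \<le> x \<Longrightarrow> \<bar>w1 x\<bar> \<le> C * (1 + x)" "\<And>x. 0 \<le> x \<Longrightarrow> \<bar>w2 x\<bar> \<le> C * (1 + x)"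
  shows "\<exists>B. \<forall>x\<ge>0. \<bar>p1 x\<bar> \<le> B \<and> \<bar>p2 x\<bar> \<le> B"
proof -
  define D where "D x = 2 * sqrt ((w1 x)\<^sup>2 - w1 x * w2 x + (w2 x)\<^sup>2)" for x
  define s where "s x = p1 x + p2 x" for x
  have D: "D x = (p1 x)\<^sup>2 + p1 x * p2 x + (p2 x)\<^sup>2" if "0 \<le> x" for x
    unfolding D_def w1[OF that] w2[OF that] by (rule quadratic_pair_modulus[symmetric])
  have contD: "continuous_on {0..} D" unfolding D_def by (intro continuous_intros c1 c2)
  have D_up: "D x \<le> 2 * (\<bar>w1 x\<bar> + \<bar>w2 x\<bar>)" for x
  proof -
    have "(w1 x)\<^sup>2 - w1 x * w2 x + (w2 x)\<^sup>2 \<le> (\<bar>w1 x\<bar> + \<bar>w2 x\<bar>)\<^sup>2"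
      using abs_ge_minus_self[of "w1 x * w2 x"] mult_nonneg_nonneg[OF abs_ge_zero abs_ge_zero, of "w1 x" "w2 x"]
      unfolding power2_sum abs_mult power2_abs by linarith
    then have "sqrt ((w1 x)\<^sup>2 - w1 x * w2 x + (w2 x)\<^sup>2) \<le> \<bar>w1 x\<bar> + \<bar>w2 x\<bar>"
      by (intro real_le_lsqrt) auto
    then show ?thesis by (simp add: D_def)
  qed
  have D_s: "3 / 4 * (s x)\<^sup>2 \<le> D x" if "0 \<le> x" for x
  proof -
    have "D x = 3 / 4 * (s x)\<^sup>2 + (p1 x - p2 x)\<^sup>2 / 4"
      unfolding D[OF that] s_def by (simp add: power2_eq_square field_simps)
    then show ?thesis using zero_le_power2[of "p1 x - p2 x"] by linarith
  qed
  have D_p: "(p1 x)\<^sup>2 + (p2 x)\<^sup>2 \<le> 2 * D x" "2 * D x \<le> 3 * ((p1 x)\<^sup>2 + (p2 x)\<^sup>2)" if "0 \<le> x" for x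
  proof -
    have "2 * D x - ((p1 x)\<^sup>2 + (p2 x)\<^sup>2) = (p1 x + p2 x)\<^sup>2"
      "3 * ((p1 x)\<^sup>2 + (p2 x)\<^sup>2) - 2 * D x = (p1 x - p2 x)\<^sup>2"
      unfolding D[OF that] by (simp_all add: power2_eq_square field_simps)
    then show "(p1 x)\<^sup>2 + (p2 x)\<^sup>2 \<le> 2 * D x" "2 * D x \<le> 3 * ((p1 x)\<^sup>2 + (p2 x)\<^sup>2)"
      using zero_le_power2[of "p1 x + p2 x"] zero_le_power2[of "p1 x - p2 x"] by linarith+
  qed
  define Q where "Q = k1\<^sup>2 + k2\<^sup>2"
  \<comment> \<open>For \<open>D x \<ge> R\<close> the squared norm of \<open>p\<close> is at least
    \<open>4 * Q\<close>, so the quadratic part of the numerator beats the linear one and the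
    derivative of \<open>s\<close> is at most -1/3. The added 1 keeps \<open>D\<close> away from
    0.\<close>
  define R where "R = 6 * Q + 1"
  have R: "R \<ge> 1" by (simp add: R_def Q_def)
  have decr: "\<exists>\<delta>>0. \<forall>y. x < y \<and> y < x + \<delta> \<longrightarrow> s y \<le> s x - (y - x) / 4"
    if x: "0 \<le> x" and big: "R \<le> D x" for x
  proof -
    let ?N = "(p1 x)\<^sup>2 + (p2 x)\<^sup>2"
    have QN: "4 * Q \<le> ?N" using D_p(2)[OF x] big by (simp add: R_def)
    have kN: "k1 * p1 x + k2 * p2 x \<le> Q + ?N / 4"
    proof -
      have "Q + ?N / 4 - (k1 * p1 x + k2 * p2 x) = (k1 - p1 x / 2)\<^sup>2 + (k2 - p2 x / 2)\<^sup>2"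
        by (simp add: Q_def power2_eq_square field_simps)
      then show ?thesis using zero_le_power2[of "k1 - p1 x / 2"] zero_le_power2[of "k2 - p2 x / 2"] by linarith
    qed
    have num: "k1 * p1 x + k2 * p2 x - (p1 x)\<^sup>2 - (p2 x)\<^sup>2 \<le> - (D x / 3)"
    proof -
      have "a - N \<le> - (d / 3)" if "4 * q \<le> N" "a \<le> q + N / 4" "2 * d \<le> 3 * N" for a d q N :: real
        using that by (simp add: field_simps)
      from this[OF QN kN D_p(2)[OF x]] show ?thesis by (simp only: diff_diff_eq)
    qed
    have pos: "(p1 x)\<^sup>2 + p1 x * p2 x + (p2 x)\<^sup>2 > 0" using D[OF x] big R by linarith
    have der: "(s has_real_derivative (k1 * p1 x + k2 * p2 x - (p1 x)\<^sup>2 - (p2 x)\<^sup>2)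
        / ((p1 x)\<^sup>2 + p1 x * p2 x + (p2 x)\<^sup>2)) (at x within {x..})"
      unfolding s_def[abs_def]
      by (rule right_derivative_of_sum[OF _ _ d1[OF x] d2[OF x] l1[OF x] l2[OF x]])
         (use w1 w2 x pos in auto)
    have "(k1 * p1 x + k2 * p2 x - (p1 x)\<^sup>2 - (p2 x)\<^sup>2)
        / ((p1 x)\<^sup>2 + p1 x * p2 x + (p2 x)\<^sup>2) \<le> - 1/3"
      using num pos unfolding D[OF x] by (simp add: pos_divide_le_eq)
    then have "(k1 * p1 x + k2 * p2 x - (p1 x)\<^sup>2 - (p2 x)\<^sup>2)
        / ((p1 x)\<^sup>2 + p1 x * p2 x + (p2 x)\<^sup>2) < - 1/4" by simp
    from right_derivative_imp_increment_le[OF der this] show ?thesis by (simp add: algebra_simps)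
  qed
  have jump: "\<exists>\<delta>>0. \<forall>y. x - \<delta> < y \<and> y < x \<longrightarrow> s x \<le> s y + e" if x: "0 < x" and e: "0 < e" for x e
  proof -
    obtain L where L: "s x \<le> L" "(s \<longlongrightarrow> L) (at_left x)"
      using left[OF x] unfolding s_def by auto
    have "eventually (\<lambda>y. dist (s y) L < e) (at_left x)" using L(2) e by (rule tendstoD)
    then obtain b where b: "b < x" "\<And>y. b < y \<Longrightarrow> y < x \<Longrightarrow> dist (s y) L < e"
      unfolding eventually_at_left_field by auto
    show ?thesis
    proof (intro exI[of _ "x - b"] conjI allI impI)
      show "0 < x - b" using b by simp
      fix y assume "x - (x - b) < y \<and> y < x"
      then have "dist (s y) L < e" using b by auto
      then show "s x \<le> s y + e" using L(1) unfolding dist_real_def by linarith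
    qed
  qed
  have fall: "s b \<le> s a - (b - a) / 4"
    if "0 \<le> a" "a \<le> b" "\<And>x. a \<le> x \<Longrightarrow> x < b \<Longrightarrow> s x \<le> s a - (x - a) / 4 \<Longrightarrow> R \<le> D x" for a b
  proof -
    have "s b \<le> s a + - (1/4) * (b - a)"
    proof (rule right_increments_bounded[OF that(2)])
      fix x assume x: "a \<le> x" "x < b" "s x \<le> s a + - (1/4) * (x - a)"
      have "s x \<le> s a - (x - a) / 4" using x(3) by simp
      from decr[OF _ that(3)[OF x(1,2) this]] that(1) x(1)
      show "\<exists>\<delta>>0. \<forall>y. x < y \<and> y < x + \<delta> \<longrightarrow> s y \<le> s x + - (1/4) * (y - x)" by simp
    next
      fix x e assume "a < x" "0 < (e::real)"
      then show "\<exists>\<delta>>0. \<forall>y. x - \<delta> < y \<and> y < x \<longrightarrow> s x \<le> s y + e"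
        using jump that(1) by simp
    qed
    then show ?thesis by simp
  qed
  \<comment> \<open>By \<open>s_big\<close>, \<open>\<bar>s x\<bar> \<ge> S\<close> forces
    \<open>D x > R\<close>; once \<open>s\<close> is below \<open>- S\<close>, its decrease never
    stops.\<close>
  define S where "S = 2 * (R + 1)"
  have s_big: "R' < 3 / 4 * t\<^sup>2" if "2 * (R' + 1) \<le> \<bar>t\<bar>" "1 \<le> R'" for t R' :: real
  proof -
    have "(2 * (R' + 1))\<^sup>2 \<le> \<bar>t\<bar>\<^sup>2" using that by (intro power_mono) auto
    moreover have "R' < 3 / 4 * (2 * (R' + 1))\<^sup>2"
    proof -
      have le: "(R' + 1) * 1 \<le> (R' + 1) * (R' + 1)" using that(2) by (intro mult_left_mono) auto
      have eq: "3 / 4 * (2 * (R' + 1))\<^sup>2 = 3 * ((R' + 1) * (R' + 1))" by (simp add: power2_eq_square algebra_simps)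
      have "R' < 3 * z" if "R' + 1 \<le> z" for z using that \<open>1 \<le> R'\<close> by linarith
      then show ?thesis using le unfolding eq by simp
    qed
    ultimately show ?thesis by simp
  qed
  have lower: "- S \<le> s a" if a: "0 \<le> a" for a
  proof (rule ccontr)
    assume "\<not> - S \<le> s a"
    then have sa: "s a < - S" by simp
    have below: "s b \<le> s a - (b - a) / 4" if ab: "a \<le> b" for b
    proof (rule fall[OF a ab])
      fix x assume x: "a \<le> x" "s x \<le> s a - (x - a) / 4"
      then have "s x \<le> - S" using sa by argo
      then have "R < 3 / 4 * (s x)\<^sup>2" by (intro s_big R) (simp add: S_def)
      then show "R \<le> D x" using D_s[of x] a x by simp
    qed
    have "3 / 64 * t\<^sup>2 \<le> 4 * C * (1 + a + t)" if t: "0 \<le> t" for t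
    proof -
      have "t / 4 \<le> - s (a + t)" using below[of "a + t"] t sa R unfolding S_def by auto
      then have "(t / 4)\<^sup>2 \<le> (- s (a + t))\<^sup>2" using t by (intro power_mono) auto
      then have "3 / 64 * t\<^sup>2 \<le> 3 / 4 * (s (a + t))\<^sup>2" by (simp add: power_divide)
      also have "\<dots> \<le> D (a + t)" using D_s a t by simp
      also have "\<dots> \<le> 2 * (\<bar>w1 (a + t)\<bar> + \<bar>w2 (a + t)\<bar>)" by (rule D_up)
      also have "\<dots> \<le> 2 * (C * (1 + (a + t)) + C * (1 + (a + t)))"
        using growth[of "a + t"] a t by (intro mult_left_mono add_mono) auto
      finally show ?thesis by (simp add: algebra_simps)
    qed
    moreover define K where "K = 4 * \<bar>C\<bar> * (1 + a)"
    moreover have K: "K \<ge> 0" using a by (simp add: K_def)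
    moreover have "4 * C * (1 + a + t) \<le> K + K * t" if t: "0 \<le> t" for t
    proof -
      have "4 * C * (1 + a + t) \<le> 4 * \<bar>C\<bar> * (1 + a + t)" using a t by (intro mult_right_mono) auto
      also have "\<dots> \<le> 4 * \<bar>C\<bar> * ((1 + a) * (1 + t))" using a t by (intro mult_left_mono) (auto simp: algebra_simps)
      finally show ?thesis by (simp add: K_def algebra_simps)
    qed
    ultimately have ineq: "3 / 64 * t\<^sup>2 \<le> K + K * t" if "0 \<le> t" for t using that by fastforce
    \<comment> \<open>Now \<open>3 / 64 * t\<^sup>2 = 3 * (K + 1) * t\<close>, which exceeds
      \<open>K + K * t\<close>.\<close>
    define t where "t = 64 * (K + 1)"
    have t: "t \<ge> 1" using K by (simp add: t_def)
    have "3 / 64 * t\<^sup>2 = 3 * (K + 1) * t" by (simp add: t_def power2_eq_square)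
    moreover have "3 * (K + 1) * t = 3 * (K * t) + 3 * t" by (simp add: algebra_simps)
    moreover have "K * 1 \<le> K * t" using K t by (intro mult_left_mono) auto
    moreover have "0 \<le> K * t" using K t by simp
    ultimately show False using ineq[of t] t by linarith
  qed
  \<comment> \<open>Including \<open>D 0\<close> ensures, by intermediate values, that every
    excursion above the level \<open>R'\<close> starts at a point where \<open>D\<close> equals
    \<open>R'\<close>.\<close>
  define R' where "R' = max R (D 0)"
  have R': "R \<le> R'" "D 0 \<le> R'" "1 \<le> R'" using R by (auto simp: R'_def)
  \<comment> \<open>Bounds the length of an excursion: \<open>s\<close> is at most
    \<open>2 * (R' + 1)\<close> at its start, never goes below \<open>- S\<close>, and falls at rate
    at least 1/4.\<close>
  define \<Lambda> where "\<Lambda> = 4 * (2 * (R' + 1) + S)"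
  have \<Lambda>: "\<Lambda> \<ge> 0" using R R' by (simp add: \<Lambda>_def S_def)
  \<comment> \<open>Comes from absorbing \<open>4 * \<Lambda> * y\<close> into
    \<open>16 * \<Lambda>\<^sup>2 + y\<^sup>2 / 4\<close>, where \<open>y\<^sup>2\<close> is twice
    the maximum of \<open>D\<close> on the excursion.\<close>
  define B where "B = 2 * (8 * R' + 4 * \<Lambda> * (\<bar>k1\<bar> + \<bar>k2\<bar> + 1) + 16 * \<Lambda>\<^sup>2)"
  have upper: "D x \<le> R' + B" if x: "0 \<le> x" and big: "R' < D x" for x
  proof -
    have contD': "continuous_on {a..b} D" if "0 \<le> a" for a b
      using that by (intro continuous_on_subset[OF contD]) auto
    \<comment> \<open>The largest element of \<open>A\<close> is the start of the excursion that
      contains \<open>x\<close>.\<close>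
    define A where "A = {y \<in> {0..x}. D y = R'}"
    have "\<exists>y\<ge>0. y \<le> x \<and> D y = R'"
      using IVT'[of D 0 R' x] R' big x contD' by auto
    then have "A \<noteq> {}" by (auto simp: A_def)
    moreover have "compact A"
    proof -
      have "closed A" unfolding A_def
        by (rule continuous_closed_preimage_constant[OF contD'[OF order_refl]]) auto
      moreover have "A \<subseteq> {0..x}" by (auto simp: A_def)
      ultimately show ?thesis by (meson bounded_closed_interval bounded_subset compact_eq_bounded_closed)
    qed
    ultimately obtain a where a: "a \<in> A" "\<And>y. y \<in> A \<Longrightarrow> y \<le> a"
      using compact_attains_sup[of A] by blast
    then have a0: "0 \<le> a" "a \<le> x" "D a = R'" by (auto simp: A_def)
    have DR: "R' \<le> D y" if y: "a \<le> y" "y \<le> x" for y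
    proof (rule ccontr)
      assume "\<not> R' \<le> D y"
      then obtain z where "y \<le> z" "z \<le> x" "D z = R'"
        using IVT'[of D y R' x] big y a0 contD'[of y x] by auto
      then have "z \<in> A" using y a0 by (auto simp: A_def)
      with a(2) \<open>y \<le> z\<close> y have "y = a" by force
      then show False using a0 \<open>\<not> R' \<le> D y\<close> by simp
    qed
    have "s x \<le> s a - (x - a) / 4"
      by (rule fall[OF a0(1,2)]) (use DR R' in \<open>fastforce intro: order_trans\<close>)
    moreover have "s a \<le> 2 * (R' + 1)"
    proof (rule ccontr)
      assume "\<not> ?thesis"
      then have "R' < 3 / 4 * (s a)\<^sup>2" by (intro s_big R') auto
      then show False using D_s[OF a0(1)] a0(3) by simp
    qed
    ultimately have len: "x - a \<le> \<Lambda>" using lower[OF x] unfolding \<Lambda>_def by argo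
    have "\<exists>m\<in>{a..x}. \<forall>y\<in>{a..x}. D y \<le> D m"
      by (rule continuous_attains_sup[OF compact_Icc _ contD'[OF a0(1)]]) (use a0 in auto)
    then obtain m where m: "m \<in> {a..x}" "\<And>y. y \<in> {a..x} \<Longrightarrow> D y \<le> D m" by blast
    have m0: "0 \<le> m" "a \<le> m" "m \<le> x" using m a0 by auto
    define y where "y = sqrt (2 * D m)"
    have Dm: "0 \<le> D m" using DR[OF m0(2,3)] R' by linarith
    have y: "0 \<le> y" "y\<^sup>2 = 2 * D m" using Dm by (auto simp: y_def)
    define c where "c = \<bar>k1\<bar> + \<bar>k2\<bar> + 1 + y"
    have p: "\<bar>p1 z\<bar> \<le> y" "\<bar>p2 z\<bar> \<le> y" if "a \<le> z" "z < m" for z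
    proof -
      have "(p1 z)\<^sup>2 + (p2 z)\<^sup>2 \<le> 2 * D m" using D_p(1)[of z] m(2)[of z] that a0 m0 by auto
      then have "(p1 z)\<^sup>2 \<le> y\<^sup>2" "(p2 z)\<^sup>2 \<le> y\<^sup>2"
        unfolding y(2) using zero_le_power2[of "p1 z"] zero_le_power2[of "p2 z"] by linarith+
      then show "\<bar>p1 z\<bar> \<le> y" "\<bar>p2 z\<bar> \<le> y" using y(1) by (metis abs_le_square_iff abs_of_nonneg)+
    qed
    have i1: "\<bar>w1 m - w1 a\<bar> \<le> c * (m - a)"
    proof (rule right_derivative_bound[where D = "\<lambda>x. k1 - p1 x"])
      show "continuous_on {a..m} w1" using a0 by (intro continuous_on_subset[OF c1]) auto
      fix z assume z: "a \<le> z" "z < m"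
      show "(w1 has_real_derivative k1 - p1 z) (at z within {z..})" using d1 z a0 by simp
      show "\<bar>k1 - p1 z\<bar> < c" using p[OF z] unfolding c_def by linarith
    qed (use m0 in auto)
    have i2: "\<bar>w2 m - w2 a\<bar> \<le> c * (m - a)"
    proof (rule right_derivative_bound[where D = "\<lambda>x. k2 - p2 x"])
      show "continuous_on {a..m} w2" using a0 by (intro continuous_on_subset[OF c2]) auto
      fix z assume z: "a \<le> z" "z < m"
      show "(w2 has_real_derivative k2 - p2 z) (at z within {z..})" using d2 z a0 by simp
      show "\<bar>k2 - p2 z\<bar> < c" using p[OF z] unfolding c_def by linarith
    qed (use m0 in auto)
    have c\<Lambda>: "c * (m - a) \<le> c * \<Lambda>" using len m0 y(1) by (intro mult_left_mono) (auto simp: c_def)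
    have wa: "\<bar>w1 a\<bar> \<le> 2 * R'" "\<bar>w2 a\<bar> \<le> 2 * R'"
    proof -
      have N: "(p1 a)\<^sup>2 + (p2 a)\<^sup>2 \<le> 2 * R'" using D_p(1)[OF a0(1)] a0(3) by simp
      have "\<bar>p1 a * p2 a\<bar> \<le> ((p1 a)\<^sup>2 + (p2 a)\<^sup>2) / 2"
        using zero_le_power2[of "\<bar>p1 a\<bar> - \<bar>p2 a\<bar>"] by (simp add: power2_diff abs_mult)
      then show "\<bar>w1 a\<bar> \<le> 2 * R'" "\<bar>w2 a\<bar> \<le> 2 * R'"
        unfolding w1[OF a0(1)] w2[OF a0(1)]
        using N zero_le_power2[of "p1 a"] zero_le_power2[of "p2 a"] by argo+
    qed
    have "\<bar>w1 m\<bar> \<le> 2 * R' + c * \<Lambda>" "\<bar>w2 m\<bar> \<le> 2 * R' + c * \<Lambda>"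
      using order_trans[OF i1 c\<Lambda>] order_trans[OF i2 c\<Lambda>] wa by linarith+
    then have "D m \<le> 2 * (4 * R' + 2 * (c * \<Lambda>))"
      using D_up[of m] by argo
    also have "2 * (4 * R' + 2 * (c * \<Lambda>)) = 8 * R' + 4 * \<Lambda> * (\<bar>k1\<bar> + \<bar>k2\<bar> + 1) + 4 * \<Lambda> * y"
      by (simp add: c_def algebra_simps)
    finally have "D m \<le> 8 * R' + 4 * \<Lambda> * (\<bar>k1\<bar> + \<bar>k2\<bar> + 1) + 4 * \<Lambda> * y" .
    moreover have "16 * \<Lambda>\<^sup>2 + y\<^sup>2 / 4 - 4 * \<Lambda> * y = (4 * \<Lambda> - y / 2)\<^sup>2"
      by (simp add: power2_eq_square field_simps)
    then have "4 * \<Lambda> * y \<le> 16 * \<Lambda>\<^sup>2 + y\<^sup>2 / 4"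
      using zero_le_power2[of "4 * \<Lambda> - y / 2"] by linarith
    ultimately have "D m \<le> B" unfolding B_def y(2) by argo
    moreover have "D x \<le> D m" using m a0 by auto
    ultimately show ?thesis using R' by linarith
  qed
  have B0: "B \<ge> 0" using R' \<Lambda> unfolding B_def by (intro mult_nonneg_nonneg add_nonneg_nonneg) auto
  then have D_all: "D x \<le> R' + B" if "0 \<le> x" for x
    using upper[OF that] by (cases "R' < D x") auto
  show ?thesis
  proof (intro exI[of _ "sqrt (2 * (R' + B))"] allI impI conjI)
    fix x :: real assume x: "0 \<le> x"
    have "(p1 x)\<^sup>2 \<le> 2 * (R' + B)" "(p2 x)\<^sup>2 \<le> 2 * (R' + B)"
      using D_p(1)[OF x] D_all[OF x] zero_le_power2[of "p1 x"] zero_le_power2[of "p2 x"] by argo+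
    then show "\<bar>p1 x\<bar> \<le> sqrt (2 * (R' + B))" "\<bar>p2 x\<bar> \<le> sqrt (2 * (R' + B))"
      by (simp_all add: real_le_rsqrt)
  qed
qed

section \<open>Admissible solutions\<close>

text \<open>An admissible solution recorded through its left and right derivatives at every point.
  Both appear symmetrically because reflection exchanges them and because a feedback may take either
  value at a jump. Where \<open>r = - l\<close>, the two alternatives of (A3) merge into
  \<open>l1 x + l2 x \<ge> 0\<close>.\<close>

locale game_solution =
  fixes h1 h2 u1 u2 l1 l2 r1 r2 :: "real \<Rightarrow> real"
  assumes right_deriv1: "\<And>x. (u1 has_real_derivative r1 x) (at x within {x..})"
    and right_deriv2: "\<And>x. (u2 has_real_derivative r2 x) (at x within {x..})"
    and left_deriv1: "\<And>x. (u1 has_real_derivative l1 x) (at x within {..x})"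
    and left_deriv2: "\<And>x. (u2 has_real_derivative l2 x) (at x within {..x})"
    and right_lim_right1: "\<And>x. (r1 \<longlongrightarrow> r1 x) (at_right x)"
    and right_lim_right2: "\<And>x. (r2 \<longlongrightarrow> r2 x) (at_right x)"
    and right_lim_left1: "\<And>x. (l1 \<longlongrightarrow> r1 x) (at_right x)"
    and right_lim_left2: "\<And>x. (l2 \<longlongrightarrow> r2 x) (at_right x)"
    and left_lim_right1: "\<And>x. (r1 \<longlongrightarrow> l1 x) (at_left x)"
    and left_lim_right2: "\<And>x. (r2 \<longlongrightarrow> l2 x) (at_left x)"
    and left_lim_left1: "\<And>x. (l1 \<longlongrightarrow> l1 x) (at_left x)"
    and left_lim_left2: "\<And>x. (l2 \<longlongrightarrow> l2 x) (at_left x)"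
    and right_eq1: "\<And>x. u1 x = h1 x - r1 x * r2 x - (r1 x)\<^sup>2 / 2"
    and right_eq2: "\<And>x. u2 x = h2 x - r1 x * r2 x - (r2 x)\<^sup>2 / 2"
    and left_eq1: "\<And>x. u1 x = h1 x - l1 x * l2 x - (l1 x)\<^sup>2 / 2"
    and left_eq2: "\<And>x. u2 x = h2 x - l1 x * l2 x - (l2 x)\<^sup>2 / 2"
    and jump: "\<And>x. (r1 x = l1 x \<and> r2 x = l2 x) \<or> (r1 x = - l1 x \<and> r2 x = - l2 x \<and> l1 x + l2 x \<ge> 0)"
    and linear_growth: "\<exists>C. \<forall>x. \<bar>u1 x\<bar> \<le> C * (1 + \<bar>x\<bar>) \<and> \<bar>u2 x\<bar> \<le> C * (1 + \<bar>x\<bar>)"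

section \<open>Symmetries and a priori bounds of admissible solutions\<close>

lemma tendsto_mirror:
  fixes f :: "real \<Rightarrow> real"
  shows "(f \<longlongrightarrow> l) (at_left (- x)) \<Longrightarrow> ((\<lambda>y. - f (- y)) \<longlongrightarrow> - l) (at_right x)"
    and "(f \<longlongrightarrow> l) (at_right (- x)) \<Longrightarrow> ((\<lambda>y. - f (- y)) \<longlongrightarrow> - l) (at_left x)"
proof -
  assume "(f \<longlongrightarrow> l) (at_left (- x))"
  then show "((\<lambda>y. - f (- y)) \<longlongrightarrow> - l) (at_right x)"
    unfolding filterlim_at_left_to_right[of _ _ "- x"] by (intro tendsto_minus) simp
next
  assume "(f \<longlongrightarrow> l) (at_right (- x))"
  then show "((\<lambda>y. - f (- y)) \<longlongrightarrow> - l) (at_left x)"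
    unfolding filterlim_at_left_to_right[of _ _ x] by (intro tendsto_minus) simp
qed

lemma has_real_derivative_mirror:
  fixes f :: "real \<Rightarrow> real"
  shows "(f has_real_derivative d) (at (- x) within {..- x}) \<Longrightarrow> ((\<lambda>y. f (- y)) has_real_derivative - d) (at x within {x..})"
    and "(f has_real_derivative d) (at (- x) within {- x..}) \<Longrightarrow> ((\<lambda>y. f (- y)) has_real_derivative - d) (at x within {..x})"
proof -
  assume *: "(f has_real_derivative d) (at (- x) within {..- x})"
  have "(f \<circ> uminus has_real_derivative d * - 1) (at x within {x..})"
    by (rule DERIV_image_chain) (use * in \<open>auto intro!: derivative_eq_intros\<close>)
  then show "((\<lambda>y. f (- y)) has_real_derivative - d) (at x within {x..})" by (simp add: o_def)
next
  assume *: "(f has_real_derivative d) (at (- x) within {- x..})"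
  have "(f \<circ> uminus has_real_derivative d * - 1) (at x within {..x})"
    by (rule DERIV_image_chain) (use * in \<open>auto intro!: derivative_eq_intros\<close>)
  then show "((\<lambda>y. f (- y)) has_real_derivative - d) (at x within {..x})" by (simp add: o_def)
qed

context game_solution
begin

lemma swap: "game_solution h2 h1 u2 u1 l2 l1 r2 r1"
proof
  show "\<exists>C. \<forall>x. \<bar>u2 x\<bar> \<le> C * (1 + \<bar>x\<bar>) \<and> \<bar>u1 x\<bar> \<le> C * (1 + \<bar>x\<bar>)"
    using linear_growth by blast
  show "(r2 x = l2 x \<and> r1 x = l1 x) \<or> (r2 x = - l2 x \<and> r1 x = - l1 x \<and> l2 x + l1 x \<ge> 0)" for x
    using jump[of x] by (auto simp: add.commute)
qed (use right_deriv1 right_deriv2 left_deriv1 left_deriv2 right_lim_right1 right_lim_right2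
      right_lim_left1 right_lim_left2 left_lim_right1 left_lim_right2 left_lim_left1 left_lim_left2
      right_eq1 right_eq2 left_eq1 left_eq2 in \<open>simp_all add: mult.commute\<close>)

text \<open>At a jump the left sum of the reflected solution is \<open>- r1 - r2\<close>, which
  equals the old \<open>l1 + l2\<close>; admissibility is therefore invariant. This reduces the left
  half-line to the right one.\<close>

lemma mirror: "game_solution (\<lambda>x. h1 (- x)) (\<lambda>x. h2 (- x)) (\<lambda>x. u1 (- x)) (\<lambda>x. u2 (- x))
    (\<lambda>x. - r1 (- x)) (\<lambda>x. - r2 (- x)) (\<lambda>x. - l1 (- x)) (\<lambda>x. - l2 (- x))"
proof
  obtain C where "\<forall>x. \<bar>u1 x\<bar> \<le> C * (1 + \<bar>x\<bar>) \<and> \<bar>u2 x\<bar> \<le> C * (1 + \<bar>x\<bar>)"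
    using linear_growth by blast
  then have "\<bar>u1 (- x)\<bar> \<le> C * (1 + \<bar>x\<bar>) \<and> \<bar>u2 (- x)\<bar> \<le> C * (1 + \<bar>x\<bar>)" for x
    by (metis abs_minus)
  then show "\<exists>C. \<forall>x. \<bar>u1 (- x)\<bar> \<le> C * (1 + \<bar>x\<bar>) \<and> \<bar>u2 (- x)\<bar> \<le> C * (1 + \<bar>x\<bar>)"
    by blast
  show "(- l1 (- x) = - r1 (- x) \<and> - l2 (- x) = - r2 (- x)) \<or>
    (- l1 (- x) = - (- r1 (- x)) \<and> - l2 (- x) = - (- r2 (- x)) \<and> - r1 (- x) + - r2 (- x) \<ge> 0)" for x
    using jump[of "- x"] by auto
qed (auto intro!: tendsto_mirror has_real_derivative_mirror right_deriv1 right_deriv2 left_deriv1 left_deriv2 right_lim_right1 right_lim_right2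
      right_lim_left1 right_lim_left2 left_lim_right1 left_lim_right2 left_lim_left1 left_lim_left2
      simp: right_eq1[symmetric] right_eq2[symmetric] left_eq1[symmetric] left_eq2[symmetric])

lemma continuous_u: "isCont u1 x" "isCont u2 x"
proof -
  have "continuous (at x within {x..}) u1" "continuous (at x within {..x}) u1"
    "continuous (at x within {x..}) u2" "continuous (at x within {..x}) u2"
    by (rule DERIV_continuous, rule right_deriv1 left_deriv1 right_deriv2 left_deriv2)+
  then have "continuous (at x within {x..} \<union> {..x}) u1" "continuous (at x within {x..} \<union> {..x}) u2"
    unfolding continuous_within Lim_within_Un by auto
  moreover have "{x..} \<union> {..x} = (UNIV :: real set)" by auto
  ultimately show "isCont u1 x" "isCont u2 x" by simp_all
qed

lemma derivative: "l1 x = r1 x \<Longrightarrow> (u1 has_real_derivative r1 x) (at x)"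
proof -
  assume "l1 x = r1 x"
  then have "(u1 has_real_derivative r1 x) (at x within {x..} \<union> {..x})"
    using left_deriv1[of x] right_deriv1[of x]
    by (simp add: has_field_derivative_iff Lim_within_Un)
  moreover have "{x..} \<union> {..x} = (UNIV :: real set)" by auto
  ultimately show ?thesis by simp
qed

lemma right_derivatives_bounded:
  assumes h: "\<And>x. 0 \<le> x \<Longrightarrow> h1 x = h1 0 + k1 * x" "\<And>x. 0 \<le> x \<Longrightarrow> h2 x = h2 0 + k2 * x"
  shows "\<exists>B. \<forall>x\<ge>0. \<bar>r1 x\<bar> \<le> B \<and> \<bar>r2 x\<bar> \<le> B"
proof -
  obtain C where C: "\<And>x. \<bar>u1 x\<bar> \<le> C * (1 + \<bar>x\<bar>)" "\<And>x. \<bar>u2 x\<bar> \<le> C * (1 + \<bar>x\<bar>)"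
    using linear_growth by blast
  define w1 w2 where "w1 x = h1 0 + k1 * x - u1 x" and "w2 x = h2 0 + k2 * x - u2 x" for x
  define C' where "C' = \<bar>h1 0\<bar> + \<bar>h2 0\<bar> + \<bar>k1\<bar> + \<bar>k2\<bar> + C"
  show ?thesis
  proof (rule half_line_bounded[of w1 r1 r2 w2 k1 k2 C'])
    fix x :: real assume x: "0 \<le> x"
    show "w1 x = r1 x * r2 x + (r1 x)\<^sup>2 / 2" "w2 x = r1 x * r2 x + (r2 x)\<^sup>2 / 2"
      using right_eq1[of x] right_eq2[of x] h(1)[OF x] h(2)[OF x] by (auto simp: w1_def w2_def)
    show "(w1 has_real_derivative k1 - r1 x) (at x within {x..})"
        "(w2 has_real_derivative k2 - r2 x) (at x within {x..})"
      unfolding w1_def w2_def by (auto intro!: derivative_eq_intros right_deriv1 right_deriv2)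
    show "(r1 \<longlongrightarrow> r1 x) (at_right x)" "(r2 \<longlongrightarrow> r2 x) (at_right x)"
      by (rule right_lim_right1 right_lim_right2)+
    have bound: "\<bar>c + k * x - v\<bar> \<le> C' * (1 + x)"
      if v: "\<bar>v\<bar> \<le> C * (1 + \<bar>x\<bar>)" and le: "\<bar>c\<bar> + \<bar>k\<bar> + C \<le> C'" for c k v
    proof -
      have "\<bar>c + k * x - v\<bar> \<le> \<bar>c\<bar> + \<bar>k * x\<bar> + \<bar>v\<bar>" by linarith
      also have "\<dots> \<le> \<bar>c\<bar> * (1 + x) + \<bar>k\<bar> * (1 + x) + C * (1 + x)"
        using v x by (intro add_mono) (auto simp: abs_mult algebra_simps)
      also have "\<dots> = (\<bar>c\<bar> + \<bar>k\<bar> + C) * (1 + x)" by (simp add: algebra_simps)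
      also have "\<dots> \<le> C' * (1 + x)" using le x by (intro mult_right_mono) auto
      finally show ?thesis .
    qed
    show "\<bar>w1 x\<bar> \<le> C' * (1 + x)" "\<bar>w2 x\<bar> \<le> C' * (1 + x)"
      unfolding w1_def w2_def by (rule bound; simp add: C C'_def)+
  next
    show "continuous_on {0..} w1" "continuous_on {0..} w2"
      unfolding w1_def w2_def
      by (auto intro!: continuous_intros continuous_at_imp_continuous_on continuous_u)
  next
    fix x :: real assume x: "0 < x"
    have "((\<lambda>y. r1 y + r2 y) \<longlongrightarrow> l1 x + l2 x) (at_left x)"
      by (intro tendsto_add left_lim_right1 left_lim_right2)
    moreover have "r1 x + r2 x \<le> l1 x + l2 x" using jump[of x] by auto
    ultimately show "\<exists>L\<ge>r1 x + r2 x. ((\<lambda>y. r1 y + r2 y) \<longlongrightarrow> L) (at_left x)" by blast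
  qed
qed

text \<open>The reflected estimate bounds \<open>l\<close> on the left half-line, and
  \<open>l\<close> and \<open>r\<close> agree up to sign everywhere.\<close>

lemma one_sided_derivatives_bounded:
  assumes h: "\<And>x. 0 \<le> x \<Longrightarrow> h1 x = h1 0 + k11 * x" "\<And>x. 0 \<le> x \<Longrightarrow> h2 x = h2 0 + k21 * x"
    and h': "\<And>x. x \<le> 0 \<Longrightarrow> h1 x = h1 0 + k10 * x" "\<And>x. x \<le> 0 \<Longrightarrow> h2 x = h2 0 + k20 * x"
  obtains B where "\<And>x. \<bar>r1 x\<bar> \<le> B" "\<And>x. \<bar>r2 x\<bar> \<le> B" "\<And>x. \<bar>l1 x\<bar> \<le> B" "\<And>x. \<bar>l2 x\<bar> \<le> B"
proof -
  obtain B1 where B1: "\<And>x. 0 \<le> x \<Longrightarrow> \<bar>r1 x\<bar> \<le> B1 \<and> \<bar>r2 x\<bar> \<le> B1"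
    using right_derivatives_bounded[OF h] by blast
  interpret m: game_solution "\<lambda>x. h1 (- x)" "\<lambda>x. h2 (- x)" "\<lambda>x. u1 (- x)" "\<lambda>x. u2 (- x)"
    "\<lambda>x. - r1 (- x)" "\<lambda>x. - r2 (- x)" "\<lambda>x. - l1 (- x)" "\<lambda>x. - l2 (- x)"
    by (rule mirror)
  have "h1 (- x) = h1 (- 0) + - k10 * x" "h2 (- x) = h2 (- 0) + - k20 * x" if "0 \<le> x" for x
    using h'(1)[of "- x"] h'(2)[of "- x"] that by simp_all
  then obtain B2 where B2: "\<And>x. 0 \<le> x \<Longrightarrow> \<bar>- l1 (- x)\<bar> \<le> B2 \<and> \<bar>- l2 (- x)\<bar> \<le> B2"
    using m.right_derivatives_bounded by metis
  have abs: "\<bar>l1 x\<bar> = \<bar>r1 x\<bar>" "\<bar>l2 x\<bar> = \<bar>r2 x\<bar>" for x using jump[of x] by auto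
  have "\<bar>r1 x\<bar> \<le> max B1 B2 \<and> \<bar>r2 x\<bar> \<le> max B1 B2" for x
  proof (cases "0 \<le> x")
    case True then show ?thesis using B1[of x] by auto
  next
    case False then show ?thesis using B2[of "- x"] abs[of x] by auto
  qed
  then show thesis using that[of "max B1 B2"] abs by simp
qed

text \<open>At a jump \<open>l + r\<close> vanishes in both components. On either side of it
  \<open>l\<close> and \<open>r\<close> share a limit with a nonzero component, so
  \<open>l + r\<close> is nonzero at all nearby points, which excludes further jumps.\<close>

lemma discrete_jumps: "discrete {x. (l1 x, l2 x) \<noteq> (r1 x, r2 x)}" (is "discrete ?J")
  unfolding discrete_altdef
proof
  fix x assume x: "x \<in> ?J"
  then have ne: "l1 x \<noteq> 0 \<or> l2 x \<noteq> 0" and neg: "r1 x = - l1 x" "r2 x = - l2 x"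
    using jump[of x] by auto
  have nj: "y \<notin> ?J" if "l1 y + r1 y \<noteq> 0 \<or> l2 y + r2 y \<noteq> 0" for y
    using jump[of y] that by auto
  have "eventually (\<lambda>y. y \<notin> ?J) (at_right x)"
  proof (cases "l1 x = 0")
    case True
    then have "r2 x + r2 x \<noteq> 0" using ne neg by auto
    from tendsto_imp_eventually_ne[OF tendsto_add[OF right_lim_left2 right_lim_right2] this]
    show ?thesis by (rule eventually_mono) (use nj in auto)
  next
    case False
    then have "r1 x + r1 x \<noteq> 0" using ne neg by auto
    from tendsto_imp_eventually_ne[OF tendsto_add[OF right_lim_left1 right_lim_right1] this]
    show ?thesis by (rule eventually_mono) (use nj in auto)
  qed
  moreover have "eventually (\<lambda>y. y \<notin> ?J) (at_left x)"
  proof (cases "l1 x = 0")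
    case True
    then have "l2 x + l2 x \<noteq> 0" using ne by auto
    from tendsto_imp_eventually_ne[OF tendsto_add[OF left_lim_left2 left_lim_right2] this]
    show ?thesis by (rule eventually_mono) (use nj in auto)
  next
    case False
    then have "l1 x + l1 x \<noteq> 0" by auto
    from tendsto_imp_eventually_ne[OF tendsto_add[OF left_lim_left1 left_lim_right1] this]
    show ?thesis by (rule eventually_mono) (use nj in auto)
  qed
  ultimately show "eventually (\<lambda>y. y \<notin> ?J) (at x)"
    by (simp add: eventually_at_split)
qed

end

lemma discrete_imp_countable:
  fixes S :: "'a::second_countable_topology set"
  assumes "discrete S"
  shows "countable S"
proof -
  have "\<exists>T. open T \<and> T \<inter> S = {x}" if "x \<in> S" for x
    using discreteD[OF assms that] unfolding isolated_in_def by auto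
  then obtain T where T: "\<And>x. x \<in> S \<Longrightarrow> open (T x) \<and> T x \<inter> S = {x}" by metis
  obtain F where F: "F \<subseteq> T ` S" "countable F" "\<Union>F = \<Union>(T ` S)"
  proof (rule Lindelof[of "T ` S"])
    show "open A" if "A \<in> T ` S" for A using that T by auto
  qed auto
  have "S \<subseteq> (\<Union>A\<in>F. A \<inter> S)"
  proof
    fix x assume x: "x \<in> S"
    then have "x \<in> \<Union>F" unfolding F(3) using T[OF x] by auto
    then show "x \<in> (\<Union>A\<in>F. A \<inter> S)" using x by auto
  qed
  moreover have "countable (A \<inter> S)" if A: "A \<in> F" for A
  proof -
    obtain x where "x \<in> S" "A = T x" using A F(1) by blast
    then show ?thesis using T by simp
  qed
  ultimately show ?thesis using F(2) by (meson countable_UN countable_subset)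
qed

text \<open>Lets an identity that holds at almost every point pass to the one-sided limits at every
  point.\<close>

lemma AE_lebesgue_frequently_unique_limit:
  fixes y :: real and f :: "real \<Rightarrow> real"
  assumes G: "AE x in lebesgue. x \<in> G"
    and S: "S = {y<..} \<or> S = {..<y}"
    and f: "(f \<longlongrightarrow> a) (at y within S \<inter> G)" and g: "(g \<longlongrightarrow> b) (at y within S)"
    and eq: "\<And>x. x \<in> S \<Longrightarrow> x \<in> G \<Longrightarrow> f x = g x"
  shows "a = b"
proof -
  have nb: "at y within S \<inter> G \<noteq> bot"
    using AE_lebesgue_islimpt[OF G, of y] S trivial_limit_within[of y "S \<inter> G"] by (auto simp: Int_commute)
  have "(g \<longlongrightarrow> b) (at y within S \<inter> G)" using g by (rule tendsto_within_subset) auto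
  moreover have "eventually (\<lambda>x. g x = f x) (at y within S \<inter> G)"
    unfolding eventually_at_filter using eq by (auto intro: always_eventually)
  ultimately have "(f \<longlongrightarrow> b) (at y within S \<inter> G)" by (rule Lim_transform_eventually)
  with f show ?thesis by (rule tendsto_unique[OF nb])
qed

text \<open>The system, known at almost every point, is carried to both one-sided derivatives at
  every point by limits along the full-measure set \<open>G\<close>; every discontinuity is then a
  change of sign. The two equivalences reduce \<open>feedback_of\<close> to a choice between two
  explicit values.\<close>

theorem admissible_solution_branches:
  assumes adm: "admissible_solution h1 h2 u" and h: "continuous_on UNIV h1" "continuous_on UNIV h2"
  obtains l1 l2 r1 r2 where "game_solution h1 h2 (\<lambda>x. fst (u x)) (\<lambda>x. snd (u x)) l1 l2 r1 r2"
    "\<And>y p. deriv_limit_left u y p \<longleftrightarrow> p = (l1 y, l2 y)"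
    "\<And>y p. deriv_limit_right u y p \<longleftrightarrow> p = (r1 y, r2 y)"
proof -
  have ac: "\<And>a b. abs_continuous_on {a..b} u"
    using adm by (simp add: admissible_solution_def)
  define G where "G = {x. \<exists>p1 p2. (u has_vector_derivative (p1, p2)) (at x) \<and>
        fst (u x) = h1 x - p1 * p2 - p1\<^sup>2 / 2 \<and> snd (u x) = h2 x - p1 * p2 - p2\<^sup>2 / 2}"
  have G: "AE x in lebesgue. x \<in> G" using adm by (simp add: admissible_solution_def G_def)
  have Gd: "u differentiable (at x)" if "x \<in> G" for x
    using that by (auto simp: G_def intro: differentiableI_vector)
  then have ae: "AE x in lebesgue. u differentiable (at x)" using G by (auto elim: eventually_mono)
  have "\<forall>y. \<exists>l1 l2 r1 r2. deriv_limit_left u y (l1, l2) \<and> deriv_limit_right u y (r1, r2) \<and>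
        ((l1, l2) \<noteq> (r1, r2) \<longrightarrow> r1 + r2 \<le> 0 \<or> l1 + l2 \<ge> 0)"
    using adm by (simp add: admissible_solution_def)
  then obtain l1 l2 r1 r2 where L: "\<And>y. deriv_limit_left u y (l1 y, l2 y)"
    and R: "\<And>y. deriv_limit_right u y (r1 y, r2 y)"
    and J: "\<And>y. (l1 y, l2 y) \<noteq> (r1 y, r2 y) \<Longrightarrow> r1 y + r2 y \<le> 0 \<or> l1 y + l2 y \<ge> 0"
    by metis
  have dR: "(u has_vector_derivative p) (at y within {y..})" if "deriv_limit_right u y p" for y p
    by (rule deriv_limit_imp_has_vector_derivative[OF ac ae, where S = "{y<..}"])
       (use that in \<open>auto simp: deriv_limit_right_def\<close>)
  have dL: "(u has_vector_derivative p) (at y within {..y})" if "deriv_limit_left u y p" for y p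
    by (rule deriv_limit_imp_has_vector_derivative[OF ac ae, where S = "{..<y}"])
       (use that in \<open>auto simp: deriv_limit_left_def\<close>)
  note comp = bounded_linear.has_vector_derivative[OF bounded_linear_fst]
    bounded_linear.has_vector_derivative[OF bounded_linear_snd]
  have tR: "(q \<longlongrightarrow> (r1 y, r2 y)) (at_right y)" and tL: "(q \<longlongrightarrow> (l1 y, l2 y)) (at_left y)"
    if "\<And>x. (u has_vector_derivative q x) (at x within {x..}) \<or> (u has_vector_derivative q x) (at x within {..x})" for q y
    using one_sided_derivatives_tendsto[OF ac ae, of "(r1 y, r2 y)" y "{y<..}" q]
      one_sided_derivatives_tendsto[OF ac ae, of "(l1 y, l2 y)" y "{..<y}" q] R[of y] L[of y] that
    by (simp_all add: deriv_limit_right_def deriv_limit_left_def)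
  have ulim: "((\<lambda>x. fst (u x)) \<longlongrightarrow> fst (u y)) (at y)" "((\<lambda>x. snd (u x)) \<longlongrightarrow> snd (u y)) (at y)" for y
  proof -
    have "continuous_on {y - 1<..<y + 1} u"
      by (rule continuous_on_subset[OF abs_continuous_on_imp_continuous_on[OF ac[of "y-1" "y+1"]]]) auto
    then have "(u \<longlongrightarrow> u y) (at y)"
      by (simp add: continuous_on_eq_continuous_at isCont_def)
    then show "((\<lambda>x. fst (u x)) \<longlongrightarrow> fst (u y)) (at y)" "((\<lambda>x. snd (u x)) \<longlongrightarrow> snd (u y)) (at y)"
      by (rule tendsto_fst tendsto_snd)+
  qed
  have hlim: "(h1 \<longlongrightarrow> h1 y) (at y)" "(h2 \<longlongrightarrow> h2 y) (at y)" for y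
    using h by (auto simp: continuous_on_eq_continuous_at isCont_def)
  have eqs: "fst (u y) = h1 y - p1 * p2 - p1\<^sup>2 / 2 \<and> snd (u y) = h2 y - p1 * p2 - p2\<^sup>2 / 2"
    if S: "S = {y<..} \<or> S = {..<y}"
      and lim: "((\<lambda>x. vector_derivative u (at x)) \<longlongrightarrow> (p1, p2)) (at y within {x. x \<in> S \<and> u differentiable (at x)})"
    for y p1 p2 S
  proof -
    let ?v = "\<lambda>x. vector_derivative u (at x)"
    have v: "(?v \<longlongrightarrow> (p1, p2)) (at y within S \<inter> G)"
      using lim by (rule tendsto_within_subset) (use Gd in auto)
    have v1: "((\<lambda>x. fst (?v x)) \<longlongrightarrow> p1) (at y within S \<inter> G)" and v2: "((\<lambda>x. snd (?v x)) \<longlongrightarrow> p2) (at y within S \<inter> G)"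
      using tendsto_fst[OF v] tendsto_snd[OF v] by simp_all
    have Gv: "fst (u x) = h1 x - fst (?v x) * snd (?v x) - (fst (?v x))\<^sup>2 / 2"
        "snd (u x) = h2 x - fst (?v x) * snd (?v x) - (snd (?v x))\<^sup>2 / 2" if "x \<in> G" for x
      using that by (auto simp: G_def vector_derivative_at)
    have sub: "((\<lambda>x. fst (u x)) \<longlongrightarrow> fst (u y)) (at y within S)" "((\<lambda>x. snd (u x)) \<longlongrightarrow> snd (u y)) (at y within S)"
      using ulim[of y] by (auto intro: tendsto_within_subset)
    have hs: "(h1 \<longlongrightarrow> h1 y) (at y within S \<inter> G)" "(h2 \<longlongrightarrow> h2 y) (at y within S \<inter> G)"
      using hlim[of y] by (auto intro: tendsto_within_subset)
    have "h1 y - p1 * p2 - p1\<^sup>2 / 2 = fst (u y)"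
    proof (rule AE_lebesgue_frequently_unique_limit[OF G S _ sub(1)])
      show "((\<lambda>x. h1 x - fst (?v x) * snd (?v x) - (fst (?v x))\<^sup>2 / 2) \<longlongrightarrow> h1 y - p1 * p2 - p1\<^sup>2 / 2) (at y within S \<inter> G)"
        by (intro tendsto_intros hs v1 v2) auto
    qed (simp add: Gv)
    moreover have "h2 y - p1 * p2 - p2\<^sup>2 / 2 = snd (u y)"
    proof (rule AE_lebesgue_frequently_unique_limit[OF G S _ sub(2)])
      show "((\<lambda>x. h2 x - fst (?v x) * snd (?v x) - (snd (?v x))\<^sup>2 / 2) \<longlongrightarrow> h2 y - p1 * p2 - p2\<^sup>2 / 2) (at y within S \<inter> G)"
        by (intro tendsto_intros hs v1 v2) auto
    qed (simp add: Gv)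
    ultimately show ?thesis by simp
  qed
  have eqR: "fst (u y) = h1 y - r1 y * r2 y - (r1 y)\<^sup>2 / 2" "snd (u y) = h2 y - r1 y * r2 y - (r2 y)\<^sup>2 / 2" for y
    using eqs[of "{y<..}" y "r1 y" "r2 y"] R[of y] by (auto simp: deriv_limit_right_def)
  have eqL: "fst (u y) = h1 y - l1 y * l2 y - (l1 y)\<^sup>2 / 2" "snd (u y) = h2 y - l1 y * l2 y - (l2 y)\<^sup>2 / 2" for y
    using eqs[of "{..<y}" y "l1 y" "l2 y"] L[of y] by (auto simp: deriv_limit_left_def)
  obtain C where C: "\<And>x. norm (u x) \<le> C * (1 + \<bar>x\<bar>)" using adm by (auto simp: admissible_solution_def)
  have "game_solution h1 h2 (\<lambda>x. fst (u x)) (\<lambda>x. snd (u x)) l1 l2 r1 r2"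
  proof
    fix x
    show "((\<lambda>x. fst (u x)) has_real_derivative r1 x) (at x within {x..})"
      "((\<lambda>x. snd (u x)) has_real_derivative r2 x) (at x within {x..})"
      using comp[OF dR[OF R[of x]]] by (simp_all add: has_real_derivative_iff_has_vector_derivative)
    show "((\<lambda>x. fst (u x)) has_real_derivative l1 x) (at x within {..x})"
      "((\<lambda>x. snd (u x)) has_real_derivative l2 x) (at x within {..x})"
      using comp[OF dL[OF L[of x]]] by (simp_all add: has_real_derivative_iff_has_vector_derivative)
    have qR: "((\<lambda>x. (r1 x, r2 x)) \<longlongrightarrow> (r1 x, r2 x)) (at_right x)" "((\<lambda>x. (l1 x, l2 x)) \<longlongrightarrow> (r1 x, r2 x)) (at_right x)"
      by (rule tR; use dR[OF R] dL[OF L] in blast)+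
    have qL: "((\<lambda>x. (r1 x, r2 x)) \<longlongrightarrow> (l1 x, l2 x)) (at_left x)" "((\<lambda>x. (l1 x, l2 x)) \<longlongrightarrow> (l1 x, l2 x)) (at_left x)"
      by (rule tL; use dR[OF R] dL[OF L] in blast)+
    show "(r1 \<longlongrightarrow> r1 x) (at_right x)" "(r2 \<longlongrightarrow> r2 x) (at_right x)"
      using tendsto_fst[OF qR(1)] tendsto_snd[OF qR(1)] by simp_all
    show "(l1 \<longlongrightarrow> r1 x) (at_right x)" "(l2 \<longlongrightarrow> r2 x) (at_right x)"
      using tendsto_fst[OF qR(2)] tendsto_snd[OF qR(2)] by simp_all
    show "(r1 \<longlongrightarrow> l1 x) (at_left x)" "(r2 \<longlongrightarrow> l2 x) (at_left x)"
      using tendsto_fst[OF qL(1)] tendsto_snd[OF qL(1)] by simp_all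
    show "(l1 \<longlongrightarrow> l1 x) (at_left x)" "(l2 \<longlongrightarrow> l2 x) (at_left x)"
      using tendsto_fst[OF qL(2)] tendsto_snd[OF qL(2)] by simp_all
    show "fst (u x) = h1 x - r1 x * r2 x - (r1 x)\<^sup>2 / 2" "snd (u x) = h2 x - r1 x * r2 x - (r2 x)\<^sup>2 / 2"
      "fst (u x) = h1 x - l1 x * l2 x - (l1 x)\<^sup>2 / 2" "snd (u x) = h2 x - l1 x * l2 x - (l2 x)\<^sup>2 / 2"
      by (rule eqR eqL)+
    have "(r1 x = l1 x \<and> r2 x = l2 x) \<or> (r1 x = - l1 x \<and> r2 x = - l2 x)"
      by (rule quadratic_pair_eq_imp_eq_or_neg) (use eqR[of x] eqL[of x] in linarith)+
    then show "(r1 x = l1 x \<and> r2 x = l2 x) \<or> (r1 x = - l1 x \<and> r2 x = - l2 x \<and> 0 \<le> l1 x + l2 x)"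
      using J[of x] by auto
  next
    show "\<exists>C. \<forall>x. \<bar>fst (u x)\<bar> \<le> C * (1 + \<bar>x\<bar>) \<and> \<bar>snd (u x)\<bar> \<le> C * (1 + \<bar>x\<bar>)"
      using C norm_fst_le[of "fst (u _)" "snd (u _)"] norm_snd_le[of "snd (u _)" "fst (u _)"]
      by (metis order_trans prod.collapse real_norm_def)
  qed
  moreover have "p = (l1 y, l2 y)" if "deriv_limit_left u y p" for y p
    using vector_derivative_unique_within[OF _ dL[OF that] dL[OF L[of y]]] islimpt_half_line(2)[of y]
    by (simp add: trivial_limit_within)
  moreover have "p = (r1 y, r2 y)" if "deriv_limit_right u y p" for y p
    using vector_derivative_unique_within[OF _ dR[OF that] dR[OF R[of y]]] islimpt_half_line(1)[of y]
    by (simp add: trivial_limit_within)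
  ultimately show thesis using that[of l1 l2 r1 r2] L R by blast
qed

section \<open>Verification\<close>

lemma exp_minus_lipschitz:
  fixes s t :: real
  assumes "0 \<le> s" "0 \<le> t"
  shows "\<bar>exp (- t) - exp (- s)\<bar> \<le> \<bar>t - s\<bar>"
proof -
  have *: "exp (- a) - exp (- b) \<le> b - a \<and> 0 \<le> exp (- a) - exp (- b)" if "0 \<le> a" "a \<le> b" for a b :: real
  proof -
    have "exp (- a) - exp (- b) = exp (- a) * (1 - exp (- (b - a)))"
      by (simp add: algebra_simps flip: exp_add)
    also have "\<dots> \<le> 1 * (b - a)"
    proof (rule mult_mono)
      show "1 - exp (- (b - a)) \<le> b - a" using exp_ge_add_one_self[of "- (b - a)"] by linarith
      show "0 \<le> 1 - exp (- (b - a))" using that by simp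
    qed (use that in auto)
    finally show ?thesis using that by simp
  qed
  show ?thesis
    using *[of s t] *[of t s] assms by (cases "s \<le> t") auto
qed

text \<open>With nonzero derivative \<open>x\<close> leaves its value at once, and the values near
  it avoid the discrete set \<open>J\<close>; such times are isolated. So for almost every time of
  differentiability spent in \<open>J\<close> the velocity is 0.\<close>

lemma derivative_at_discrete_countable:
  fixes x d :: "real \<Rightarrow> real"
  assumes J: "discrete J"
  shows "countable {t. x t \<in> J \<and> d t \<noteq> 0 \<and> (x has_real_derivative d t) (at t)}" (is "countable ?E")
proof (rule discrete_imp_countable)
  show "discrete ?E"
    unfolding discrete_altdef
  proof
    fix t assume t: "t \<in> ?E"
    then have der: "(x has_real_derivative d t) (at t)" "d t \<noteq> 0" "x t \<in> J" by auto
    have "eventually (\<lambda>s. (x s - x t) / (s - t) \<noteq> 0) (at t)"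
      using der(1,2) unfolding has_field_derivative_iff by (rule tendsto_imp_eventually_ne)
    then have "eventually (\<lambda>s. x s \<noteq> x t) (at t)" by eventually_elim auto
    moreover have "(x \<longlongrightarrow> x t) (at t)" using DERIV_isCont[OF der(1)] by (simp add: isCont_def)
    ultimately have "filterlim x (at (x t)) (at t)" by (simp add: filterlim_at)
    moreover have "eventually (\<lambda>z. z \<notin> J) (at (x t))" using J der(3) unfolding discrete_altdef by blast
    ultimately have "eventually (\<lambda>s. x s \<notin> J) (at t)" by (rule eventually_compose_filterlim[rotated])
    then show "eventually (\<lambda>s. s \<notin> ?E) (at t)" by eventually_elim auto
  qed
qed

lemma exp_half_integrable: "set_integrable lebesgue {0..} (\<lambda>t. K * exp (- t / 2 :: real))"
proof -
  have "((\<lambda>t::real. exp (- (1/2) * t)) has_integral exp (- (1/2) * 0) / (1/2)) {0..}"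
    by (rule has_integral_exp_minus_to_infinity) simp
  then have "(\<lambda>t. exp (- t / 2 :: real)) integrable_on {0..}"
    by (auto simp: integrable_on_def)
  then have "set_integrable lebesgue {0..} (\<lambda>t. exp (- t / 2 :: real))"
    by (intro nonnegative_absolutely_integrable_1) auto
  then show ?thesis by (rule set_integrable_mult_right)
qed

text \<open>By \<open>t \<le> 2 * exp (t / 2)\<close>, linear growth costs half of the discount rate
  and leaves an integrable majorant that tends to 0.\<close>

lemma affine_times_exp_le:
  fixes a b t :: real
  assumes "0 \<le> a" "0 \<le> b" "0 \<le> t"
  shows "exp (- t) * (a + b * t) \<le> (a + 2 * b) * exp (- t / 2)"
proof -
  have "1 \<le> exp (t / 2)" "t \<le> 2 * exp (t / 2)"
    using exp_ge_add_one_self[of "t / 2"] assms(3) by (simp, argo)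
  then have "a * 1 + b * t \<le> a * exp (t / 2) + b * (2 * exp (t / 2))"
    using assms by (intro add_mono mult_left_mono) auto
  then have "exp (- t) * (a + b * t) \<le> exp (- t) * (exp (t / 2) * (a + 2 * b))"
    by (intro mult_left_mono) (auto simp: algebra_simps)
  also have "\<dots> = (a + 2 * b) * exp (- t / 2)"
    by (simp flip: exp_add mult.assoc)
  finally show ?thesis .
qed

text \<open>One player's side of the game: \<open>v\<close> is the candidate value,
  \<open>\<alpha>\<close> the player's own feedback, \<open>\<beta>\<close> that of the opponent,
  \<open>J\<close> the jump set. \<open>M\<close> serves below as the bound for the open-loop
  controls as well. On \<open>J\<close> the Lipschitz estimate takes the place of the
  derivative.\<close>

locale player_verification =
  fixes v h \<alpha> \<beta> :: "real \<Rightarrow> real" and J :: "real set" and L C M :: real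
  assumes v_lipschitz: "\<And>x y. \<bar>v x - v y\<bar> \<le> L * \<bar>x - y\<bar>"
    and discrete_J: "discrete J"
    and v_deriv: "\<And>x. x \<notin> J \<Longrightarrow> (v has_real_derivative - \<alpha> x) (at x)"
    and v_eq: "\<And>x. v x = h x - \<alpha> x * \<beta> x - (\<alpha> x)\<^sup>2 / 2"
    and h_cont: "continuous_on UNIV h"
    and h_growth: "\<And>x. \<bar>h x\<bar> \<le> C * (1 + \<bar>x\<bar>)"
    and \<beta>_bounded: "\<And>x. \<bar>\<beta> x\<bar> \<le> M"
begin

context
  fixes a x :: "real \<Rightarrow> real" and y :: real
  assumes a_meas: "set_borel_measurable lebesgue {0..} a" and a_bounded: "\<And>t. 0 \<le> t \<Longrightarrow> \<bar>a t\<bar> \<le> M"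
    and sol: "caratheodory_solution (\<lambda>t z. a t + \<beta> z) y x"
begin

lemma L_M_C_nonneg: "0 \<le> L" "0 \<le> M" "0 \<le> C"
  using v_lipschitz[of 1 0] a_bounded[of 0] h_growth[of 0] by auto

lemma trajectory_lipschitz:
  assumes "0 \<le> s" "0 \<le> t"
  shows "\<bar>x t - x s\<bar> \<le> 2 * M * \<bar>t - s\<bar>"
proof -
  have *: "\<bar>x t - x s\<bar> \<le> 2 * M * (t - s)" if st: "0 \<le> s" "s \<le> t" for s t
  proof -
    have "abs_continuous_on {0..t} x" using sol by (simp add: caratheodory_solution_def)
    then have ac: "abs_continuous_on {s..t} x"
      by (rule abs_continuous_on_subset) (use st in auto)
    have "AE r in lebesgue. r \<in> {s<..<t} \<longrightarrow>
        (\<exists>d. (x has_vector_derivative d) (at r) \<and> norm (d - 0) \<le> 2 * M)"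
    proof -
      have "AE r in lebesgue. r > 0 \<longrightarrow> (x has_real_derivative a r + \<beta> (x r)) (at r)"
        using sol by (simp add: caratheodory_solution_def)
      then show ?thesis
      proof eventually_elim
        case (elim r)
        show ?case
        proof
          assume r: "r \<in> {s<..<t}"
          then have "\<bar>a r + \<beta> (x r)\<bar> \<le> 2 * M"
            using a_bounded[of r] \<beta>_bounded[of "x r"] st by auto
          then show "\<exists>d. (x has_vector_derivative d) (at r) \<and> norm (d - 0) \<le> 2 * M"
            using elim r st by (auto simp: has_real_derivative_iff_has_vector_derivative)
        qed
      qed
    qed
    from abs_continuous_on_derivative_bound[OF st(2) ac this] L_M_C_nonneg show ?thesis by simp
  qed
  show ?thesis using *[of s t] *[of t s] assms by (cases "s \<le> t") (auto simp: abs_minus_commute)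
qed

lemma trajectory_bound: "0 \<le> t \<Longrightarrow> \<bar>x t\<bar> \<le> \<bar>y\<bar> + 2 * M * t"
  using trajectory_lipschitz[of 0 t] sol by (auto simp: caratheodory_solution_def)

lemma value_bound: "0 \<le> t \<Longrightarrow> \<bar>v (x t)\<bar> \<le> \<bar>v y\<bar> + 2 * L * M * t"
proof -
  assume t: "0 \<le> t"
  have "\<bar>v (x t) - v (x 0)\<bar> \<le> L * \<bar>x t - x 0\<bar>" by (rule v_lipschitz)
  also have "\<dots> \<le> L * (2 * M * \<bar>t - 0\<bar>)"
    using trajectory_lipschitz[of 0 t] t L_M_C_nonneg by (intro mult_left_mono) auto
  finally show ?thesis using sol t by (auto simp: caratheodory_solution_def)
qed

definition running_cost :: "real \<Rightarrow> real" where
  "running_cost t = exp (- t) * (h (x t) + (a t)\<^sup>2 / 2)"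

text \<open>Almost everywhere the derivative of \<open>exp (- t) * v (x t)\<close>, after
  \<open>v_eq\<close> has been used to complete the square.\<close>

definition discounted_gap_rate :: "real \<Rightarrow> real" where
  "discounted_gap_rate t = exp (- t) * ((a t - \<alpha> (x t))\<^sup>2 / 2 - (h (x t) + (a t)\<^sup>2 / 2))"

lemma value_along_trajectory:
  assumes T: "0 \<le> T"
  shows "(discounted_gap_rate has_integral exp (- T) * v (x T) - v y) {0..T}"
proof -
  let ?f = "\<lambda>t. exp (- t) * v (x t)"
  define V where "V = \<bar>v y\<bar> + 2 * L * M * T"
  have fl: "\<bar>?f t - ?f s\<bar> \<le> (V + 2 * L * M) * \<bar>t - s\<bar>" if s: "s \<in> {0..T}" and t: "t \<in> {0..T}" for s t
  proof -
    have "?f t - ?f s = (exp (- t) - exp (- s)) * v (x t) + exp (- s) * (v (x t) - v (x s))"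
      by (simp add: algebra_simps)
    also have "\<bar>\<dots>\<bar> \<le> \<bar>exp (- t) - exp (- s)\<bar> * \<bar>v (x t)\<bar> + exp (- s) * \<bar>v (x t) - v (x s)\<bar>"
      by (rule order_trans[OF abs_triangle_ineq]) (simp add: abs_mult)
    also have "\<dots> \<le> \<bar>t - s\<bar> * V + 1 * (L * (2 * M * \<bar>t - s\<bar>))"
    proof (intro add_mono mult_mono)
      show "\<bar>exp (- t) - exp (- s)\<bar> \<le> \<bar>t - s\<bar>" using s t by (intro exp_minus_lipschitz) auto
      have "\<bar>v (x t)\<bar> \<le> \<bar>v y\<bar> + 2 * L * M * t" using t by (intro value_bound) auto
      also have "\<dots> \<le> V" unfolding V_def using t L_M_C_nonneg by (intro add_left_mono mult_left_mono) auto
      finally show "\<bar>v (x t)\<bar> \<le> V" .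
      have "L * \<bar>x t - x s\<bar> \<le> L * (2 * M * \<bar>t - s\<bar>)"
        using s t L_M_C_nonneg by (intro mult_left_mono trajectory_lipschitz) auto
      with v_lipschitz[of "x t" "x s"] show "\<bar>v (x t) - v (x s)\<bar> \<le> L * (2 * M * \<bar>t - s\<bar>)" by linarith
    qed (use s in auto)
    finally show ?thesis by (simp add: algebra_simps)
  qed
  have ac: "abs_continuous_on {0..T} ?f"
    by (rule lipschitz_on_imp_abs_continuous_on[where L = "V + 2 * L * M"]) (use fl in auto)
  obtain N where N: "N \<in> null_sets lebesgue"
    "\<And>t. t \<notin> N \<Longrightarrow> t > 0 \<Longrightarrow> (x has_real_derivative a t + \<beta> (x t)) (at t)"
  proof -
    have "AE t in lebesgue. t > 0 \<longrightarrow> (x has_real_derivative a t + \<beta> (x t)) (at t)"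
      using sol by (simp add: caratheodory_solution_def)
    from AE_E3[OF this] obtain N where "N \<in> null_sets lebesgue"
      "\<And>t. t \<in> space lebesgue - N \<Longrightarrow> t > 0 \<longrightarrow> (x has_real_derivative a t + \<beta> (x t)) (at t)" by blast
    then show thesis using that[of N] by simp
  qed
  \<comment> \<open>The times at which the chain rule may break down: a trajectory moving through a
    jump. They are countable, hence negligible.\<close>
  define E where "E = {t. x t \<in> J \<and> a t + \<beta> (x t) \<noteq> 0 \<and> (x has_real_derivative a t + \<beta> (x t)) (at t)}"
  have "countable E"
    unfolding E_def by (rule derivative_at_discrete_countable[OF discrete_J])
  then have neg: "negligible (N \<union> E \<union> {0, T})"
    using N(1) countable_imp_null_set_lborel[of E]
    by (intro negligible_Un) (auto simp: negligible_iff_null_sets intro: null_sets_completionI)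
  have der: "(?f has_vector_derivative discounted_gap_rate t) (at t within {0..T})"
    if t: "t \<in> {0..T} - (N \<union> E \<union> {0, T})" for t
  proof -
    have t0: "0 < t" using t by auto
    have dx: "(x has_real_derivative a t + \<beta> (x t)) (at t)" using N(2)[of t] t t0 by auto
    have dv: "((\<lambda>t. v (x t)) has_real_derivative - \<alpha> (x t) * (a t + \<beta> (x t))) (at t)"
    proof (cases "x t \<in> J")
      case False
      show ?thesis by (rule DERIV_chain2[OF v_deriv[OF False] dx])
    next
      case True
      \<comment> \<open>\<open>v\<close> may have no derivative at \<open>x t\<close>, but the
        trajectory has velocity 0, so the Lipschitz bound gives \<open>v\<close> along it the
        derivative 0. The formula says the same, whatever the value of
        \<open>\<alpha> (x t)\<close>.\<close>
      then have z: "a t + \<beta> (x t) = 0" using t dx by (auto simp: E_def)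
      have "((\<lambda>s. \<bar>(x s - x t) / (s - t)\<bar>) \<longlongrightarrow> 0) (at t)"
        using dx unfolding z has_field_derivative_iff by (rule tendsto_rabs_zero)
      from tendsto_mult_right_zero[OF this, of L]
      have "((\<lambda>s. (v (x s) - v (x t)) / (s - t)) \<longlongrightarrow> 0) (at t)"
      proof (rule Lim_null_comparison[rotated])
        show "eventually (\<lambda>s. norm ((v (x s) - v (x t)) / (s - t)) \<le> L * \<bar>(x s - x t) / (s - t)\<bar>) (at t)"
          using v_lipschitz by (intro always_eventually) (auto simp: abs_divide divide_right_mono)
      qed
      then show ?thesis unfolding z has_field_derivative_iff by simp
    qed
    have "(?f has_real_derivative exp (- t) * (- \<alpha> (x t) * (a t + \<beta> (x t))) - exp (- t) * v (x t)) (at t)"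
      by (auto intro!: derivative_eq_intros dv)
    moreover have "exp (- t) * (- \<alpha> (x t) * (a t + \<beta> (x t))) - exp (- t) * v (x t) = discounted_gap_rate t"
      unfolding discounted_gap_rate_def v_eq[of "x t"] by (simp add: power2_eq_square field_simps)
    ultimately have "(?f has_real_derivative discounted_gap_rate t) (at t)" by simp
    then show ?thesis
      by (simp add: has_real_derivative_iff_has_vector_derivative has_vector_derivative_at_within)
  qed
  have "(discounted_gap_rate has_integral ?f T - ?f 0) {0..T}"
    by (rule abs_continuous_on_FTC[OF T ac neg der])
  then show ?thesis using sol by (simp add: caratheodory_solution_def)
qed

lemma running_cost_integrable:
  "set_integrable lebesgue {0..} running_cost"
proof -
  let ?g = "\<lambda>t. exp (- t) * (h (x t) + (a t)\<^sup>2 / 2)"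
  define x' where "x' t = x (max 0 t)" for t
  have cont: "continuous_on UNIV x'"
  proof -
    have "continuous_on {0..} x"
    proof (rule lipschitz_on_continuous_on[of "2 * M"])
      show "(2 * M)-lipschitz_on {0..} x"
        using trajectory_lipschitz L_M_C_nonneg by (auto simp: lipschitz_on_def dist_real_def)
    qed
    then show ?thesis unfolding x'_def
      by (rule continuous_on_compose2) (auto intro!: continuous_intros)
  qed
  have "(\<lambda>t. exp (- t) * h (x' t)) \<in> borel_measurable borel" "(\<lambda>t::real. exp (- t)) \<in> borel_measurable borel"
    by (intro borel_measurable_continuous_onI continuous_intros continuous_on_compose2[OF h_cont cont]; simp)+
  then have m1: "(\<lambda>t. exp (- t) * h (x' t)) \<in> borel_measurable lebesgue" and m3: "(\<lambda>t::real. exp (- t)) \<in> borel_measurable lebesgue"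
    by (auto intro: measurable_completion)
  have m2: "(\<lambda>t. indicat_real {0..} t * a t) \<in> borel_measurable lebesgue"
    using a_meas by (simp add: set_borel_measurable_def)
  have m4: "(\<lambda>t::real. indicat_real {0..} t) \<in> borel_measurable lebesgue"
    by (intro borel_measurable_indicator sets_completionI_sets) simp
  have "(\<lambda>t. indicat_real {0..} t * (exp (- t) * h (x' t)) + exp (- t) * ((indicat_real {0..} t * a t)\<^sup>2 / 2)) \<in> borel_measurable lebesgue"
    using m1 m2 m3 m4 by measurable
  moreover have "indicat_real {0..} t * (exp (- t) * h (x' t)) + exp (- t) * ((indicat_real {0..} t * a t)\<^sup>2 / 2)
      = indicat_real {0..} t *\<^sub>R ?g t" for t
    by (auto simp: indicator_def x'_def max_def algebra_simps)
  ultimately have meas: "set_borel_measurable lebesgue {0..} ?g"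
    by (simp add: set_borel_measurable_def)
  define K0 K1 where "K0 = C * (1 + \<bar>y\<bar>) + M\<^sup>2 / 2" and "K1 = 2 * C * M"
  have K: "0 \<le> K0" "0 \<le> K1" using L_M_C_nonneg by (auto simp: K0_def K1_def)
  show ?thesis
    unfolding running_cost_def[abs_def]
  proof (rule set_integrable_bound[OF exp_half_integrable[of "K0 + 2 * K1"] meas], intro AE_I2 impI)
    fix t :: real assume t: "t \<in> {0..}"
    then have t0: "0 \<le> t" by simp
    have "C * (1 + \<bar>x t\<bar>) \<le> C * (1 + (\<bar>y\<bar> + 2 * M * t))"
      using trajectory_bound[OF t0] L_M_C_nonneg by (intro mult_left_mono) auto
    with h_growth[of "x t"] have "\<bar>h (x t)\<bar> \<le> C * (1 + (\<bar>y\<bar> + 2 * M * t))" by linarith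
    moreover have "(a t)\<^sup>2 \<le> M\<^sup>2" using a_bounded[OF t0] by (metis abs_le_square_iff abs_of_nonneg L_M_C_nonneg(2))
    moreover have "0 \<le> (a t)\<^sup>2" by simp
    ultimately have "\<bar>h (x t) + (a t)\<^sup>2 / 2\<bar> \<le> C * (1 + (\<bar>y\<bar> + 2 * M * t)) + M\<^sup>2 / 2" by linarith
    also have "\<dots> = K0 + K1 * t" by (simp add: K0_def K1_def algebra_simps)
    finally have "norm (?g t) \<le> exp (- t) * (K0 + K1 * t)" by (simp add: abs_mult)
    also have "\<dots> \<le> (K0 + 2 * K1) * exp (- t / 2)" by (rule affine_times_exp_le[OF K t0])
    also have "\<dots> \<le> norm ((K0 + 2 * K1) * exp (- t / 2))" by simp
    finally show "norm (?g t) \<le> norm ((K0 + 2 * K1) * exp (- t / 2))" .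
  qed
qed

lemma discounted_value_tendsto: "((\<lambda>T. exp (- T) * v (x T)) \<longlongrightarrow> 0) at_top"
proof (rule Lim_null_comparison)
  show "eventually (\<lambda>T. norm (exp (- T) * v (x T)) \<le> (\<bar>v y\<bar> + 2 * (2 * L * M)) * exp (- T / 2)) at_top"
    using eventually_ge_at_top[of 0]
  proof eventually_elim
    case (elim T)
    have "norm (exp (- T) * v (x T)) \<le> exp (- T) * (\<bar>v y\<bar> + 2 * L * M * T)"
      using value_bound[OF elim] by (simp add: abs_mult)
    also have "\<dots> \<le> (\<bar>v y\<bar> + 2 * (2 * L * M)) * exp (- T / 2)"
      using L_M_C_nonneg elim by (intro affine_times_exp_le) auto
    finally show ?case .
  qed
  have "filterlim (\<lambda>T::real. 1/2 * T) at_top at_top"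
    by (rule filterlim_tendsto_pos_mult_at_top[OF tendsto_const _ filterlim_ident]) simp
  then have "filterlim (\<lambda>T::real. - T / 2) at_bot at_top"
    by (simp add: filterlim_uminus_at_bot)
  from filterlim_compose[OF exp_at_bot this]
  have "((\<lambda>T. exp (- T / 2 :: real)) \<longlongrightarrow> 0) at_top" .
  from tendsto_mult_right_zero[OF this]
  show "((\<lambda>T. (\<bar>v y\<bar> + 2 * (2 * L * M)) * exp (- T / 2)) \<longlongrightarrow> 0) at_top" .
qed

text \<open>Adding the running cost back leaves the discounted square alone. Its sign gives
  optimality, and it vanishes when the control is the player's own feedback.\<close>

lemma finite_horizon_gap:
  assumes T: "0 \<le> T"
  shows "((\<lambda>t. exp (- t) * ((a t - \<alpha> (x t))\<^sup>2 / 2)) has_integral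
    exp (- T) * v (x T) - v y + (LINT t:{0..T}|lebesgue. running_cost t)) {0..T}"
proof -
  have "set_integrable lebesgue {0..T} running_cost"
    by (rule set_integrable_subset[OF running_cost_integrable]) auto
  then have "(running_cost has_integral (LINT t:{0..T}|lebesgue. running_cost t)) {0..T}"
    by (rule has_integral_set_lebesgue)
  from has_integral_add[OF value_along_trajectory[OF T] this]
  show ?thesis
    by (simp add: discounted_gap_rate_def running_cost_def algebra_simps)
qed

lemma finite_horizon_cost_tendsto:
  "((\<lambda>T. exp (- T) * v (x T) - v y + (LINT t:{0..T}|lebesgue. running_cost t))
     \<longlongrightarrow> 0 - v y + cost h a x) at_top"
  unfolding cost_def running_cost_def[symmetric]
  by (intro tendsto_add tendsto_diff tendsto_const discounted_value_tendsto
      tendsto_set_lebesgue_integral_at_top running_cost_integrable) auto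

lemma value_le_cost: "v y \<le> cost h a x"
proof -
  have "0 \<le> 0 - v y + cost h a x"
  proof (rule tendsto_lowerbound[OF finite_horizon_cost_tendsto])
    show "eventually (\<lambda>T. 0 \<le> exp (- T) * v (x T) - v y + (LINT t:{0..T}|lebesgue. running_cost t)) at_top"
      using eventually_ge_at_top[of 0]
    proof eventually_elim
      case (elim T)
      show ?case by (rule has_integral_nonneg[OF finite_horizon_gap[OF elim]]) auto
    qed
  qed auto
  then show ?thesis by simp
qed

lemma value_eq_cost:
  assumes fb: "\<And>t. 0 \<le> t \<Longrightarrow> a t = \<alpha> (x t)"
  shows "cost h a x = v y"
proof -
  have "eventually (\<lambda>T. exp (- T) * v (x T) - v y + (LINT t:{0..T}|lebesgue. running_cost t) = 0) at_top"
    using eventually_ge_at_top[of 0]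
  proof eventually_elim
    case (elim T)
    have "((\<lambda>t. 0) has_integral
      exp (- T) * v (x T) - v y + (LINT t:{0..T}|lebesgue. running_cost t)) {0..T}"
      by (rule has_integral_eq[OF _ finite_horizon_gap[OF elim]]) (simp add: fb)
    then show ?case by simp
  qed
  then have "((\<lambda>T. exp (- T) * v (x T) - v y + (LINT t:{0..T}|lebesgue. running_cost t)) \<longlongrightarrow> 0) at_top"
    by (rule tendsto_eventually)
  from tendsto_unique[OF _ finite_horizon_cost_tendsto this] show ?thesis by simp
qed

end

end

section \<open>Closed-loop trajectories\<close>

text \<open>On the maximal interval \<open>I\<close> to the right of \<open>y\<close> with
  \<open>V > 0\<close>, \<open>\<phi>\<close> is the travel time from \<open>y\<close>. The
  trajectory is its inverse, continued by the constant \<open>z = Sup I\<close> after the total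
  travel time if that is finite. At a jump \<open>VL \<le> 0 \<le> VR\<close>, so the velocities
  point away from it and no jump is entered at positive speed.\<close>

lemma discontinuous_flow_positive:
  fixes V VL VR :: "real \<Rightarrow> real"
  assumes limR: "\<And>x. (V \<longlongrightarrow> VR x) (at_right x)" and limL: "\<And>x. (V \<longlongrightarrow> VL x) (at_left x)"
    and V: "\<And>x. V x = VL x \<or> V x = VR x"
    and jmp: "\<And>x. VL x = VR x \<or> (VR x = - VL x \<and> VL x \<le> 0)"
    and bnd: "\<And>x. \<bar>V x\<bar> \<le> B"
    and pos: "V y > 0"
  shows "\<exists>x. caratheodory_solution (\<lambda>t z. V z) y x"
proof -
  define I where "I = {\<xi>. y \<le> \<xi> \<and> (\<forall>\<eta>. y < \<eta> \<and> \<eta> \<le> \<xi> \<longrightarrow> V \<eta> > 0)}"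
  define \<phi> where "\<phi> \<xi> = integral {y..\<xi>} (\<lambda>\<eta>. 1 / V \<eta>)" for \<xi>
  have yI: "y \<in> I" by (auto simp: I_def)
  have Iy: "y \<le> \<xi>" if "\<xi> \<in> I" for \<xi> using that by (simp add: I_def)
  have down: "\<xi>' \<in> I" if "\<xi> \<in> I" "y \<le> \<xi>'" "\<xi>' \<le> \<xi>" for \<xi> \<xi>' using that by (auto simp: I_def)
  have Vpos: "V \<xi> > 0" if "\<xi> \<in> I" for \<xi> using that pos by (cases "\<xi> = y") (auto simp: I_def)
  \<comment> \<open>A positive value at a genuine jump can only be the right limit, since the left
    limit is nonpositive there.\<close>
  have VR: "VR \<xi> = V \<xi>" if "\<xi> \<in> I" for \<xi>
  proof (rule ccontr)
    assume ne: "VR \<xi> \<noteq> V \<xi>"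
    then have "V \<xi> = VL \<xi>" "VL \<xi> \<noteq> VR \<xi>" using V[of \<xi>] by auto
    then have "VL \<xi> \<le> 0" using jmp[of \<xi>] by auto
    with Vpos[OF that] \<open>V \<xi> = VL \<xi>\<close> show False by simp
  qed
  have VL: "VL \<xi> = V \<xi>" if "\<xi> \<in> I" "y < \<xi>" for \<xi>
  proof -
    have "eventually (\<lambda>\<eta>. y < \<eta> \<and> \<eta> < \<xi>) (at_left \<xi>)"
      unfolding eventually_at_left_field using that(2) by (intro exI[of _ y]) auto
    then have "eventually (\<lambda>\<eta>. 0 \<le> V \<eta>) (at_left \<xi>)"
      by eventually_elim (use that(1) in \<open>auto simp: I_def intro!: less_imp_le\<close>)
    then have "0 \<le> VL \<xi>" by (rule tendsto_lowerbound[OF limL]) simp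
    then show ?thesis using jmp[of \<xi>] VR[OF that(1)] by auto
  qed
  have cont: "isCont V \<xi>" if "\<xi> \<in> I" "y < \<xi>" for \<xi>
    using limL[of \<xi>] limR[of \<xi>] unfolding VL[OF that] VR[OF that(1)] isCont_def
    by (simp add: filterlim_split_at)
  have open_right: "\<exists>\<delta>>0. \<xi> + \<delta> \<in> I" if "\<xi> \<in> I" for \<xi>
  proof -
    have "eventually (\<lambda>\<eta>. V \<eta> > 0) (at_right \<xi>)"
      using limR[of \<xi>] Vpos[OF that] unfolding VR[OF that] by (simp add: order_tendstoD)
    then obtain b where b: "b > \<xi>" "\<And>\<eta>. \<xi> < \<eta> \<Longrightarrow> \<eta> < b \<Longrightarrow> V \<eta> > 0"
      unfolding eventually_at_right_field by auto
    have "V \<eta> > 0" if "y < \<eta>" "\<eta> \<le> \<xi> + (b - \<xi>) / 2" for \<eta>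
    proof (cases "\<eta> \<le> \<xi>")
      case True
      then show ?thesis using \<open>\<xi> \<in> I\<close> that by (auto simp: I_def)
    next
      case False
      moreover have "\<xi> + (b - \<xi>) / 2 < b" using b(1) by argo
      ultimately show ?thesis using b(2)[of \<eta>] that by simp
    qed
    moreover have "y \<le> \<xi> + (b - \<xi>) / 2" using Iy[OF that] b(1) by argo
    ultimately have "\<xi> + (b - \<xi>) / 2 \<in> I" by (auto simp: I_def)
    then show ?thesis using b(1) by (intro exI[of _ "(b - \<xi>) / 2"]) auto
  qed
  have contV: "continuous_on {y..\<xi>} (\<lambda>\<eta>. 1 / V \<eta>)" if "\<xi> \<in> I" for \<xi>
  proof -
    have "continuous_on {y..\<xi>} V"
      unfolding continuous_on_eq_continuous_within
    proof
      fix \<eta> assume \<eta>: "\<eta> \<in> {y..\<xi>}"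
      then have \<eta>I: "\<eta> \<in> I" using down[OF that] by auto
      show "continuous (at \<eta> within {y..\<xi>}) V"
      proof (cases "y < \<eta>")
        case True
        then show ?thesis using cont[OF \<eta>I] continuous_at_imp_continuous_at_within by blast
      next
        case False
        then have "\<eta> = y" using \<eta> by auto
        then have "(V \<longlongrightarrow> V \<eta>) (at \<eta> within {\<eta>..})"
          using limR[of y] VR[OF yI] by (simp add: at_within_Ici_at_right)
        then show ?thesis unfolding continuous_within
          by (rule tendsto_within_subset) (use \<open>\<eta> = y\<close> in auto)
      qed
    qed
    moreover have "V \<eta> \<noteq> 0" if "\<eta> \<in> {y..\<xi>}" for \<eta>
      using Vpos[OF down[OF \<open>\<xi> \<in> I\<close>]] that by force
    ultimately show ?thesis by (intro continuous_intros) auto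
  qed
  have B: "B > 0" using bnd[of y] pos by linarith
  have \<phi>y: "\<phi> y = 0" by (simp add: \<phi>_def)
  have \<phi>_inc: "(\<xi>2 - \<xi>1) / B \<le> \<phi> \<xi>2 - \<phi> \<xi>1" if "\<xi>2 \<in> I" "y \<le> \<xi>1" "\<xi>1 \<le> \<xi>2" for \<xi>1 \<xi>2
  proof -
    have int: "(\<lambda>\<eta>. 1 / V \<eta>) integrable_on {y..\<xi>2}"
      by (rule integrable_continuous_real[OF contV[OF that(1)]])
    have "\<phi> \<xi>1 + integral {\<xi>1..\<xi>2} (\<lambda>\<eta>. 1 / V \<eta>) = \<phi> \<xi>2"
      unfolding \<phi>_def by (rule Henstock_Kurzweil_Integration.integral_combine[OF that(2,3) int])
    moreover have "integral {\<xi>1..\<xi>2} (\<lambda>\<eta>. 1 / B) \<le> integral {\<xi>1..\<xi>2} (\<lambda>\<eta>. 1 / V \<eta>)"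
    proof (rule integral_le)
      show "(\<lambda>\<eta>. 1 / V \<eta>) integrable_on {\<xi>1..\<xi>2}"
        by (rule integrable_subinterval_real[OF int]) (use that in auto)
      fix \<eta> assume "\<eta> \<in> {\<xi>1..\<xi>2}"
      then have "V \<eta> > 0" using Vpos[OF down[OF that(1), of \<eta>]] that by auto
      then show "1 / B \<le> 1 / V \<eta>" using bnd[of \<eta>] by (intro divide_left_mono) auto
    qed auto
    ultimately show ?thesis using that by simp
  qed
  have \<phi>_mono: "\<phi> \<xi>1 < \<phi> \<xi>2" if "\<xi>2 \<in> I" "y \<le> \<xi>1" "\<xi>1 < \<xi>2" for \<xi>1 \<xi>2
  proof -
    have "0 < (\<xi>2 - \<xi>1) / B" using that B by simp
    then show ?thesis using \<phi>_inc[of \<xi>2 \<xi>1] that by linarith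
  qed
  have \<phi>_cont: "continuous_on {y..\<xi>} \<phi>" if "\<xi> \<in> I" for \<xi>
    unfolding \<phi>_def by (rule indefinite_integral_continuous_1[OF integrable_continuous_real[OF contV[OF that]]])
  have surj: "s \<in> \<phi> ` I" if t: "t \<in> \<phi> ` I" and s: "0 \<le> s" "s \<le> t" for s t
  proof -
    obtain \<xi> where \<xi>: "\<xi> \<in> I" "t = \<phi> \<xi>" using t by auto
    obtain \<eta> where "y \<le> \<eta>" "\<eta> \<le> \<xi>" "\<phi> \<eta> = s"
      using IVT'[of \<phi> y s \<xi>] \<phi>y s \<xi> Iy[OF \<xi>(1)] \<phi>_cont[OF \<xi>(1)] by auto
    then show ?thesis using down[OF \<xi>(1)] by blast
  qed
  have inj: "inj_on \<phi> I"
    by (rule linorder_inj_onI) (use \<phi>_mono Iy in force)+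
  define z where "z = Sup I"
  define x where "x t = (if t \<in> \<phi> ` I then inv_into I \<phi> t else z)" for t
  have xin: "x t \<in> I" "\<phi> (x t) = t" if "t \<in> \<phi> ` I" for t
    using that inv_into_into[OF that] f_inv_into_f[OF that] by (auto simp: x_def)
  have xout: "x t = z" if "t \<notin> \<phi> ` I" for t using that by (simp add: x_def)
  have below: "\<phi> \<xi> < t" if "t \<notin> \<phi> ` I" "0 \<le> t" "\<xi> \<in> I" for \<xi> t
    using surj[of "\<phi> \<xi>" t] that by force
  \<comment> \<open>A time beyond all travel times bounds \<open>I\<close>. Since \<open>z\<close>
    lies outside \<open>I\<close>, \<open>V z \<le> 0\<close>, while the left limit at
    \<open>z\<close> is nonnegative; the jump condition then leaves \<open>V z = 0\<close>, so
    resting at \<open>z\<close> is a solution.\<close>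
  have z_facts: "bdd_above I" "V z = 0" if t: "t \<notin> \<phi> ` I" "0 \<le> t" for t
  proof -
    show bdd: "bdd_above I"
    proof (rule bdd_aboveI)
      fix \<xi> assume \<xi>: "\<xi> \<in> I"
      have "(\<xi> - y) / B \<le> t" using \<phi>_inc[OF \<xi> order_refl Iy[OF \<xi>]] below[OF t \<xi>] \<phi>y by simp
      then show "\<xi> \<le> y + B * t" using B by (simp add: field_simps)
    qed
    have up: "\<xi> \<le> z" if "\<xi> \<in> I" for \<xi> unfolding z_def by (rule cSup_upper[OF that bdd])
    have zI: "z \<notin> I"
    proof
      assume "z \<in> I"
      from open_right[OF this] up show False by force
    qed
    have yz: "y < z" using up[OF yI] zI yI by (cases "y = z") auto
    have Vb: "V \<eta> > 0" if \<eta>: "y < \<eta>" "\<eta> < z" for \<eta>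
    proof -
      obtain \<xi> where "\<xi> \<in> I" "\<eta> < \<xi>" using \<eta>(2) less_cSup_iff[of I \<eta>] yI bdd unfolding z_def by blast
      then show ?thesis using \<eta>(1) by (auto simp: I_def)
    qed
    have "V z \<le> 0"
    proof (rule ccontr)
      assume "\<not> V z \<le> 0"
      then have "z \<in> I" unfolding I_def using Vb yz by (auto simp: le_less)
      then show False using zI by simp
    qed
    moreover have "0 \<le> VL z"
    proof (rule tendsto_lowerbound[OF limL])
      show "eventually (\<lambda>\<eta>. 0 \<le> V \<eta>) (at_left z)"
        unfolding eventually_at_left_field using yz Vb by (intro exI[of _ y]) (auto intro: less_imp_le)
    qed simp
    ultimately show "V z = 0" using jmp[of z] V[of z] by auto
  qed
  have lip1: "0 \<le> x t - x s \<and> x t - x s \<le> B * (t - s)" if st: "0 \<le> s" "s \<le> t" for s t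
  proof (cases "t \<in> \<phi> ` I")
    case True
    then have s: "s \<in> \<phi> ` I" using surj st by blast
    have le: "x s \<le> x t"
    proof (rule ccontr)
      assume "\<not> x s \<le> x t"
      then have "\<phi> (x t) < \<phi> (x s)" using \<phi>_mono[of "x s" "x t"] xin[OF s] xin[OF True] Iy by auto
      then show False using xin[OF s] xin[OF True] st by simp
    qed
    have "(x t - x s) / B \<le> t - s"
      using \<phi>_inc[OF xin(1)[OF True] _ le] Iy[OF xin(1)[OF s]] xin(2)[OF s] xin(2)[OF True] by simp
    then show ?thesis using le B by (simp add: field_simps)
  next
    case False
    have t0: "0 \<le> t" using st by simp
    note zf = z_facts[OF False t0]
    show ?thesis
    proof (cases "s \<in> \<phi> ` I")
      case True
      note xs = xin[OF True]
      have "x s \<le> z" unfolding z_def by (rule cSup_upper[OF xs(1) zf(1)])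
      moreover have "z \<le> x s + B * (t - s)"
        unfolding z_def
      proof (rule cSup_least)
        show "I \<noteq> {}" using yI by blast
        fix \<xi> assume \<xi>: "\<xi> \<in> I"
        show "\<xi> \<le> x s + B * (t - s)"
        proof (cases "x s \<le> \<xi>")
          case True
          have "(\<xi> - x s) / B \<le> t - s"
            using \<phi>_inc[OF \<xi> Iy[OF xs(1)] True] below[OF False t0 \<xi>] xs(2) by simp
          then show ?thesis using B by (simp add: field_simps)
        next
          case False
          moreover have "0 \<le> B * (t - s)" using B st by simp
          ultimately show ?thesis by linarith
        qed
      qed
      ultimately show ?thesis by (simp add: xout[OF False])
    next
      case s: False
      show ?thesis using B st by (simp add: xout[OF False] xout[OF s])
    qed
  qed
  have lip: "\<bar>x t - x s\<bar> \<le> B * \<bar>t - s\<bar>" if "0 \<le> s" "0 \<le> t" for s t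
    using lip1[of s t] lip1[of t s] that by (cases "s \<le> t") auto
  have contx: "isCont x t" if t: "0 < t" for t
  proof -
    have "B-lipschitz_on {0<..} x" using lip B by (auto simp: lipschitz_on_def dist_real_def)
    then have "continuous_on {0<..} x" by (rule lipschitz_on_continuous_on)
    then show ?thesis using t by (simp add: continuous_on_eq_continuous_at)
  qed
  have d_in: "(x has_real_derivative V (x t)) (at t)" if t: "t \<in> \<phi> ` I" "0 < t" for t
  proof -
    note xt = xin[OF t(1)]
    obtain \<delta> where \<delta>: "\<delta> > 0" "x t + \<delta> \<in> I" using open_right[OF xt(1)] by blast
    have yx: "y < x t" using Iy[OF xt(1)] xt(2) \<phi>y t(2) by (cases "y = x t") auto
    have "((\<lambda>\<xi>. integral {y..\<xi>} (\<lambda>\<eta>. 1 / V \<eta>)) has_real_derivative 1 / V (x t)) (at (x t) within {y..x t + \<delta>})"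
      by (rule integral_has_real_derivative[OF contV[OF \<delta>(2)]]) (use yx \<delta> in auto)
    moreover have "at (x t) within {y..x t + \<delta>} = at (x t)"
      by (rule at_within_interior) (use yx \<delta> in auto)
    ultimately have d\<phi>: "(\<phi> has_real_derivative 1 / V (x t)) (at (x t))"
      by (simp add: \<phi>_def[abs_def])
    have t_less: "t < \<phi> (x t + \<delta>)"
      using \<phi>_mono[OF \<delta>(2) Iy[OF xt(1)]] xt(2) \<delta>(1) by simp
    have "(x has_real_derivative inverse (1 / V (x t))) (at t)"
    proof (rule DERIV_inverse_function[where f = \<phi> and g = x and x = t, OF d\<phi> _ t(2) t_less])
      fix s assume s: "0 < s" "s < \<phi> (x t + \<delta>)"
      show "\<phi> (x s) = s" by (rule xin(2)) (use surj[of "\<phi> (x t + \<delta>)" s] \<delta>(2) s in auto)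
    qed (use Vpos[OF xt(1)] t contx in auto)
    then show ?thesis by simp
  qed
  have d_out: "(x has_real_derivative V (x t)) (at t)" if t: "s \<notin> \<phi> ` I" "0 \<le> s" "s < t" for s t
  proof -
    have out: "r \<notin> \<phi> ` I" if "s \<le> r" for r using surj[of r s] t that by auto
    have "(x has_real_derivative 0) (at t)"
    proof (rule has_field_derivative_transform_within_open[where f = "\<lambda>_. z" and S = "{s<..}"])
      fix r assume "r \<in> {s<..}"
      then show "z = x r" using xout[OF out[of r]] by simp
    qed (use t in auto)
    moreover have "V (x t) = 0" using xout[OF out[of t]] z_facts(2)[OF t(1,2)] t by simp
    ultimately show ?thesis by simp
  qed
  \<comment> \<open>The arrival time at \<open>z\<close>, the only positive time that
    \<open>d_in\<close> and \<open>d_out\<close> do not cover; there is at most one.\<close>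
  define E where "E = {t. 0 < t \<and> t \<notin> \<phi> ` I \<and> (\<forall>s. 0 \<le> s \<and> s < t \<longrightarrow> s \<in> \<phi> ` I)}"
  have single: "t1 = t2" if "t1 \<in> E" "t2 \<in> E" for t1 t2
    using that by (cases t1 t2 rule: linorder_cases) (auto simp: E_def)
  have "E \<in> null_sets lebesgue"
  proof (cases "E = {}")
    case False
    then obtain t where "t \<in> E" by blast
    then have "E = {t}" using single by blast
    then show ?thesis by (simp flip: negligible_iff_null_sets)
  qed simp
  then have "AE t in lebesgue. t \<notin> E" by (rule AE_not_in)
  then have AE: "AE t in lebesgue. t > 0 \<longrightarrow> (x has_real_derivative V (x t)) (at t)"
  proof eventually_elim
    case (elim t)
    show ?case
    proof
      assume t: "t > 0"
      show "(x has_real_derivative V (x t)) (at t)"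
      proof (cases "t \<in> \<phi> ` I")
        case True
        then show ?thesis using d_in t by blast
      next
        case False
        then obtain s where "0 \<le> s" "s < t" "s \<notin> \<phi> ` I" using elim t by (auto simp: E_def)
        then show ?thesis using d_out by blast
      qed
    qed
  qed
  have "0 \<in> \<phi> ` I" using yI \<phi>y by force
  from xin[OF this] have "\<phi> (x 0) = \<phi> y" "x 0 \<in> I" using \<phi>y by auto
  then have x0: "x 0 = y" using inj yI by (auto dest: inj_onD)
  have "abs_continuous_on {0..T} x" for T
    by (rule lipschitz_on_imp_abs_continuous_on[where L = B]) (use lip in \<open>auto simp: abs_minus_commute\<close>)
  then show ?thesis using x0 AE unfolding caratheodory_solution_def by blast
qed

lemma caratheodory_solution_mirror:
  assumes "caratheodory_solution (\<lambda>t z. - V (- z)) (- y) x"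
  shows "caratheodory_solution (\<lambda>t z. V z) y (\<lambda>t. - x t)"
  unfolding caratheodory_solution_def
proof (intro conjI allI)
  show "- x 0 = y" using assms by (simp add: caratheodory_solution_def)
  have "abs_continuous_on {0..T} x" for T using assms by (simp add: caratheodory_solution_def)
  moreover have "norm (- a - - b) = norm (a - b)" for a b :: real by simp
  ultimately show "abs_continuous_on {0..T} (\<lambda>t. - x t)" for T
    unfolding abs_continuous_on_def by simp
  have "AE t in lebesgue. t > 0 \<longrightarrow> (x has_real_derivative - V (- x t)) (at t)"
    using assms by (simp add: caratheodory_solution_def)
  then show "AE t in lebesgue. t > 0 \<longrightarrow> ((\<lambda>t. - x t) has_real_derivative V (- x t)) (at t)"
    by eventually_elim (auto dest: DERIV_minus)
qed

text \<open>The sign of \<open>V y\<close> decides the direction once and for all. Reflection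
  replaces \<open>VL\<close> by \<open>- VR\<close>, which at a jump is again \<open>VL\<close> and
  hence nonpositive, so the jump condition survives.\<close>

theorem discontinuous_flow_exists:
  fixes V VL VR :: "real \<Rightarrow> real"
  assumes limR: "\<And>x. (V \<longlongrightarrow> VR x) (at_right x)" and limL: "\<And>x. (V \<longlongrightarrow> VL x) (at_left x)"
    and V: "\<And>x. V x = VL x \<or> V x = VR x"
    and jmp: "\<And>x. VL x = VR x \<or> (VR x = - VL x \<and> VL x \<le> 0)"
    and bnd: "\<And>x. \<bar>V x\<bar> \<le> B"
  shows "\<exists>x. caratheodory_solution (\<lambda>t z. V z) y x"
proof -
  consider "V y > 0" | "V y = 0" | "V y < 0" by linarith
  then show ?thesis
  proof cases
    case 1
    then show ?thesis using discontinuous_flow_positive[OF limR limL V jmp bnd] by blast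
  next
    case 2
    then have "caratheodory_solution (\<lambda>t z. V z) y (\<lambda>_. y)"
      unfolding caratheodory_solution_def
      by (auto intro!: lipschitz_on_imp_abs_continuous_on[where L = 0])
    then show ?thesis by blast
  next
    case 3
    have "\<exists>x. caratheodory_solution (\<lambda>t z. - V (- z)) (- y) x"
    proof (rule discontinuous_flow_positive[where VL = "\<lambda>x. - VR (- x)" and VR = "\<lambda>x. - VL (- x)" and B = B])
      fix x
      show "- VR (- x) = - VL (- x) \<or> - VL (- x) = - (- VR (- x)) \<and> - VR (- x) \<le> 0"
        using jmp[of "- x"] by auto
      show "- V (- x) = - VR (- x) \<or> - V (- x) = - VL (- x)" using V[of "- x"] by auto
    qed (use 3 bnd in \<open>auto intro!: tendsto_mirror limL limR\<close>)
    then show ?thesis using caratheodory_solution_mirror by blast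
  qed
qed

section \<open>Nash equilibria\<close>

lemma tendsto_selection:
  fixes k f g :: "real \<Rightarrow> real"
  assumes "(f \<longlongrightarrow> l) F" "(g \<longlongrightarrow> l) F" "\<And>y. k y = f y \<or> k y = g y"
  shows "(k \<longlongrightarrow> l) F"
proof (rule tendstoI)
  fix e :: real assume "0 < e"
  with assms(1,2) have "eventually (\<lambda>y. dist (f y) l < e) F" "eventually (\<lambda>y. dist (g y) l < e) F"
    by (auto dest: tendstoD)
  then show "eventually (\<lambda>y. dist (k y) l < e) F"
    by eventually_elim (metis assms(3))
qed

context game_solution
begin

context
  fixes \<alpha>1 \<alpha>2 :: "real \<Rightarrow> real" and B C :: real
  assumes feedback: "\<And>x. (\<alpha>1 x = - l1 x \<and> \<alpha>2 x = - l2 x) \<or> (\<alpha>1 x = - r1 x \<and> \<alpha>2 x = - r2 x)"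
    and bound: "\<And>x. \<bar>r1 x\<bar> \<le> B" "\<And>x. \<bar>r2 x\<bar> \<le> B"
    and h1: "continuous_on UNIV h1" "\<And>x. \<bar>h1 x\<bar> \<le> C * (1 + \<bar>x\<bar>)"
begin

lemma feedback_bounded: "\<bar>\<alpha>1 x\<bar> \<le> B" "\<bar>\<alpha>2 x\<bar> \<le> B"
  using feedback[of x] jump[of x] bound[of x] by auto

lemma feedback_lim_right: "(\<alpha>1 \<longlongrightarrow> - r1 x) (at_right x)" "(\<alpha>2 \<longlongrightarrow> - r2 x) (at_right x)"
  by (rule tendsto_selection[OF tendsto_minus[OF right_lim_left1] tendsto_minus[OF right_lim_right1]];
      use feedback in blast)
     (rule tendsto_selection[OF tendsto_minus[OF right_lim_left2] tendsto_minus[OF right_lim_right2]];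
      use feedback in blast)

lemma feedback_lim_left: "(\<alpha>1 \<longlongrightarrow> - l1 x) (at_left x)" "(\<alpha>2 \<longlongrightarrow> - l2 x) (at_left x)"
  by (rule tendsto_selection[OF tendsto_minus[OF left_lim_left1] tendsto_minus[OF left_lim_right1]];
      use feedback in blast)
     (rule tendsto_selection[OF tendsto_minus[OF left_lim_left2] tendsto_minus[OF left_lim_right2]];
      use feedback in blast)

text \<open>Off the jump set the two branches agree and \<open>\<alpha>1\<close> is continuous; the
  jump set is discrete, hence countable.\<close>

lemma feedback_borel: "\<alpha>1 \<in> borel_measurable borel"
proof (rule borel_measurable_continuous_countable_exceptions)
  let ?J = "{x. (l1 x, l2 x) \<noteq> (r1 x, r2 x)}"
  show "countable ?J" by (rule discrete_imp_countable[OF discrete_jumps])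
  have "isCont \<alpha>1 x" if "x \<in> - ?J" for x
  proof -
    have eq: "l1 x = r1 x" using that by simp
    then have "\<alpha>1 x = - r1 x" using feedback[of x] by auto
    then show ?thesis
      using feedback_lim_left(1)[of x] feedback_lim_right(1)[of x] eq
      unfolding isCont_def by (simp add: filterlim_split_at)
  qed
  then show "continuous_on (- ?J) \<alpha>1"
    by (simp add: continuous_at_imp_continuous_on)
qed

lemma closed_loop_exists: "\<exists>x. caratheodory_solution (\<lambda>t z. \<alpha>1 z + \<alpha>2 z) y x"
proof (rule discontinuous_flow_exists[where VL = "\<lambda>x. - l1 x + - l2 x" and VR = "\<lambda>x. - r1 x + - r2 x" and B = "2 * B"])
  fix x
  show "((\<lambda>z. \<alpha>1 z + \<alpha>2 z) \<longlongrightarrow> - r1 x + - r2 x) (at_right x)"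
    by (intro tendsto_add feedback_lim_right)
  show "((\<lambda>z. \<alpha>1 z + \<alpha>2 z) \<longlongrightarrow> - l1 x + - l2 x) (at_left x)"
    by (intro tendsto_add feedback_lim_left)
  show "\<alpha>1 x + \<alpha>2 x = - l1 x + - l2 x \<or> \<alpha>1 x + \<alpha>2 x = - r1 x + - r2 x"
    using feedback[of x] by auto
  show "- l1 x + - l2 x = - r1 x + - r2 x \<or> - r1 x + - r2 x = - (- l1 x + - l2 x) \<and> - l1 x + - l2 x \<le> 0"
    using jump[of x] by auto
  show "\<bar>\<alpha>1 x + \<alpha>2 x\<bar> \<le> 2 * B"
    using feedback_bounded[of x] by linarith
qed

lemma u1_lipschitz: "\<bar>u1 x - u1 y\<bar> \<le> (B + 1) * \<bar>x - y\<bar>"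
proof -
  have *: "\<bar>u1 b - u1 a\<bar> \<le> (B + 1) * (b - a)" if "a \<le> b" for a b
  proof (rule right_derivative_bound[OF that])
    show "continuous_on {a..b} u1" by (auto intro!: continuous_at_imp_continuous_on continuous_u)
    show "(u1 has_real_derivative r1 x) (at x within {x..})" for x by (rule right_deriv1)
    show "\<bar>r1 x\<bar> < B + 1" for x using bound(1)[of x] by linarith
  qed
  show ?thesis using *[of x y] *[of y x] by (cases "x \<le> y") (auto simp: abs_minus_commute)
qed

lemma player_verification:
  assumes "B \<le> M"
  shows "player_verification u1 h1 \<alpha>1 \<alpha>2 {x. (l1 x, l2 x) \<noteq> (r1 x, r2 x)} (B + 1) C M"
proof
  show "\<bar>u1 x - u1 y\<bar> \<le> (B + 1) * \<bar>x - y\<bar>" for x y by (rule u1_lipschitz)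
  show "discrete {x. (l1 x, l2 x) \<noteq> (r1 x, r2 x)}" by (rule discrete_jumps)
  show "(u1 has_real_derivative - \<alpha>1 x) (at x)" if "x \<notin> {x. (l1 x, l2 x) \<noteq> (r1 x, r2 x)}" for x
    using derivative[of x] that feedback[of x] by auto
  show "u1 x = h1 x - \<alpha>1 x * \<alpha>2 x - (\<alpha>1 x)\<^sup>2 / 2" for x
    using feedback[of x] left_eq1[of x] right_eq1[of x] by auto
  show "\<bar>\<alpha>2 x\<bar> \<le> M" for x using feedback_bounded(2)[of x] assms by linarith
qed (rule h1)+

lemma closed_loop_optimal:
  assumes U: "compact U" "range \<alpha>1 \<subseteq> U" and sol: "caratheodory_solution (\<lambda>t z. \<alpha>1 z + \<alpha>2 z) y x"
  shows "is_minimum (cost h1 (\<lambda>t. \<alpha>1 (x t)) x) (attainable_costs h1 U \<alpha>2 y)"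
proof -
  obtain M0 where M0: "\<And>a. a \<in> U \<Longrightarrow> \<bar>a\<bar> \<le> M0"
    using compact_imp_bounded[OF U(1)] by (auto simp: bounded_iff)
  \<comment> \<open>A common bound for the controls in \<open>U\<close> and for the opponent's
    feedback, about which \<open>U\<close> says nothing.\<close>
  define M where "M = max M0 B"
  interpret pv: player_verification u1 h1 \<alpha>1 \<alpha>2 "{x. (l1 x, l2 x) \<noteq> (r1 x, r2 x)}" "B + 1" C M
    by (rule player_verification) (simp add: M_def)
  have UM: "\<bar>a\<bar> \<le> M" if "a \<in> U" for a using M0[OF that] by (simp add: M_def)
  have ac: "\<And>T. abs_continuous_on {0..T} x" using sol by (simp add: caratheodory_solution_def)
  have "continuous_on {0..} x"
    unfolding continuous_on_eq_continuous_within
  proof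
    fix t :: real assume t: "t \<in> {0..}"
    have "continuous (at t within {0..t+1}) x"
      using abs_continuous_on_imp_continuous_on[OF ac[of "t+1"]] t
      by (auto simp: continuous_on_eq_continuous_within)
    moreover have "at t within {0..t+1} = at t within {0..}"
      by (rule at_within_nhd[of t "{..<t+1}"]) auto
    ultimately show "continuous (at t within {0..}) x" by (simp add: continuous_within)
  qed
  then have "continuous_on UNIV (\<lambda>t. x (max 0 t))"
    by (rule continuous_on_compose2) (auto intro!: continuous_intros)
  then have "(\<lambda>t. \<alpha>1 (x (max 0 t))) \<in> borel_measurable borel"
    by (intro measurable_compose[OF borel_measurable_continuous_onI feedback_borel])
  then have "(\<lambda>t. indicator {0..} t *\<^sub>R \<alpha>1 (x (max 0 t))) \<in> borel_measurable borel"
    by (intro borel_measurable_scaleR borel_measurable_indicator) auto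
  then have "(\<lambda>t. indicator {0..} t *\<^sub>R \<alpha>1 (x (max 0 t))) \<in> borel_measurable lebesgue"
    by (auto intro: measurable_completion)
  moreover have "(\<lambda>t. indicat_real {0..} t *\<^sub>R \<alpha>1 (x (max 0 t))) = (\<lambda>t. indicat_real {0..} t *\<^sub>R \<alpha>1 (x t))"
    by (auto simp: fun_eq_iff indicator_def max_def)
  ultimately have meas: "set_borel_measurable lebesgue {0..} (\<lambda>t. \<alpha>1 (x t))"
    by (simp only: set_borel_measurable_def)
  have ctl: "control U (\<lambda>t. \<alpha>1 (x t))" using meas U(2) by (auto simp: control_def)
  \<comment> \<open>The closed-loop trajectory is also one for the open-loop control
    \<open>\<alpha>1 (x t)\<close> against \<open>\<alpha>2\<close>, which makes its cost
    attainable.\<close>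
  have sol': "caratheodory_solution (\<lambda>t z. \<alpha>1 (x t) + \<alpha>2 z) y x"
    using sol by (simp add: caratheodory_solution_def)
  have eq: "cost h1 (\<lambda>t. \<alpha>1 (x t)) x = u1 y"
    by (rule pv.value_eq_cost[OF meas _ sol']) (use UM U(2) in auto)
  show ?thesis
    unfolding is_minimum_def
  proof (intro conjI ballI)
    show "cost h1 (\<lambda>t. \<alpha>1 (x t)) x \<in> attainable_costs h1 U \<alpha>2 y"
      using ctl sol' by (auto simp: attainable_costs_def)
    fix c assume "c \<in> attainable_costs h1 U \<alpha>2 y"
    then obtain a x' where c: "c = cost h1 a x'" "control U a" "caratheodory_solution (\<lambda>t z. a t + \<alpha>2 z) y x'"
      by (auto simp: attainable_costs_def)
    have "u1 y \<le> cost h1 a x'"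
      by (rule pv.value_le_cost[OF _ _ c(3)]) (use c(2) UM in \<open>auto simp: control_def\<close>)
    then show "cost h1 (\<lambda>t. \<alpha>1 (x t)) x \<le> c" unfolding eq c(1) .
  qed
qed

end

text \<open>The claim for the second player is the one for the first applied to the solution with
  exchanged components.\<close>

theorem nash:
  assumes feedback: "\<And>x. (\<alpha>1 x = - l1 x \<and> \<alpha>2 x = - l2 x) \<or> (\<alpha>1 x = - r1 x \<and> \<alpha>2 x = - r2 x)"
    and bound: "\<And>x. \<bar>r1 x\<bar> \<le> B" "\<And>x. \<bar>r2 x\<bar> \<le> B"
    and h: "continuous_on UNIV h1" "\<And>x. \<bar>h1 x\<bar> \<le> C * (1 + \<bar>x\<bar>)"
      "continuous_on UNIV h2" "\<And>x. \<bar>h2 x\<bar> \<le> C * (1 + \<bar>x\<bar>)"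
    and U: "compact U1" "range \<alpha>1 \<subseteq> U1" "compact U2" "range \<alpha>2 \<subseteq> U2"
  shows "nash_feedback h1 h2 U1 U2 \<alpha>1 \<alpha>2"
proof -
  interpret s: game_solution h2 h1 u2 u1 l2 l1 r2 r1 by (rule swap)
  have fb: "(\<alpha>2 x = - l2 x \<and> \<alpha>1 x = - l1 x) \<or> (\<alpha>2 x = - r2 x \<and> \<alpha>1 x = - r1 x)" for x
    using feedback[of x] by blast
  show ?thesis
    unfolding nash_feedback_def
  proof (intro conjI allI impI)
    show "\<alpha>1 x \<in> U1" "\<alpha>2 x \<in> U2" for x using U by auto
    show "\<exists>x. caratheodory_solution (\<lambda>t z. \<alpha>1 z + \<alpha>2 z) y x" for y
      by (rule closed_loop_exists[OF feedback bound h(1,2)])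
    fix y x assume sol: "caratheodory_solution (\<lambda>t z. \<alpha>1 z + \<alpha>2 z) y x"
    show "is_minimum (cost h1 (\<lambda>t. \<alpha>1 (x t)) x) (attainable_costs h1 U1 \<alpha>2 y)"
      by (rule closed_loop_optimal[OF feedback bound h(1,2) U(1,2) sol])
    have "caratheodory_solution (\<lambda>t z. \<alpha>2 z + \<alpha>1 z) y x" using sol by (simp add: add.commute)
    then show "is_minimum (cost h2 (\<lambda>t. \<alpha>2 (x t)) x) (attainable_costs h2 U2 \<alpha>1 y)"
      by (rule s.closed_loop_optimal[OF fb bound(2,1) h(3,4) U(3,4)])
  qed
qed

end

section \<open>A one-parameter family of solutions\<close>

lemma quotient_difference_bound:
  fixes f g d e s :: real
  assumes "\<bar>f - g\<bar> \<le> c1 * s" "\<bar>g\<bar> \<le> m" "\<bar>d - e\<bar> \<le> c2 * s" "\<delta> \<le> d" "\<delta> \<le> e" "0 < \<delta>" "0 \<le> s" "0 \<le> c1" "0 \<le> c2"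
  shows "\<bar>f / d - g / e\<bar> \<le> (c1 / \<delta> + m * c2 / \<delta>\<^sup>2) * s"
proof -
  have pos: "0 < d" "0 < e" "0 \<le> m" using assms by auto
  have "f / d - g / e = (f - g) / d + g * (e - d) / (d * e)"
    using pos by (simp add: field_simps)
  also have "\<bar>\<dots>\<bar> \<le> \<bar>f - g\<bar> / d + \<bar>g\<bar> * \<bar>d - e\<bar> / (d * e)"
    using pos by (intro order_trans[OF abs_triangle_ineq]) (simp add: abs_mult abs_minus_commute)
  also have "\<dots> \<le> c1 * s / \<delta> + m * (c2 * s) / (\<delta> * \<delta>)"
    using assms pos by (intro add_mono frac_le mult_mono mult_nonneg_nonneg) auto
  also have "\<dots> = (c1 / \<delta> + m * c2 / \<delta>\<^sup>2) * s"
    using assms(6) by (simp add: power2_eq_square field_simps)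
  finally show ?thesis .
qed

section \<open>The saddle at the origin and bounded flows that avoid it\<close>

lemma branch_form_pos:
  fixes p1 p2 :: real
  shows "p1\<^sup>2 + p2\<^sup>2 \<le> 2 * (p1\<^sup>2 + p1 * p2 + p2\<^sup>2)"
proof -
  have "2 * (p1\<^sup>2 + p1 * p2 + p2\<^sup>2) - (p1\<^sup>2 + p2\<^sup>2) = (p1 + p2)\<^sup>2"
    by (simp add: power2_eq_square algebra_simps)
  then show ?thesis using zero_le_power2[of "p1 + p2"] by linarith
qed

text \<open>In rescaled time the linearization at the origin has rows \<open>(k1 - k2, k1)\<close>
  and \<open>(k2, k2 - k1)\<close>: trace 0 and eigenvalues plus and minus
  \<open>sqrt (k1\<^sup>2 - k1 * k2 + k2\<^sup>2)\<close>. The vector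
  \<open>(saddle_slope k1 k2, 1)\<close> is a left eigenvector for the positive one, so the stable
  direction is its orthogonal complement.\<close>

definition saddle_slope :: "real \<Rightarrow> real \<Rightarrow> real" where
  "saddle_slope k1 k2 = (k1 - k2 + sqrt (k1\<^sup>2 - k1 * k2 + k2\<^sup>2)) / k1"

text \<open>The two equations for \<open>k1 * \<sigma>\<close> and \<open>k2\<close> are the
  components of the left eigenvector equation. The signs follow from
  \<open>\<bar>k1 - k2\<bar> < \<mu>\<close>, that is, from \<open>k1 * k2 > 0\<close>.\<close>

lemma saddle_slope:
  fixes k1 k2 :: real
  assumes k: "0 < k1" "0 < k2"
  defines "\<mu> \<equiv> sqrt (k1\<^sup>2 - k1 * k2 + k2\<^sup>2)" and "\<sigma> \<equiv> saddle_slope k1 k2"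
  shows "0 < \<mu>" "0 < \<sigma>" "k1 * \<sigma> = k1 - k2 + \<mu>" "k2 = \<sigma> * (\<mu> - k1 + k2)" "0 < \<mu> - k1 + k2"
proof -
  have gt: "\<bar>k1 - k2\<bar> < \<mu>"
    unfolding \<mu>_def
  proof (rule real_less_rsqrt)
    have "k1\<^sup>2 - k1 * k2 + k2\<^sup>2 - \<bar>k1 - k2\<bar>\<^sup>2 = k1 * k2"
      by (simp add: power2_eq_square algebra_simps)
    moreover have "0 < k1 * k2" using k by simp
    ultimately show "\<bar>k1 - k2\<bar>\<^sup>2 < k1\<^sup>2 - k1 * k2 + k2\<^sup>2" by linarith
  qed
  then show l: "0 < \<mu>" and m: "0 < \<mu> - k1 + k2" by linarith+
  show e: "k1 * \<sigma> = k1 - k2 + \<mu>" using k by (simp add: \<sigma>_def saddle_slope_def \<mu>_def)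
  show "0 < \<sigma>" using gt k unfolding \<sigma>_def saddle_slope_def \<mu>_def[symmetric] by (intro divide_pos_pos) linarith+
  have sq: "\<mu>\<^sup>2 = k1\<^sup>2 - k1 * k2 + k2\<^sup>2"
    unfolding \<mu>_def
  proof (rule real_sqrt_pow2)
    have "k1\<^sup>2 - k1 * k2 + k2\<^sup>2 = (k1 - k2)\<^sup>2 + k1 * k2" by (simp add: power2_eq_square algebra_simps)
    moreover have "0 \<le> k1 * k2" using k by simp
    ultimately show "0 \<le> k1\<^sup>2 - k1 * k2 + k2\<^sup>2" using zero_le_power2[of "k1 - k2"] by linarith
  qed
  have "k1 * (\<sigma> * (\<mu> - k1 + k2)) = (k1 - k2 + \<mu>) * (\<mu> - k1 + k2)" using e by simp
  also have "\<dots> = \<mu>\<^sup>2 - (k1 - k2)\<^sup>2" by (simp add: power2_eq_square algebra_simps)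
  also have "\<dots> = k1 * k2" unfolding sq by (simp add: power2_eq_square algebra_simps)
  finally show "k2 = \<sigma> * (\<mu> - k1 + k2)" using k by simp
qed

text \<open>Eliminating the square root gives \<open>k2 * (2 * t - 1) = k1 * (t * (2 - t))\<close>
  for the slope \<open>t\<close>, so the slope determines the ratio. The case
  \<open>t = 1 / 2\<close> cannot occur: the right side would be \<open>3 / 4 * k1\<close>.\<close>

lemma saddle_slope_eq_imp_ratio_eq:
  fixes k1 k2 m1 m2 :: real
  assumes "0 < k1" "0 < k2" "0 < m1" "0 < m2" "saddle_slope k1 k2 = saddle_slope m1 m2"
  shows "k2 / k1 = m2 / m1"
proof -
  have *: "c2 * (2 * t - 1) = c1 * (t * (2 - t))" if "0 < c1" "0 < c2" "t = saddle_slope c1 c2" for c1 c2 t :: real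
  proof -
    define l where "l = sqrt (c1\<^sup>2 - c1 * c2 + c2\<^sup>2)"
    have e: "c1 * t = c1 - c2 + l" "c2 = t * (l - c1 + c2)"
      using saddle_slope(3,4)[OF that(1,2)] that(3) unfolding l_def by auto
    have l: "l = c1 * t - c1 + c2" using e(1) by simp
    show ?thesis using e(2) unfolding l by (simp add: algebra_simps)
  qed
  define t where "t = saddle_slope k1 k2"
  have 1: "k2 * (2 * t - 1) = k1 * (t * (2 - t))" by (rule *[OF assms(1,2) t_def])
  have 2: "m2 * (2 * t - 1) = m1 * (t * (2 - t))" by (rule *[OF assms(3,4)]) (simp add: t_def assms(5))
  have ne: "2 * t - 1 \<noteq> 0"
  proof
    assume z: "2 * t - 1 = 0"
    then have t: "t = 1 / 2" by simp
    show False using 1 assms(1) unfolding z unfolding t by simp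
  qed
  have "k2 / k1 = t * (2 - t) / (2 * t - 1)" "m2 / m1 = t * (2 - t) / (2 * t - 1)"
    using 1 2 ne assms by (simp_all add: field_simps)
  then show ?thesis by simp
qed

text \<open>The equations \<open>w' = k - p\<close> solved for the derivative of \<open>p\<close>;
  the denominator is the Jacobian determinant of \<open>p \<mapsto> w\<close>.\<close>

definition saddle_flow :: "real \<Rightarrow> real \<Rightarrow> real \<Rightarrow> (real \<Rightarrow> real) \<Rightarrow> (real \<Rightarrow> real) \<Rightarrow> bool" where
  "saddle_flow k1 k2 B p1 p2 \<longleftrightarrow> (\<forall>x\<ge>0.
     (p1 has_real_derivative ((k1 - k2) * p1 x + k1 * p2 x - (p1 x)\<^sup>2)
       / ((p1 x)\<^sup>2 + p1 x * p2 x + (p2 x)\<^sup>2)) (at x within {0..}) \<and>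
     (p2 has_real_derivative ((k2 - k1) * p2 x + k2 * p1 x - (p2 x)\<^sup>2)
       / ((p1 x)\<^sup>2 + p1 x * p2 x + (p2 x)\<^sup>2)) (at x within {0..}) \<and>
     0 < (p1 x)\<^sup>2 + p1 x * p2 x + (p2 x)\<^sup>2 \<and> \<bar>p1 x\<bar> \<le> B \<and> \<bar>p2 x\<bar> \<le> B)"

text \<open>After rescaling time by the quadratic form in the denominators, the origin is a saddle whose
  stable direction is orthogonal to \<open>(\<sigma>, 1)\<close> with \<open>\<sigma> = saddle_slope k1 k2\<close>, and \<open>(k1, k2)\<close> is a sink.
  The pentagon \<open>K\<close> cut out by \<open>\<sigma> p\<^sub>1 + p\<^sub>2 \<ge> c > 0\<close> and \<open>- \<epsilon> \<le> p\<^sub>i \<le> B\<close> is trapping and avoids the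
  saddle.\<close>

lemma branch_flow_exists:
  fixes k1 k2 w1 w2 :: real
  assumes k: "0 < k1" "0 < k2" and w: "\<bar>w1\<bar> \<le> 1" "\<bar>w2\<bar> \<le> 1"
    and side: "0 < saddle_slope k1 k2 * w1 + w2"
  shows "\<exists>\<epsilon>0>0. \<forall>\<epsilon>. 0 < \<epsilon> \<and> \<epsilon> \<le> \<epsilon>0 \<longrightarrow>
    (\<exists>p1 p2. saddle_flow k1 k2 (2 * (k1 + k2) + 1) p1 p2 \<and> p1 0 = \<epsilon> * w1 \<and> p2 0 = \<epsilon> * w2)"
proof -
  \<comment> \<open>\<open>2 * k1 \<le> B\<close> and \<open>2 * k2 \<le> B\<close> make the field
    point inward on the two upper sides of \<open>K\<close>; \<open>1 \<le> B\<close> makes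
    \<open>B\<close> a bound for the absolute values as well.\<close>
  define B where "B = 2 * (k1 + k2) + 1"
  define \<sigma> \<mu> where "\<sigma> = saddle_slope k1 k2" and "\<mu> = sqrt (k1\<^sup>2 - k1 * k2 + k2\<^sup>2)"
  note \<sigma>\<mu> = saddle_slope[OF k, folded \<sigma>_def \<mu>_def]
  define m where "m = \<sigma> * w1 + w2"
  have m: "0 < m" using side by (simp add: m_def \<sigma>_def)
  \<comment> \<open>On the slanted side \<open>\<sigma> * p1 + p2 = c\<close> of \<open>K\<close>
    the components are at most \<open>\<epsilon> * a1\<close> and \<open>\<epsilon> * a2\<close> in
    absolute value, and \<open>\<sigma> * p1\<^sup>2 + p2\<^sup>2\<close> is at most
    \<open>\<epsilon>\<^sup>2 * A\<close>.\<close>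
  define a1 a2 where "a1 = 1 + (m + 1) / \<sigma>" and "a2 = 1 + m + \<sigma>"
  define A where "A = 2 * \<sigma> * a1\<^sup>2 + 2 * a2\<^sup>2"
  have a2: "0 < a2" using m \<sigma>\<mu> by (simp add: a2_def)
  have A: "0 < A" unfolding A_def using a2 \<sigma>\<mu> by (intro add_nonneg_pos) auto
  \<comment> \<open>\<open>\<epsilon> \<le> \<mu>\<close> gives
    \<open>- \<mu> * z - z\<^sup>2 \<ge> 0\<close> at \<open>z = - \<epsilon>\<close>, as needed on
    the lower sides. \<open>\<epsilon> \<le> \<mu> * m / A\<close> lets the linear repulsion
    \<open>\<mu> * (\<epsilon> * m)\<close> dominate the quadratic terms on the slanted
    side.\<close>
  define \<epsilon>0 where "\<epsilon>0 = min 1 (min \<mu> (\<mu> * m / A))"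
  have B1: "1 \<le> B" "2 * k1 \<le> B" "2 * k2 \<le> B" using k by (auto simp: B_def)
  define F1 F2 D where "F1 p1 p2 = (k1 - k2) * p1 + k1 * p2 - p1\<^sup>2" and "F2 p1 p2 = (k2 - k1) * p2 + k2 * p1 - p2\<^sup>2"
    and "D p1 p2 = p1\<^sup>2 + p1 * p2 + p2\<^sup>2" for p1 p2 :: real
  have main: "\<exists>p1 p2. p1 0 = \<epsilon> * w1 \<and> p2 0 = \<epsilon> * w2 \<and>
      (\<forall>x\<ge>0. (p1 has_real_derivative F1 (p1 x) (p2 x) / D (p1 x) (p2 x)) (at x within {0..}) \<and>
        (p2 has_real_derivative F2 (p1 x) (p2 x) / D (p1 x) (p2 x)) (at x within {0..}) \<and>
        0 < D (p1 x) (p2 x) \<and> \<bar>p1 x\<bar> \<le> B \<and> \<bar>p2 x\<bar> \<le> B)"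
    if \<epsilon>: "0 < \<epsilon>" "\<epsilon> \<le> \<epsilon>0" for \<epsilon>
  proof -
    have \<epsilon>': "\<epsilon> \<le> 1" "\<epsilon> \<le> \<mu>" "\<epsilon> \<le> \<mu> * m / A" using \<epsilon>(2) unfolding \<epsilon>0_def by linarith+
    \<comment> \<open>The slanted side passes through the initial point
      \<open>(\<epsilon> * w1, \<epsilon> * w2)\<close>.\<close>
    define c where "c = \<epsilon> * m"
    have c: "0 < c" using \<epsilon> m by (simp add: c_def)
    define Y where "Y = (\<sigma> + 1) * B"
    have Y: "0 < Y" unfolding Y_def using \<sigma>\<mu> B1 by (intro mult_pos_pos) auto
    define I :: "((real \<times> real) \<times> real) set"
      where "I = {((1, 0), - \<epsilon>), ((0, 1), - \<epsilon>), ((\<sigma>, 1), c), ((- 1, 0), - B), ((0, - 1), - B)}"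
    define K where "K = {p. \<forall>i\<in>I. snd i \<le> fst i \<bullet> p}"
    have K: "(p1, p2) \<in> K \<longleftrightarrow> - \<epsilon> \<le> p1 \<and> - \<epsilon> \<le> p2 \<and> c \<le> \<sigma> * p1 + p2 \<and> p1 \<le> B \<and> p2 \<le> B" for p1 p2
      unfolding K_def I_def by (simp add: inner_Pair)
    define G where "G p = (F1 (fst p) (snd p) / D (fst p) (snd p), F2 (fst p) (snd p) / D (fst p) (snd p))" for p
    \<comment> \<open>Cauchy-Schwarz applied to \<open>c \<le> \<sigma> * p1 + p2\<close>, together
      with \<open>branch_form_pos\<close>, keeps the denominator above \<open>\<delta>\<close> on
      \<open>K\<close>.\<close>
    define \<delta> where "\<delta> = c\<^sup>2 / (2 * (\<sigma>\<^sup>2 + 1))"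
    have \<delta>: "0 < \<delta>" unfolding \<delta>_def using c by (intro divide_pos_pos) (auto intro: add_nonneg_pos)
    have D\<delta>: "\<delta> \<le> D p1 p2" if p: "(p1, p2) \<in> K" for p1 p2
    proof -
      have "c\<^sup>2 \<le> (\<sigma> * p1 + p2)\<^sup>2" using p c by (intro power_mono) (auto simp: K)
      also have "\<dots> \<le> (\<sigma>\<^sup>2 + 1) * (p1\<^sup>2 + p2\<^sup>2)"
      proof -
        have "(\<sigma>\<^sup>2 + 1) * (p1\<^sup>2 + p2\<^sup>2) - (\<sigma> * p1 + p2)\<^sup>2 = (p1 - \<sigma> * p2)\<^sup>2"
          by (simp add: power2_eq_square algebra_simps)
        then show ?thesis using zero_le_power2[of "p1 - \<sigma> * p2"] by linarith
      qed
      also have "\<dots> \<le> (\<sigma>\<^sup>2 + 1) * (2 * D p1 p2)"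
        unfolding D_def by (intro mult_left_mono branch_form_pos) auto
      finally have "c\<^sup>2 \<le> D p1 p2 * (2 * (\<sigma>\<^sup>2 + 1))" by (simp add: algebra_simps)
      moreover have "0 < 2 * (\<sigma>\<^sup>2 + 1)" by (auto intro: add_nonneg_pos)
      ultimately show ?thesis unfolding \<delta>_def by (simp add: pos_divide_le_eq)
    qed
    have absB: "\<bar>p1\<bar> \<le> B \<and> \<bar>p2\<bar> \<le> B" if p: "(p1, p2) \<in> K" for p1 p2
      using p \<epsilon>'(1) B1 unfolding K by auto
    define Lc where "Lc = (k1 + k2 + 2 * B) / \<delta> + (2 * (k1 + k2) * B + B\<^sup>2) * (3 * B) / \<delta>\<^sup>2"
    have lip: "norm (G p - G q) \<le> (4 * Lc) * norm (p - q)" if pq: "p \<in> K" "q \<in> K" for p q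
    proof -
      obtain p1 p2 q1 q2 where e: "p = (p1, p2)" "q = (q1, q2)" by (cases p, cases q)
      define s where "s = \<bar>p1 - q1\<bar> + \<bar>p2 - q2\<bar>"
      have b: "\<bar>p1\<bar> \<le> B" "\<bar>p2\<bar> \<le> B" "\<bar>q1\<bar> \<le> B" "\<bar>q2\<bar> \<le> B" using absB pq e by auto
      have sq: "\<bar>x\<^sup>2 - z\<^sup>2\<bar> \<le> 2 * B * \<bar>x - z\<bar>" if "\<bar>x\<bar> \<le> B" "\<bar>z\<bar> \<le> B" for x z :: real
      proof -
        have "\<bar>x\<^sup>2 - z\<^sup>2\<bar> = \<bar>x + z\<bar> * \<bar>x - z\<bar>" by (simp add: power2_eq_square algebra_simps flip: abs_mult)
        also have "\<dots> \<le> (2 * B) * \<bar>x - z\<bar>" using that by (intro mult_right_mono) auto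
        finally show ?thesis .
      qed
      have cross: "\<bar>p1 * p2 - q1 * q2\<bar> \<le> B * s"
      proof -
        have "p1 * p2 - q1 * q2 = p1 * (p2 - q2) + (p1 - q1) * q2" by (simp add: algebra_simps)
        also have "\<bar>\<dots>\<bar> \<le> \<bar>p1\<bar> * \<bar>p2 - q2\<bar> + \<bar>p1 - q1\<bar> * \<bar>q2\<bar>"
          by (rule order_trans[OF abs_triangle_ineq]) (simp add: abs_mult)
        also have "\<dots> \<le> B * \<bar>p2 - q2\<bar> + \<bar>p1 - q1\<bar> * B"
          using b by (intro add_mono mult_right_mono mult_left_mono) auto
        finally show ?thesis by (simp add: s_def algebra_simps)
      qed
      have Dl: "\<bar>D p1 p2 - D q1 q2\<bar> \<le> (3 * B) * s"
      proof -
        have "D p1 p2 - D q1 q2 = (p1\<^sup>2 - q1\<^sup>2) + (p1 * p2 - q1 * q2) + (p2\<^sup>2 - q2\<^sup>2)" by (simp add: D_def)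
        also have "\<bar>\<dots>\<bar> \<le> \<bar>p1\<^sup>2 - q1\<^sup>2\<bar> + \<bar>p1 * p2 - q1 * q2\<bar> + \<bar>p2\<^sup>2 - q2\<^sup>2\<bar>" by linarith
        also have "\<dots> \<le> 2 * B * \<bar>p1 - q1\<bar> + B * s + 2 * B * \<bar>p2 - q2\<bar>"
          by (intro add_mono sq cross b)
        finally show ?thesis by (simp add: s_def algebra_simps)
      qed
      have lin: "\<bar>(c1 - c2) * x + c1 * y\<bar> \<le> (k1 + k2) * (\<bar>x\<bar> + \<bar>y\<bar>)"
        if "c1 = k1 \<and> c2 = k2 \<or> c1 = k2 \<and> c2 = k1" for c1 c2 x y :: real
      proof -
        have "\<bar>(c1 - c2) * x + c1 * y\<bar> \<le> \<bar>c1 - c2\<bar> * \<bar>x\<bar> + \<bar>c1\<bar> * \<bar>y\<bar>"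
          by (rule order_trans[OF abs_triangle_ineq]) (simp add: abs_mult)
        also have "\<dots> \<le> (k1 + k2) * \<bar>x\<bar> + (k1 + k2) * \<bar>y\<bar>"
          using that k by (intro add_mono mult_right_mono) auto
        finally show ?thesis by (simp add: algebra_simps)
      qed
      have s0: "0 \<le> s" by (simp add: s_def)
      have c0: "0 \<le> k1 + k2 + 2 * B" "0 \<le> 3 * B" using k B1 by auto
      have d: "\<delta> \<le> D p1 p2" "\<delta> \<le> D q1 q2" using D\<delta> pq e by auto
      have F1l: "\<bar>F1 p1 p2 - F1 q1 q2\<bar> \<le> (k1 + k2 + 2 * B) * s"
      proof -
        have "F1 p1 p2 - F1 q1 q2 = ((k1 - k2) * (p1 - q1) + k1 * (p2 - q2)) - (p1\<^sup>2 - q1\<^sup>2)"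
          by (simp add: F1_def algebra_simps)
        also have "\<bar>\<dots>\<bar> \<le> \<bar>(k1 - k2) * (p1 - q1) + k1 * (p2 - q2)\<bar> + \<bar>p1\<^sup>2 - q1\<^sup>2\<bar>" by linarith
        also have "\<dots> \<le> (k1 + k2) * s + 2 * B * \<bar>p1 - q1\<bar>"
          unfolding s_def by (intro add_mono lin sq b) auto
        also have "\<dots> \<le> (k1 + k2) * s + 2 * B * s"
          using B1 by (intro add_left_mono mult_left_mono) (auto simp: s_def)
        finally show ?thesis by (simp add: algebra_simps)
      qed
      have F2l: "\<bar>F2 p1 p2 - F2 q1 q2\<bar> \<le> (k1 + k2 + 2 * B) * s"
      proof -
        have "F2 p1 p2 - F2 q1 q2 = ((k2 - k1) * (p2 - q2) + k2 * (p1 - q1)) - (p2\<^sup>2 - q2\<^sup>2)"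
          by (simp add: F2_def algebra_simps)
        also have "\<bar>\<dots>\<bar> \<le> \<bar>(k2 - k1) * (p2 - q2) + k2 * (p1 - q1)\<bar> + \<bar>p2\<^sup>2 - q2\<^sup>2\<bar>" by linarith
        also have "\<dots> \<le> (k1 + k2) * (\<bar>p2 - q2\<bar> + \<bar>p1 - q1\<bar>) + 2 * B * \<bar>p2 - q2\<bar>"
          by (intro add_mono lin sq b) auto
        also have "\<dots> \<le> (k1 + k2) * s + 2 * B * s"
          using B1 by (intro add_mono mult_left_mono) (use k in \<open>auto simp: s_def\<close>)
        finally show ?thesis by (simp add: algebra_simps)
      qed
      have sqB: "\<bar>x\<^sup>2\<bar> \<le> B\<^sup>2" if "\<bar>x\<bar> \<le> B" for x :: real
        using that by (metis abs_ge_zero abs_power2 power2_abs power_mono)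
      have Fb: "\<bar>F1 q1 q2\<bar> \<le> 2 * (k1 + k2) * B + B\<^sup>2" "\<bar>F2 q1 q2\<bar> \<le> 2 * (k1 + k2) * B + B\<^sup>2"
      proof -
        have B2: "(k1 + k2) * (\<bar>q1\<bar> + \<bar>q2\<bar>) \<le> (k1 + k2) * (B + B)"
          using b k by (intro mult_left_mono add_mono) auto
        have "\<bar>F1 q1 q2\<bar> \<le> \<bar>(k1 - k2) * q1 + k1 * q2\<bar> + \<bar>q1\<^sup>2\<bar>" unfolding F1_def by linarith
        also have "\<dots> \<le> (k1 + k2) * (\<bar>q1\<bar> + \<bar>q2\<bar>) + B\<^sup>2" by (intro add_mono lin sqB b) auto
        finally show "\<bar>F1 q1 q2\<bar> \<le> 2 * (k1 + k2) * B + B\<^sup>2" using B2 by (simp add: algebra_simps)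
        have "\<bar>F2 q1 q2\<bar> \<le> \<bar>(k2 - k1) * q2 + k2 * q1\<bar> + \<bar>q2\<^sup>2\<bar>" unfolding F2_def by linarith
        also have "\<dots> \<le> (k1 + k2) * (\<bar>q2\<bar> + \<bar>q1\<bar>) + B\<^sup>2" by (intro add_mono lin sqB b) auto
        finally show "\<bar>F2 q1 q2\<bar> \<le> 2 * (k1 + k2) * B + B\<^sup>2" using B2 by (simp add: algebra_simps)
      qed
      have q: "\<bar>F1 p1 p2 / D p1 p2 - F1 q1 q2 / D q1 q2\<bar> \<le> Lc * s"
        "\<bar>F2 p1 p2 / D p1 p2 - F2 q1 q2 / D q1 q2\<bar> \<le> Lc * s"
        unfolding Lc_def
        by (rule quotient_difference_bound[OF F1l Fb(1) Dl d \<delta> s0 c0] quotient_difference_bound[OF F2l Fb(2) Dl d \<delta> s0 c0])+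
      have Lc0: "0 \<le> Lc" unfolding Lc_def using c0 \<delta> B1 k by (intro add_nonneg_nonneg divide_nonneg_nonneg mult_nonneg_nonneg) auto
      have "norm (G p - G q) \<le> \<bar>F1 p1 p2 / D p1 p2 - F1 q1 q2 / D q1 q2\<bar> + \<bar>F2 p1 p2 / D p1 p2 - F2 q1 q2 / D q1 q2\<bar>"
        unfolding G_def e using norm_Pair_le[of "F1 p1 p2 / D p1 p2 - F1 q1 q2 / D q1 q2" "F2 p1 p2 / D p1 p2 - F2 q1 q2 / D q1 q2"] by simp
      also have "\<dots> \<le> 2 * Lc * s" using q by linarith
      also have "s \<le> 2 * norm (p - q)"
        unfolding s_def e using norm_fst_le[of "p1 - q1" "p2 - q2"] norm_snd_le[of "p2 - q2" "p1 - q1"] by simp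
      then have "2 * Lc * s \<le> 2 * Lc * (2 * norm (p - q))" using Lc0 by (intro mult_left_mono) auto
      finally show ?thesis by simp
    qed
    \<comment> \<open>The sum of the rates required on the lower, slanted and upper sides, in this
      order.\<close>
    define L' where "L' = (\<mu> + B + 1) + (2 * Y / \<sigma> + 2 * Y) + (2 * B + k1 + k2)"
    have Lpos: "0 \<le> 2 * Y / \<sigma> + 2 * Y" using Y \<sigma>\<mu> by simp
    have L': "\<mu> + B + 1 \<le> L'" "2 * Y / \<sigma> + 2 * Y \<le> L'" "2 * B + k1 + k2 \<le> L'" "0 < L'"
      unfolding L'_def using Lpos \<sigma>\<mu> B1 k by linarith+
    have low: "- L' * (z + \<epsilon>) \<le> - \<mu> * z - z\<^sup>2" if z: "- \<epsilon> \<le> z" "z \<le> B" for z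
    proof -
      define t where "t = z + \<epsilon>"
      have t: "0 \<le> t" "t \<le> B + 1" "z = t - \<epsilon>" using z \<epsilon>' by (auto simp: t_def)
      have "t * t \<le> (B + 1) * t" using t by (intro mult_right_mono) auto
      moreover have "0 \<le> t * \<epsilon>" using t \<epsilon> by simp
      moreover have "\<epsilon> * \<epsilon> \<le> \<mu> * \<epsilon>" using \<epsilon> \<epsilon>' by (intro mult_right_mono) auto
      moreover have "(\<mu> + B + 1) * t \<le> L' * t" using L' t by (intro mult_right_mono) auto
      moreover have "- \<mu> * z - z\<^sup>2 = - \<mu> * t + \<mu> * \<epsilon> - t * t + 2 * (t * \<epsilon>) - \<epsilon> * \<epsilon>"
        unfolding t(3) by (simp add: power2_eq_square algebra_simps)
      moreover have "(\<mu> + B + 1) * t = \<mu> * t + (B + 1) * t" by (simp add: algebra_simps)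
      ultimately show ?thesis unfolding t_def[symmetric] by linarith
    qed
    have up: "- L' * (B - z) \<le> - ((c1 - c2) * z + c1 * z' - z\<^sup>2)"
      if z: "z \<le> B" "z' \<le> B" and cc: "c1 = k1 \<and> c2 = k2 \<or> c1 = k2 \<and> c2 = k1" for z z' c1 c2
    proof -
      define t where "t = B - z"
      have t: "0 \<le> t" "z = B - t" using z by (auto simp: t_def)
      have c12: "0 < c1" "0 < c2" "2 * c1 \<le> B" "c2 \<le> k1 + k2" using cc k B1 by auto
      have "c1 * z' \<le> c1 * B" using c12 z by (intro mult_left_mono) auto
      moreover have "0 \<le> B * (B - 2 * c1 + c2)" using c12 B1 by (intro mult_nonneg_nonneg) auto
      moreover have "0 \<le> c1 * t" "0 \<le> t * t" using c12 t by auto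
      moreover have "(2 * B + c2) * t \<le> L' * t" using c12 L' t by (intro mult_right_mono) auto
      moreover have "- ((c1 - c2) * z + c1 * z' - z\<^sup>2)
          = B * (B - 2 * c1 + c2) + (c1 * B - c1 * z') + c1 * t + t * t - (2 * B + c2) * t"
        unfolding t(2) by (simp add: power2_eq_square algebra_simps)
      ultimately show ?thesis unfolding t_def[symmetric] by linarith
    qed
    \<comment> \<open>Pairing with the left eigenvector turns the linear part of the field into
      \<open>\<mu> * (\<sigma> * p1 + p2)\<close>; only the two squares remain to be
      absorbed.\<close>
    have mid: "- L' * (\<sigma> * p1 + p2 - c) \<le> \<sigma> * F1 p1 p2 + F2 p1 p2" if p: "(p1, p2) \<in> K" for p1 p2
    proof -
      define t where "t = \<sigma> * p1 + p2 - c"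
      have t: "0 \<le> t" using p by (simp add: t_def K)
      have "\<sigma> * p1 \<le> \<sigma> * B" using p \<sigma>\<mu> by (intro mult_left_mono) (auto simp: K)
      then have tY: "t \<le> Y" using p c unfolding t_def Y_def K by (simp add: algebra_simps)
      have sq: "x\<^sup>2 \<le> 2 * \<epsilon>\<^sup>2 * a\<^sup>2 + 2 * (b * t)\<^sup>2" if "\<bar>x\<bar> \<le> \<epsilon> * a + b * t" for x a b
      proof -
        have "x\<^sup>2 \<le> (\<epsilon> * a + b * t)\<^sup>2" using that by (metis abs_ge_zero power2_abs power_mono)
        also have "\<dots> \<le> 2 * \<epsilon>\<^sup>2 * a\<^sup>2 + 2 * (b * t)\<^sup>2"
        proof -
          have "2 * \<epsilon>\<^sup>2 * a\<^sup>2 + 2 * (b * t)\<^sup>2 - (\<epsilon> * a + b * t)\<^sup>2 = (\<epsilon> * a - b * t)\<^sup>2"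
            by (simp add: power2_eq_square algebra_simps)
          then show ?thesis using zero_le_power2[of "\<epsilon> * a - b * t"] by linarith
        qed
        finally show ?thesis .
      qed
      have p1b: "\<bar>p1\<bar> \<le> \<epsilon> * a1 + (1 / \<sigma>) * t"
      proof -
        have "\<sigma> * p1 = t + c - p2" by (simp add: t_def)
        also have "\<dots> \<le> t + \<epsilon> * m + \<epsilon>" using p by (auto simp: K c_def)
        finally have "p1 \<le> (t + \<epsilon> * m + \<epsilon>) / \<sigma>" using \<sigma>\<mu>(2) by (simp add: pos_le_divide_eq mult.commute)
        also have "\<dots> = \<epsilon> * ((m + 1) / \<sigma>) + (1 / \<sigma>) * t" using \<sigma>\<mu>(2) by (simp add: field_simps)
        finally have 1: "p1 \<le> \<epsilon> * ((m + 1) / \<sigma>) + (1 / \<sigma>) * t" .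
        have 2: "0 \<le> \<epsilon> * ((m + 1) / \<sigma>)" "0 \<le> (1 / \<sigma>) * t" using \<epsilon> m \<sigma>\<mu>(2) t by auto
        have 3: "\<epsilon> * a1 = \<epsilon> + \<epsilon> * ((m + 1) / \<sigma>)" by (simp add: a1_def distrib_left)
        have "- \<epsilon> \<le> p1" using p by (simp add: K)
        then show ?thesis using 1 2 3 \<epsilon>(1) by linarith
      qed
      have p2b: "\<bar>p2\<bar> \<le> \<epsilon> * a2 + 1 * t"
      proof -
        have "- (\<epsilon> * \<sigma>) \<le> \<sigma> * p1" using mult_left_mono[of "- \<epsilon>" p1 \<sigma>] p \<sigma>\<mu>(2) by (simp add: K mult.commute)
        then have 1: "p2 \<le> t + \<epsilon> * m + \<epsilon> * \<sigma>" by (simp add: t_def c_def)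
        have 2: "0 \<le> \<epsilon> * m" "0 \<le> \<epsilon> * \<sigma>" using \<epsilon> m \<sigma>\<mu>(2) by auto
        have 3: "\<epsilon> * a2 = \<epsilon> + \<epsilon> * m + \<epsilon> * \<sigma>" by (simp add: a2_def algebra_simps)
        have "- \<epsilon> \<le> p2" using p by (simp add: K)
        then show ?thesis using 1 2 3 \<epsilon>(1) t by linarith
      qed
      have "\<sigma> * p1\<^sup>2 + p2\<^sup>2 \<le> \<sigma> * (2 * \<epsilon>\<^sup>2 * a1\<^sup>2 + 2 * ((1 / \<sigma>) * t)\<^sup>2) + (2 * \<epsilon>\<^sup>2 * a2\<^sup>2 + 2 * (1 * t)\<^sup>2)"
        using \<sigma>\<mu>(2) by (intro add_mono mult_left_mono sq p1b p2b) auto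
      also have "\<dots> = \<epsilon> * (\<epsilon> * A) + (2 / \<sigma> + 2) * (t * t)"
        using \<sigma>\<mu>(2) by (simp add: A_def power2_eq_square field_simps)
      also have "\<dots> \<le> \<epsilon> * (\<mu> * m) + (2 / \<sigma> + 2) * (Y * t)"
      proof (intro add_mono mult_left_mono mult_right_mono)
        show "\<epsilon> * A \<le> \<mu> * m" using \<epsilon>'(3) A by (simp add: pos_le_divide_eq)
      qed (use \<epsilon> \<sigma>\<mu>(2) t tY in auto)
      also have "\<dots> = \<mu> * c + (2 * Y / \<sigma> + 2 * Y) * t" by (simp add: c_def algebra_simps)
      also have "\<dots> \<le> \<mu> * c + L' * t" using L' t by (intro add_left_mono mult_right_mono) auto
      finally have 1: "\<sigma> * p1\<^sup>2 + p2\<^sup>2 \<le> \<mu> * c + L' * t" .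
      have "\<sigma> * F1 p1 p2 + F2 p1 p2 = (\<sigma> * (\<mu> - k1 + k2)) * p1 + (\<sigma> * k1 - \<sigma> * k2) * p1 + (k1 * \<sigma>) * p2 + (k2 - k1) * p2 - \<sigma> * p1\<^sup>2 - p2\<^sup>2"
        unfolding F1_def F2_def \<sigma>\<mu>(4)[symmetric] by (simp add: algebra_simps)
      also have "\<dots> = \<mu> * (t + c) - \<sigma> * p1\<^sup>2 - p2\<^sup>2"
        unfolding \<sigma>\<mu>(3) t_def by (simp add: algebra_simps)
      finally have 2: "\<sigma> * F1 p1 p2 + F2 p1 p2 = \<mu> * t + \<mu> * c - \<sigma> * p1\<^sup>2 - p2\<^sup>2" by (simp add: algebra_simps)
      have "0 \<le> \<mu> * t" using \<sigma>\<mu>(1) t by simp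
      then show ?thesis using 1 2 unfolding t_def[symmetric] by linarith
    qed
    \<comment> \<open>In \<open>K\<close>, \<open>p2 \<ge> - \<sigma> * p1\<close>; inserting this
      bound leaves the stable eigenvalue \<open>- \<mu>\<close> as the coefficient of
      \<open>p1\<close>.\<close>
    have left1: "- L' * (p1 + \<epsilon>) \<le> F1 p1 p2" if p: "(p1, p2) \<in> K" for p1 p2
    proof -
      have "k1 * (- (\<sigma> * p1)) \<le> k1 * p2" using p c k by (intro mult_left_mono) (auto simp: K)
      then have "- ((k1 * \<sigma>) * p1) \<le> k1 * p2" by (simp add: algebra_simps)
      then have "- \<mu> * p1 - p1\<^sup>2 \<le> F1 p1 p2" unfolding \<sigma>\<mu>(3) F1_def by (simp add: algebra_simps)
      then show ?thesis using low[of p1] p unfolding K by linarith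
    qed
    have left2: "- L' * (p2 + \<epsilon>) \<le> F2 p1 p2" if p: "(p1, p2) \<in> K" for p1 p2
    proof -
      have "(\<mu> - k1 + k2) * (- p2) \<le> (\<mu> - k1 + k2) * (\<sigma> * p1)" using p c \<sigma>\<mu>(5) by (intro mult_left_mono) (auto simp: K)
      also have "\<dots> = (\<sigma> * (\<mu> - k1 + k2)) * p1" by simp
      also have "\<dots> = k2 * p1" unfolding \<sigma>\<mu>(4)[symmetric] ..
      finally have "- \<mu> * p2 - p2\<^sup>2 \<le> F2 p1 p2" unfolding F2_def by (simp add: algebra_simps)
      then show ?thesis using low[of p2] p unfolding K by linarith
    qed
    define L where "L = max (4 * Lc) (L' / \<delta>) + 1"
    have L'\<delta>: "0 < L' / \<delta>" using L' \<delta> by simp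
    have L: "0 < L" "4 * Lc \<le> L" "L' / \<delta> \<le> L" unfolding L_def using L'\<delta> by linarith+
    \<comment> \<open>The return to the original time: dividing by a denominator of at least
      \<open>\<delta>\<close> costs a factor \<open>1 / \<delta>\<close> in the rate.\<close>
    have scale: "- L * g \<le> f / d" if "0 \<le> g" "- L' * g \<le> f" "\<delta> \<le> d" for f g d :: real
    proof -
      have d: "0 < d" using that \<delta> by simp
      have "(L' / d) * g \<le> (L' / \<delta>) * g" using that \<delta> L' by (intro mult_right_mono divide_left_mono) auto
      also have "\<dots> \<le> L * g" using L that by (intro mult_right_mono) auto
      finally have 1: "(L' / d) * g \<le> L * g" .
      have "(- L' * g) / d \<le> f / d" using that d by (intro divide_right_mono) auto
      then show ?thesis using 1 by simp
    qed
    have inward: "- L * (fst i \<bullet> p - snd i) \<le> fst i \<bullet> G p" if p: "p \<in> K" and i: "i \<in> I" for p i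
    proof -
      obtain p1 p2 where e: "p = (p1, p2)" by (cases p)
      note pK = p[unfolded e]
      have d: "\<delta> \<le> D p1 p2" by (rule D\<delta>[OF pK])
      have g: "0 \<le> fst i \<bullet> p - snd i" using p i by (auto simp: K_def)
      consider "i = ((1, 0), - \<epsilon>)" | "i = ((0, 1), - \<epsilon>)" | "i = ((\<sigma>, 1), c)" | "i = ((- 1, 0), - B)" | "i = ((0, - 1), - B)"
        using i by (auto simp: I_def)
      then show ?thesis
      proof cases
        case 1
        then show ?thesis using scale[OF _ left1[OF pK] d] g by (simp add: G_def e)
      next
        case 2
        then show ?thesis using scale[OF _ left2[OF pK] d] g by (simp add: G_def e)
      next
        case 3
        then show ?thesis using scale[OF _ mid[OF pK] d] g by (simp add: G_def e add_divide_distrib)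
      next
        case 4
        have "- L' * (B - p1) \<le> - F1 p1 p2" unfolding F1_def by (rule up) (use pK in \<open>auto simp: K\<close>)
        from scale[OF _ this d] show ?thesis using g 4 by (simp add: G_def e)
      next
        case 5
        have "- L' * (B - p2) \<le> - F2 p1 p2" unfolding F2_def by (rule up) (use pK in \<open>auto simp: K\<close>)
        from scale[OF _ this d] show ?thesis using g 5 by (simp add: G_def e)
      qed
    qed
    have p0: "(\<epsilon> * w1, \<epsilon> * w2) \<in> K"
    proof -
      have "\<bar>\<epsilon> * w1\<bar> \<le> \<epsilon> * 1" "\<bar>\<epsilon> * w2\<bar> \<le> \<epsilon> * 1"
        unfolding abs_mult using \<epsilon> w by (auto intro!: mult_mono)
      then show ?thesis using \<epsilon>' B1 unfolding K c_def m_def by (auto simp: algebra_simps)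
    qed
    have lipL: "norm (G p - G q) \<le> L * norm (p - q)" if "p \<in> K" "q \<in> K" for p q
      by (rule order_trans[OF lip[OF that] mult_right_mono[OF L(2) norm_ge_zero]])
    obtain P where P: "P 0 = (\<epsilon> * w1, \<epsilon> * w2)" "\<And>t. 0 \<le> t \<Longrightarrow> P t \<in> K"
      "\<And>t. 0 \<le> t \<Longrightarrow> (P has_vector_derivative G (P t)) (at t within {0..})"
      using polyhedron_flow_exists[where I = I and c = snd and n = fst and G = G and L = L,
          folded K_def, OF lipL L(1) inward p0] by blast
    show ?thesis
    proof (rule exI[of _ "\<lambda>t. fst (P t)"], rule exI[of _ "\<lambda>t. snd (P t)"], intro conjI allI impI)
      fix x :: real assume x: "0 \<le> x"
      have PK: "(fst (P x), snd (P x)) \<in> K" using P(2)[OF x] by simp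
      show "0 < D (fst (P x)) (snd (P x))" using D\<delta>[OF PK] \<delta> by simp
      show "\<bar>fst (P x)\<bar> \<le> B" "\<bar>snd (P x)\<bar> \<le> B" using absB[OF PK] by auto
      show "((\<lambda>t. fst (P t)) has_real_derivative F1 (fst (P x)) (snd (P x)) / D (fst (P x)) (snd (P x))) (at x within {0..})"
        "((\<lambda>t. snd (P t)) has_real_derivative F2 (fst (P x)) (snd (P x)) / D (fst (P x)) (snd (P x))) (at x within {0..})"
        using bounded_linear.has_vector_derivative[OF bounded_linear_fst P(3)[OF x]]
          bounded_linear.has_vector_derivative[OF bounded_linear_snd P(3)[OF x]]
        by (simp_all add: has_real_derivative_iff_has_vector_derivative G_def)
    qed (use P(1) in auto)
  qed
  have "0 < \<epsilon>0" unfolding \<epsilon>0_def using \<sigma>\<mu> m A by simp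
  then show ?thesis
    using main unfolding F1_def F2_def D_def B_def[symmetric] saddle_flow_def by (intro exI[of _ \<epsilon>0]) blast
qed

section \<open>Signs of the slopes and affine costs on the half-lines\<close>

lemma sector_sum_pos:
  assumes "(a, b) \<in> sector 1 \<union> sector 2"
  shows "0 < a \<and> 0 < b"
proof -
  obtain \<rho> \<theta> where e: "a = \<rho> * cos \<theta>" "b = \<rho> * sin \<theta>" "0 < \<rho>" "0 < \<theta>" "\<theta> < pi / 2"
    using assms pi_gt_zero unfolding sector_def by fastforce
  then show ?thesis by (simp add: cos_gt_zero_pi sin_gt_zero)
qed

lemma sector_sum_neg:
  assumes "(a, b) \<in> sector 5 \<union> sector 6"
  shows "a < 0 \<and> b < 0"
proof -
  obtain \<rho> \<theta> where e: "a = \<rho> * cos \<theta>" "b = \<rho> * sin \<theta>" "0 < \<rho>" "pi < \<theta>" "\<theta> < pi + pi / 2"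
    using assms pi_gt_zero unfolding sector_def by fastforce
  have "cos \<theta> < 0" "sin \<theta> < 0"
    using cos_gt_zero_pi[of "\<theta> - pi"] sin_gt_zero[of "\<theta> - pi"] e(4,5) pi_gt_zero by simp_all
  then show ?thesis using e(1-3) by (simp add: mult_pos_neg)
qed

lemma constant_derivative_imp_affine:
  fixes h :: "real \<Rightarrow> real"
  assumes h: "continuous_on UNIV h" and d: "\<And>x. 0 < x \<Longrightarrow> (h has_real_derivative k) (at x)" and x: "0 \<le> x"
  shows "h x = h 0 + k * x"
proof (cases "x = 0")
  case False
  then have "0 < x" using x by simp
  then obtain l z where "0 < z" "z < x" "(h has_real_derivative l) (at z)" "h x - h 0 = (x - 0) * l"
    using MVT[of 0 x h] continuous_on_subset[OF h] d real_differentiable_def by (metis top_greatest)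
  then have "l = k" using d DERIV_unique by blast
  then show ?thesis using \<open>h x - h 0 = (x - 0) * l\<close> by (simp add: algebra_simps)
qed simp

lemma constant_derivative_imp_affine_left:
  fixes h :: "real \<Rightarrow> real"
  assumes h: "continuous_on UNIV h" and d: "\<And>x. x < 0 \<Longrightarrow> (h has_real_derivative k) (at x)" and x: "x \<le> 0"
  shows "h x = h 0 + k * x"
proof -
  have "(\<lambda>y. h (- y)) (- x) = (\<lambda>y. h (- y)) 0 + - k * - x"
  proof (rule constant_derivative_imp_affine)
    show "continuous_on UNIV (\<lambda>y. h (- y))"
      by (rule continuous_on_compose2[OF h]) (auto intro!: continuous_intros)
    show "((\<lambda>y. h (- y)) has_real_derivative - k) (at y)" if y: "0 < y" for y
    proof -
      have "(uminus has_real_derivative - 1) (at y)" by (auto intro!: derivative_eq_intros)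
      from DERIV_chain2[OF d this] y show ?thesis by simp
    qed
  qed (use x in simp)
  then show ?thesis by simp
qed

text \<open>Continuity of the derivative makes the one-sided limits coincide, so the jump clause of
  (A3) is empty; its boundedness gives absolute continuity and linear growth.\<close>

lemma smooth_solution_admissible:
  fixes h1 h2 u1 u2 p1 p2 :: "real \<Rightarrow> real"
  defines "u \<equiv> \<lambda>x. (u1 x, u2 x)"
  assumes d1: "\<And>x. (u1 has_real_derivative p1 x) (at x)" and d2: "\<And>x. (u2 has_real_derivative p2 x) (at x)"
    and c1: "continuous_on UNIV p1" and c2: "continuous_on UNIV p2"
    and b1: "\<And>x. \<bar>p1 x\<bar> \<le> B" and b2: "\<And>x. \<bar>p2 x\<bar> \<le> B"
    and e1: "\<And>x. u1 x = h1 x - p1 x * p2 x - (p1 x)\<^sup>2 / 2" and e2: "\<And>x. u2 x = h2 x - p1 x * p2 x - (p2 x)\<^sup>2 / 2"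
  shows "admissible_solution h1 h2 u" "feedback_of u (\<lambda>x. - p1 x) (\<lambda>x. - p2 x)"
proof -
  have du: "(u has_vector_derivative (p1 x, p2 x)) (at x)" for x
  proof -
    have "(u has_derivative (\<lambda>h. (h *\<^sub>R p1 x, h *\<^sub>R p2 x))) (at x)"
      unfolding u_def using d1[of x] d2[of x]
      by (intro has_derivative_Pair) (simp_all add: has_real_derivative_iff_has_vector_derivative has_vector_derivative_def)
    then show ?thesis by (simp add: has_vector_derivative_def)
  qed
  have vd: "vector_derivative u (at x) = (p1 x, p2 x)" for x by (rule vector_derivative_at[OF du])
  have lim: "((\<lambda>x. vector_derivative u (at x)) \<longlongrightarrow> (p1 y, p2 y)) (at y within S)" for y S
    unfolding vd using c1 c2
    by (intro tendsto_Pair) (auto simp: continuous_on_eq_continuous_at isCont_def intro: tendsto_within_subset)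
  have L: "deriv_limit_left u y (p1 y, p2 y)" and R: "deriv_limit_right u y (p1 y, p2 y)" for y
    unfolding deriv_limit_left_def deriv_limit_right_def by (rule lim)+
  have l1: "\<bar>u1 x - u1 y\<bar> \<le> B * \<bar>x - y\<bar>" and l2: "\<bar>u2 x - u2 y\<bar> \<le> B * \<bar>x - y\<bar>" for x y
    using field_differentiable_bound[of UNIV u1 p1 B x y] d1 b1 field_differentiable_bound[of UNIV u2 p2 B x y] d2 b2
    by auto
  have lip: "norm (u x - u y) \<le> (2 * B) * \<bar>x - y\<bar>" for x y
  proof -
    have "norm (u x - u y) \<le> \<bar>u1 x - u1 y\<bar> + \<bar>u2 x - u2 y\<bar>"
      unfolding u_def using norm_Pair_le[of "u1 x - u1 y" "u2 x - u2 y"] by simp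
    then show ?thesis using l1[of x y] l2[of x y] by linarith
  qed
  have B: "0 \<le> B" using b1[of 0] by linarith
  have "norm (u x) \<le> (norm (u 0) + 2 * B) * (1 + \<bar>x\<bar>)" for x
  proof -
    have "norm (u x) \<le> norm (u 0) + norm (u x - u 0)" by (metis add.commute diff_add_cancel norm_triangle_ineq)
    also have "\<dots> \<le> norm (u 0) + 2 * B * \<bar>x\<bar>" using lip[of x 0] by simp
    also have "\<dots> \<le> norm (u 0) * (1 + \<bar>x\<bar>) + 2 * B * (1 + \<bar>x\<bar>)"
      using B by (intro add_mono) (auto simp: algebra_simps)
    finally show ?thesis by (simp add: algebra_simps)
  qed
  then have growth: "\<exists>C. \<forall>x. norm (u x) \<le> C * (1 + \<bar>x\<bar>)" by blast
  have "AE x in lebesgue. \<exists>p1 p2. (u has_vector_derivative (p1, p2)) (at x) \<and>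
        fst (u x) = h1 x - p1 * p2 - p1\<^sup>2 / 2 \<and> snd (u x) = h2 x - p1 * p2 - p2\<^sup>2 / 2"
    using du e1 e2 by (intro AE_I2) (auto simp: u_def)
  moreover have "abs_continuous_on {a..b} u" for a b
    by (rule lipschitz_on_imp_abs_continuous_on[OF lip])
  ultimately show "admissible_solution h1 h2 u"
    unfolding admissible_solution_def using growth L R by blast
  show "feedback_of u (\<lambda>x. - p1 x) (\<lambda>x. - p2 x)"
    unfolding feedback_of_def using L by simp
qed

text \<open>Applying the Jacobian of \<open>p \<mapsto> w\<close> to the formula for the derivative
  of \<open>p\<close> recovers \<open>w' = k - p\<close>, so \<open>h - w\<close> has derivative
  \<open>p\<close>.\<close>

lemma saddle_flow_value_derivative:
  assumes flow: "saddle_flow k1 k2 B q1 q2" and x: "0 \<le> x"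
  shows "((\<lambda>x. a + k1 * x - q1 x * q2 x - (q1 x)\<^sup>2 / 2) has_real_derivative q1 x) (at x within {0..})"
    and "((\<lambda>x. a + k2 * x - q2 x * q1 x - (q2 x)\<^sup>2 / 2) has_real_derivative q2 x) (at x within {0..})"
proof -
  define E F1 F2 where "E = (q1 x)\<^sup>2 + q1 x * q2 x + (q2 x)\<^sup>2"
    and "F1 = (k1 - k2) * q1 x + k1 * q2 x - (q1 x)\<^sup>2" and "F2 = (k2 - k1) * q2 x + k2 * q1 x - (q2 x)\<^sup>2"
  have d: "(q1 has_real_derivative F1 / E) (at x within {0..})" "(q2 has_real_derivative F2 / E) (at x within {0..})"
    and E: "E \<noteq> 0"
    using flow x unfolding saddle_flow_def E_def F1_def F2_def by auto
  have "(q1 x + q2 x) * F1 + q1 x * F2 = (k1 - q1 x) * E" "q2 x * F1 + (q1 x + q2 x) * F2 = (k2 - q2 x) * E"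
    unfolding E_def F1_def F2_def by (simp_all add: power2_eq_square algebra_simps)
  then have "(q1 x + q2 x) * (F1 / E) + q1 x * (F2 / E) = k1 - q1 x" "q2 x * (F1 / E) + (q1 x + q2 x) * (F2 / E) = k2 - q2 x"
    using E by (simp_all add: divide_simps)
  note alg = this
  have "((\<lambda>x. a + k1 * x - q1 x * q2 x - (q1 x)\<^sup>2 / 2) has_real_derivative
      k1 - ((q1 x + q2 x) * (F1 / E) + q1 x * (F2 / E))) (at x within {0..})"
    by (auto intro!: derivative_eq_intros d simp: algebra_simps)
  then show "((\<lambda>x. a + k1 * x - q1 x * q2 x - (q1 x)\<^sup>2 / 2) has_real_derivative q1 x) (at x within {0..})"
    unfolding alg by simp
  have "((\<lambda>x. a + k2 * x - q2 x * q1 x - (q2 x)\<^sup>2 / 2) has_real_derivative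
      k2 - (q2 x * (F1 / E) + (q1 x + q2 x) * (F2 / E))) (at x within {0..})"
    by (auto intro!: derivative_eq_intros d simp: algebra_simps)
  then show "((\<lambda>x. a + k2 * x - q2 x * q1 x - (q2 x)\<^sup>2 / 2) has_real_derivative q2 x) (at x within {0..})"
    unfolding alg by simp
qed

section \<open>Gluing the two half-lines\<close>

lemma saddle_flow_continuous:
  assumes "saddle_flow k1 k2 B q1 q2"
  shows "continuous_on {0..} q1" "continuous_on {0..} q2"
  using assms unfolding saddle_flow_def by (auto intro!: DERIV_continuous_on)

text \<open>Reflection negates derivatives, so the left half-line is represented by a flow
  \<open>m\<close> on the right half-line with negated slopes and negated initial value.\<close>

definition glue :: "(real \<Rightarrow> real) \<Rightarrow> (real \<Rightarrow> real) \<Rightarrow> real \<Rightarrow> real" where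
  "glue q m x = (if 0 \<le> x then q x else - m (- x))"

lemma continuous_glue:
  assumes "continuous_on {0..} q" "continuous_on {0..} m" "q 0 = - m 0"
  shows "continuous_on UNIV (glue q m)"
proof -
  have "continuous_on ({0..} \<union> {..0}) (glue q m)"
  proof (rule continuous_on_closed_Un)
    show "continuous_on {0..} (glue q m)"
      by (rule continuous_on_eq[OF assms(1)]) (simp add: glue_def)
    have "continuous_on {..0} (\<lambda>x. - m (- x))"
      by (intro continuous_on_minus continuous_on_compose2[OF assms(2)]) (auto intro!: continuous_intros)
    then show "continuous_on {..0} (glue q m)"
      by (rule continuous_on_eq) (use assms(3) in \<open>auto simp: glue_def\<close>)
  qed auto
  moreover have "{0..} \<union> {..0} = (UNIV :: real set)" by auto
  ultimately show ?thesis by simp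
qed

lemma derivative_from_half_lines:
  fixes f f' :: "real \<Rightarrow> real"
  assumes R: "\<And>x. 0 \<le> x \<Longrightarrow> (f has_real_derivative f' x) (at x within {0..})"
    and L: "\<And>x. x \<le> 0 \<Longrightarrow> (f has_real_derivative f' x) (at x within {..0})"
  shows "(f has_real_derivative f' x) (at x)"
proof -
  consider "0 < x" | "x < 0" | "x = 0" by linarith
  then show ?thesis
  proof cases
    case 1
    then have "at x within {0..} = at x" by (intro at_within_interior) (simp add: interior_real_atLeast)
    then show ?thesis using R[of x] 1 by simp
  next
    case 2
    then have "at x within {..0} = at x" by (intro at_within_interior) (simp add: interior_real_atMost)
    then show ?thesis using L[of x] 2 by simp
  next
    case 3
    then have "(f has_real_derivative f' x) (at x within {0..} \<union> {..0})"
      using R[of 0] L[of 0] by (simp add: has_field_derivative_iff Lim_within_Un)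
    moreover have "{0..} \<union> {..0} = (UNIV :: real set)" by auto
    ultimately show ?thesis by simp
  qed
qed

lemma glued_value_derivative:
  fixes h q1 q2 m1 m2 :: "real \<Rightarrow> real"
  assumes hR: "\<And>x. 0 \<le> x \<Longrightarrow> h x = h 0 + kR * x" and hL: "\<And>x. x \<le> 0 \<Longrightarrow> h x = h 0 + kL * x"
    and R: "\<And>x. 0 \<le> x \<Longrightarrow> ((\<lambda>x. h 0 + kR * x - q1 x * q2 x - (q1 x)\<^sup>2 / 2) has_real_derivative q1 x) (at x within {0..})"
    and L: "\<And>x. 0 \<le> x \<Longrightarrow> ((\<lambda>x. h 0 + - kL * x - m1 x * m2 x - (m1 x)\<^sup>2 / 2) has_real_derivative m1 x) (at x within {0..})"
    and match: "q1 0 = - m1 0" "q2 0 = - m2 0"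
  shows "((\<lambda>x. h x - glue q1 m1 x * glue q2 m2 x - (glue q1 m1 x)\<^sup>2 / 2) has_real_derivative glue q1 m1 x) (at x)"
proof (rule derivative_from_half_lines)
  fix x :: real assume x: "0 \<le> x"
  show "((\<lambda>x. h x - glue q1 m1 x * glue q2 m2 x - (glue q1 m1 x)\<^sup>2 / 2) has_real_derivative glue q1 m1 x) (at x within {0..})"
  proof (rule has_field_derivative_transform_within[OF _ zero_less_one])
    show "((\<lambda>x. h 0 + kR * x - q1 x * q2 x - (q1 x)\<^sup>2 / 2) has_real_derivative glue q1 m1 x) (at x within {0..})"
      using R[OF x] x by (simp add: glue_def)
    fix z :: real assume "z \<in> {0..}"
    then show "h 0 + kR * z - q1 z * q2 z - (q1 z)\<^sup>2 / 2 = h z - glue q1 m1 z * glue q2 m2 z - (glue q1 m1 z)\<^sup>2 / 2"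
      using hR[of z] by (simp add: glue_def)
  qed (use x in simp)
next
  fix x :: real assume x: "x \<le> 0"
  let ?g = "\<lambda>x. h 0 + - kL * x - m1 x * m2 x - (m1 x)\<^sup>2 / 2"
  have "(?g \<circ> uminus has_real_derivative m1 (- x) * - 1) (at x within {..0})"
    by (rule DERIV_image_chain) (use L[of "- x"] x in \<open>auto intro!: derivative_eq_intros\<close>)
  moreover have "m1 (- x) * - 1 = glue q1 m1 x" using x match by (cases "x = 0") (auto simp: glue_def)
  ultimately have d: "(?g \<circ> uminus has_real_derivative glue q1 m1 x) (at x within {..0})" by simp
  show "((\<lambda>x. h x - glue q1 m1 x * glue q2 m2 x - (glue q1 m1 x)\<^sup>2 / 2) has_real_derivative glue q1 m1 x) (at x within {..0})"
  proof (rule has_field_derivative_transform_within[OF d zero_less_one])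
    fix z :: real assume "z \<in> {..0}"
    then show "(?g \<circ> uminus) z = h z - glue q1 m1 z * glue q2 m2 z - (glue q1 m1 z)\<^sup>2 / 2"
      using match hL[of z] by (cases "z = 0") (auto simp: glue_def)
  qed (use x in simp)
qed

text \<open>Up to normalization the vector is \<open>(d, - d * (s + t) / 2)\<close>, orthogonal to
  the midpoint slope: paired with \<open>(s, 1)\<close> it gives \<open>d\<^sup>2 / 2\<close>,
  paired with \<open>(t, 1)\<close> the negative of that. Dividing by \<open>c\<close> brings both
  components into the unit interval.\<close>

lemma separating_direction:
  fixes s t :: real
  assumes "s \<noteq> t"
  obtains w1 w2 where "\<bar>w1\<bar> \<le> 1" "\<bar>w2\<bar> \<le> 1" "0 < s * w1 + w2" "t * w1 + w2 < 0"
proof -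
  define d c where "d = s - t" and "c = \<bar>d\<bar> + \<bar>d * (s + t) / 2\<bar>"
  have d: "d \<noteq> 0" using assms by (simp add: d_def)
  then have c: "0 < c" by (simp add: c_def add_pos_nonneg)
  have "0 < d * d" using d by (metis not_real_square_gt_zero)
  show thesis
  proof (rule that[of "d / c" "- (d * (s + t) / 2) / c"])
    show "\<bar>d / c\<bar> \<le> 1" "\<bar>- (d * (s + t) / 2) / c\<bar> \<le> 1"
      using c by (simp_all add: abs_divide pos_divide_le_eq c_def)
    have "s * (d / c) + - (d * (s + t) / 2) / c = d * d / (2 * c)" "t * (d / c) + - (d * (s + t) / 2) / c = - (d * d / (2 * c))"
      using c by (simp_all add: d_def field_simps)
    then show "0 < s * (d / c) + - (d * (s + t) / 2) / c" "t * (d / c) + - (d * (s + t) / 2) / c < 0"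
      using \<open>0 < d * d\<close> c by simp_all
  qed
qed

theorem mainTheorem5:
  fixes h1 h2 :: "real \<Rightarrow> real" and \<kappa>10 \<kappa>20 \<kappa>11 \<kappa>21 :: real
  assumes "continuous_on UNIV h1" and "continuous_on UNIV h2"
    and "\<And>x. x < 0 \<Longrightarrow> (h1 has_real_derivative \<kappa>10) (at x)"
    and "\<And>x. x > 0 \<Longrightarrow> (h1 has_real_derivative \<kappa>11) (at x)"
    and "\<And>x. x < 0 \<Longrightarrow> (h2 has_real_derivative \<kappa>20) (at x)"
    and "\<And>x. x > 0 \<Longrightarrow> (h2 has_real_derivative \<kappa>21) (at x)"
    and "(\<kappa>10, \<kappa>20) \<in> sector 5 \<union> sector 6"
    and "(\<kappa>11, \<kappa>21) \<in> sector 1 \<union> sector 2"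
    and "\<kappa>21 / \<kappa>11 \<noteq> \<kappa>20 / \<kappa>10"
  shows "infinite {u. admissible_solution h1 h2 u} \<and>
    (\<forall>u \<alpha>1 \<alpha>2. admissible_solution h1 h2 u \<and> feedback_of u \<alpha>1 \<alpha>2 \<longrightarrow>
       bounded (range \<alpha>1) \<and> bounded (range \<alpha>2) \<and>
       (\<forall>U1 U2. compact U1 \<and> compact U2 \<and> range \<alpha>1 \<subseteq> U1 \<and> range \<alpha>2 \<subseteq> U2
          \<longrightarrow> nash_feedback h1 h2 U1 U2 \<alpha>1 \<alpha>2)) \<and>
    (\<exists>U1 U2. compact U1 \<and> compact U2 \<and>
       infinite {(\<alpha>1, \<alpha>2). nash_feedback h1 h2 U1 U2 \<alpha>1 \<alpha>2 \<and>
                   (\<exists>u. admissible_solution h1 h2 u \<and> feedback_of u \<alpha>1 \<alpha>2)})"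
proof -
  note c = assms(1,2)
  have k: "0 < \<kappa>11" "0 < \<kappa>21" "0 < - \<kappa>10" "0 < - \<kappa>20"
    using sector_sum_pos[OF assms(8)] sector_sum_neg[OF assms(7)] by auto
  have hR: "\<And>x. 0 \<le> x \<Longrightarrow> h1 x = h1 0 + \<kappa>11 * x" "\<And>x. 0 \<le> x \<Longrightarrow> h2 x = h2 0 + \<kappa>21 * x"
    by (rule constant_derivative_imp_affine[OF c(1) assms(4)] constant_derivative_imp_affine[OF c(2) assms(6)]; assumption)+
  have hL: "\<And>x. x \<le> 0 \<Longrightarrow> h1 x = h1 0 + \<kappa>10 * x" "\<And>x. x \<le> 0 \<Longrightarrow> h2 x = h2 0 + \<kappa>20 * x"
    by (rule constant_derivative_imp_affine_left[OF c(1) assms(3)] constant_derivative_imp_affine_left[OF c(2) assms(5)]; assumption)+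
  define C where "C = \<bar>h1 0\<bar> + \<bar>h2 0\<bar> + \<bar>\<kappa>11\<bar> + \<bar>\<kappa>21\<bar> + \<bar>\<kappa>10\<bar> + \<bar>\<kappa>20\<bar>"
  have growth: "\<bar>h1 x\<bar> \<le> C * (1 + \<bar>x\<bar>)" "\<bar>h2 x\<bar> \<le> C * (1 + \<bar>x\<bar>)" for x
  proof -
    have *: "\<bar>a + k * x\<bar> \<le> C * (1 + \<bar>x\<bar>)" if "\<bar>a\<bar> + \<bar>k\<bar> \<le> C" for a k
    proof -
      have "\<bar>a + k * x\<bar> \<le> \<bar>a\<bar> + \<bar>k\<bar> * \<bar>x\<bar>" by (rule order_trans[OF abs_triangle_ineq]) (simp add: abs_mult)
      also have "\<dots> \<le> \<bar>a\<bar> * (1 + \<bar>x\<bar>) + \<bar>k\<bar> * (1 + \<bar>x\<bar>)" by (intro add_mono) (auto simp: algebra_simps)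
      also have "\<dots> = (\<bar>a\<bar> + \<bar>k\<bar>) * (1 + \<bar>x\<bar>)" by (simp add: algebra_simps)
      also have "\<dots> \<le> C * (1 + \<bar>x\<bar>)" using that by (intro mult_right_mono) auto
      finally show ?thesis .
    qed
    show "\<bar>h1 x\<bar> \<le> C * (1 + \<bar>x\<bar>)" "\<bar>h2 x\<bar> \<le> C * (1 + \<bar>x\<bar>)"
    proof (atomize(full), cases "0 \<le> x")
      case True
      show "\<bar>h1 x\<bar> \<le> C * (1 + \<bar>x\<bar>) \<and> \<bar>h2 x\<bar> \<le> C * (1 + \<bar>x\<bar>)"
        unfolding hR(1)[OF True] hR(2)[OF True] by (intro conjI *) (auto simp: C_def)
    next
      case False
      then have x: "x \<le> 0" by simp
      show "\<bar>h1 x\<bar> \<le> C * (1 + \<bar>x\<bar>) \<and> \<bar>h2 x\<bar> \<le> C * (1 + \<bar>x\<bar>)"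
        unfolding hL(1)[OF x] hL(2)[OF x] by (intro conjI *) (auto simp: C_def)
    qed
  qed
  have part2: "bounded (range \<alpha>1) \<and> bounded (range \<alpha>2) \<and>
       (\<forall>U1 U2. compact U1 \<and> compact U2 \<and> range \<alpha>1 \<subseteq> U1 \<and> range \<alpha>2 \<subseteq> U2
          \<longrightarrow> nash_feedback h1 h2 U1 U2 \<alpha>1 \<alpha>2)"
    if adm: "admissible_solution h1 h2 u" and fb: "feedback_of u \<alpha>1 \<alpha>2" for u \<alpha>1 \<alpha>2
  proof -
    obtain l1 l2 r1 r2 where gs: "game_solution h1 h2 (\<lambda>x. fst (u x)) (\<lambda>x. snd (u x)) l1 l2 r1 r2"
      and lr: "\<And>y p. deriv_limit_left u y p \<longleftrightarrow> p = (l1 y, l2 y)" "\<And>y p. deriv_limit_right u y p \<longleftrightarrow> p = (r1 y, r2 y)"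
      using admissible_solution_branches[OF adm c] by blast
    interpret game_solution h1 h2 "\<lambda>x. fst (u x)" "\<lambda>x. snd (u x)" l1 l2 r1 r2 by (rule gs)
    obtain B where B: "\<And>x. \<bar>r1 x\<bar> \<le> B" "\<And>x. \<bar>r2 x\<bar> \<le> B"
      using one_sided_derivatives_bounded[OF hR hL] by metis
    have f: "(\<alpha>1 x = - l1 x \<and> \<alpha>2 x = - l2 x) \<or> (\<alpha>1 x = - r1 x \<and> \<alpha>2 x = - r2 x)" for x
    proof -
      have "(- \<alpha>1 x, - \<alpha>2 x) = (l1 x, l2 x) \<or> (- \<alpha>1 x, - \<alpha>2 x) = (r1 x, r2 x)"
        using fb unfolding feedback_of_def lr by blast
      then show ?thesis by auto
    qed
    have "bounded (range \<alpha>1)" "bounded (range \<alpha>2)"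
      using feedback_bounded[OF f B c(1) growth(1)] by (auto simp: bounded_iff)
    then show ?thesis using nash[OF f B c(1) growth(1) c(2) growth(2)] by blast
  qed
  have "saddle_slope \<kappa>11 \<kappa>21 \<noteq> saddle_slope (- \<kappa>10) (- \<kappa>20)"
    using saddle_slope_eq_imp_ratio_eq[OF k] assms(9) by auto
  then obtain w1 w2 where w: "\<bar>w1\<bar> \<le> 1" "\<bar>w2\<bar> \<le> 1" "0 < saddle_slope \<kappa>11 \<kappa>21 * w1 + w2"
    "saddle_slope (- \<kappa>10) (- \<kappa>20) * w1 + w2 < 0"
    using separating_direction by metis
  define BR BL where "BR = 2 * (\<kappa>11 + \<kappa>21) + 1" and "BL = 2 * (- \<kappa>10 + - \<kappa>20) + 1"
  obtain \<epsilon>R where \<epsilon>R: "0 < \<epsilon>R" "\<And>\<epsilon>. 0 < \<epsilon> \<Longrightarrow> \<epsilon> \<le> \<epsilon>R \<Longrightarrow>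
      \<exists>p1 p2. saddle_flow \<kappa>11 \<kappa>21 BR p1 p2 \<and> p1 0 = \<epsilon> * w1 \<and> p2 0 = \<epsilon> * w2"
    using branch_flow_exists[OF k(1,2) w(1-3)] unfolding BR_def by blast
  \<comment> \<open>Reflection negates the initial value, so the good side of the left saddle is the
    one where its form is negative at \<open>(w1, w2)\<close>.\<close>
  have w': "\<bar>- w1\<bar> \<le> 1" "\<bar>- w2\<bar> \<le> 1" "0 < saddle_slope (- \<kappa>10) (- \<kappa>20) * - w1 + - w2"
    using w by auto
  obtain \<epsilon>L where \<epsilon>L: "0 < \<epsilon>L" "\<And>\<epsilon>. 0 < \<epsilon> \<Longrightarrow> \<epsilon> \<le> \<epsilon>L \<Longrightarrow>
      \<exists>p1 p2. saddle_flow (- \<kappa>10) (- \<kappa>20) BL p1 p2 \<and> p1 0 = \<epsilon> * - w1 \<and> p2 0 = \<epsilon> * - w2"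
    using branch_flow_exists[OF k(3,4) w'] unfolding BL_def by blast
  define \<epsilon>0 where "\<epsilon>0 = min \<epsilon>R \<epsilon>L"
  have \<epsilon>0: "0 < \<epsilon>0" using \<epsilon>R(1) \<epsilon>L(1) by (simp add: \<epsilon>0_def)
  define B where "B = max BR BL"
  \<comment> \<open>The values at 0 are recorded because they are what tells the members of the
    family apart.\<close>
  define good where "good \<epsilon> p1 p2 u \<longleftrightarrow> admissible_solution h1 h2 u \<and> feedback_of u (\<lambda>x. - p1 x) (\<lambda>x. - p2 x) \<and>
      (\<forall>x. \<bar>p1 x\<bar> \<le> B \<and> \<bar>p2 x\<bar> \<le> B) \<and> p1 0 = \<epsilon> * w1 \<and> p2 0 = \<epsilon> * w2 \<and>
      fst (u 0) = h1 0 - p1 0 * p2 0 - (p1 0)\<^sup>2 / 2 \<and> snd (u 0) = h2 0 - p1 0 * p2 0 - (p2 0)\<^sup>2 / 2"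
    for \<epsilon> p1 p2 u
  have "\<exists>p1 p2 u. good \<epsilon> p1 p2 u"
    if \<epsilon>: "\<epsilon> \<in> {0<..\<epsilon>0}" for \<epsilon>
  proof -
    have \<epsilon>': "0 < \<epsilon>" "\<epsilon> \<le> \<epsilon>R" "\<epsilon> \<le> \<epsilon>L" using \<epsilon> by (auto simp: \<epsilon>0_def)
    obtain q1 q2 where q: "saddle_flow \<kappa>11 \<kappa>21 BR q1 q2" and q0: "q1 0 = \<epsilon> * w1" "q2 0 = \<epsilon> * w2"
      using \<epsilon>R(2)[OF \<epsilon>'(1,2)] by blast
    obtain m1 m2 where m: "saddle_flow (- \<kappa>10) (- \<kappa>20) BL m1 m2" and m0: "m1 0 = \<epsilon> * - w1" "m2 0 = \<epsilon> * - w2"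
      using \<epsilon>L(2)[OF \<epsilon>'(1,3)] by blast
    have match: "q1 0 = - m1 0" "q2 0 = - m2 0" using q0 m0 by auto
    define p1 p2 where "p1 = glue q1 m1" and "p2 = glue q2 m2"
    define u1 u2 where "u1 x = h1 x - p1 x * p2 x - (p1 x)\<^sup>2 / 2" and "u2 x = h2 x - p1 x * p2 x - (p2 x)\<^sup>2 / 2" for x
    have d1: "(u1 has_real_derivative p1 x) (at x)" for x
      unfolding u1_def p1_def p2_def
      by (rule glued_value_derivative[OF hR(1) hL(1) saddle_flow_value_derivative(1)[OF q] saddle_flow_value_derivative(1)[OF m] match])
    have eq2: "u2 = (\<lambda>x. h2 x - glue q2 m2 x * glue q1 m1 x - (glue q2 m2 x)\<^sup>2 / 2)"
      by (simp add: u2_def p1_def p2_def mult.commute fun_eq_iff)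
    have d2: "(u2 has_real_derivative p2 x) (at x)" for x
      unfolding eq2 p2_def
      by (rule glued_value_derivative[OF hR(2) hL(2) saddle_flow_value_derivative(2)[OF q] saddle_flow_value_derivative(2)[OF m] match(2,1)])
    have cp: "continuous_on UNIV p1" "continuous_on UNIV p2"
      unfolding p1_def p2_def
      by (intro continuous_glue saddle_flow_continuous[OF q] saddle_flow_continuous[OF m] match)+
    have "\<bar>q1 x\<bar> \<le> BR \<and> \<bar>q2 x\<bar> \<le> BR" "\<bar>m1 x\<bar> \<le> BL \<and> \<bar>m2 x\<bar> \<le> BL" if "0 \<le> x" for x
      using q m that by (auto simp: saddle_flow_def)
    from this(1) this(2)[of "- _"] have b: "\<bar>p1 x\<bar> \<le> B" "\<bar>p2 x\<bar> \<le> B" for x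
      by (auto simp: p1_def p2_def glue_def B_def le_max_iff_disj)
    note sol = smooth_solution_admissible[OF d1 d2 cp b u1_def u2_def]
    show ?thesis
      by (rule exI[of _ p1], rule exI[of _ p2], rule exI[of _ "\<lambda>x. (u1 x, u2 x)"])
         (use sol b q0 in \<open>auto simp: good_def u1_def u2_def p1_def p2_def glue_def\<close>)
  qed
  then obtain P1 P2 u where "\<And>\<epsilon>. \<epsilon> \<in> {0<..\<epsilon>0} \<Longrightarrow> good \<epsilon> (P1 \<epsilon>) (P2 \<epsilon>) (u \<epsilon>)"
    by metis
  then have sol: "\<And>\<epsilon>. \<epsilon> \<in> {0<..\<epsilon>0} \<Longrightarrow> admissible_solution h1 h2 (u \<epsilon>)"
    "\<And>\<epsilon>. \<epsilon> \<in> {0<..\<epsilon>0} \<Longrightarrow> feedback_of (u \<epsilon>) (\<lambda>x. - P1 \<epsilon> x) (\<lambda>x. - P2 \<epsilon> x)"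
    "\<And>\<epsilon> x. \<epsilon> \<in> {0<..\<epsilon>0} \<Longrightarrow> \<bar>P1 \<epsilon> x\<bar> \<le> B \<and> \<bar>P2 \<epsilon> x\<bar> \<le> B"
    "\<And>\<epsilon>. \<epsilon> \<in> {0<..\<epsilon>0} \<Longrightarrow> P1 \<epsilon> 0 = \<epsilon> * w1 \<and> P2 \<epsilon> 0 = \<epsilon> * w2"
    "\<And>\<epsilon>. \<epsilon> \<in> {0<..\<epsilon>0} \<Longrightarrow> fst (u \<epsilon> 0) = h1 0 - P1 \<epsilon> 0 * P2 \<epsilon> 0 - (P1 \<epsilon> 0)\<^sup>2 / 2"
    "\<And>\<epsilon>. \<epsilon> \<in> {0<..\<epsilon>0} \<Longrightarrow> snd (u \<epsilon> 0) = h2 0 - P1 \<epsilon> 0 * P2 \<epsilon> 0 - (P2 \<epsilon> 0)\<^sup>2 / 2"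
    unfolding good_def by blast+
  have wne: "w1 \<noteq> 0 \<or> w2 \<noteq> 0" using w(3) by auto
  have inf: "infinite {0<..\<epsilon>0}" using \<epsilon>0 by (rule infinite_Ioc)
  \<comment> \<open>\<open>u \<epsilon> 0\<close> fixes the derivative at 0 up to sign, and the sign
    is settled because all these derivatives are positive multiples of the same nonzero
    vector.\<close>
  have inj_u: "inj_on u {0<..\<epsilon>0}"
  proof (rule inj_onI)
    fix \<epsilon> \<eta> assume e: "\<epsilon> \<in> {0<..\<epsilon>0}" "\<eta> \<in> {0<..\<epsilon>0}" "u \<epsilon> = u \<eta>"
    have "(P1 \<eta> 0 = P1 \<epsilon> 0 \<and> P2 \<eta> 0 = P2 \<epsilon> 0) \<or> (P1 \<eta> 0 = - P1 \<epsilon> 0 \<and> P2 \<eta> 0 = - P2 \<epsilon> 0)"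
    proof (rule quadratic_pair_eq_imp_eq_or_neg)
      show "P1 \<epsilon> 0 * P2 \<epsilon> 0 + (P1 \<epsilon> 0)\<^sup>2 / 2 = P1 \<eta> 0 * P2 \<eta> 0 + (P1 \<eta> 0)\<^sup>2 / 2"
        using sol(5)[OF e(1)] sol(5)[OF e(2)] unfolding e(3) by linarith
      show "P1 \<epsilon> 0 * P2 \<epsilon> 0 + (P2 \<epsilon> 0)\<^sup>2 / 2 = P1 \<eta> 0 * P2 \<eta> 0 + (P2 \<eta> 0)\<^sup>2 / 2"
        using sol(6)[OF e(1)] sol(6)[OF e(2)] unfolding e(3) by linarith
    qed
    then have "(\<eta> - \<epsilon>) * w1 = 0 \<and> (\<eta> - \<epsilon>) * w2 = 0 \<or> (\<eta> + \<epsilon>) * w1 = 0 \<and> (\<eta> + \<epsilon>) * w2 = 0"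
      using sol(4)[OF e(1)] sol(4)[OF e(2)] by (auto simp: algebra_simps)
    moreover have "\<eta> + \<epsilon> \<noteq> 0" using e(1,2) by auto
    ultimately show "\<epsilon> = \<eta>" using wne by auto
  qed
  have part1: "infinite {u. admissible_solution h1 h2 u}"
  proof
    assume "finite {u. admissible_solution h1 h2 u}"
    then have "finite (u ` {0<..\<epsilon>0})" by (rule finite_subset[rotated]) (use sol(1) in auto)
    then show False using inf finite_imageD[OF _ inj_u] by blast
  qed
  define F where "F \<epsilon> = (\<lambda>x. - P1 \<epsilon> x, \<lambda>x. - P2 \<epsilon> x)" for \<epsilon>
  have inj_F: "inj_on F {0<..\<epsilon>0}"
  proof (rule inj_onI)
    fix \<epsilon> \<eta> assume e: "\<epsilon> \<in> {0<..\<epsilon>0}" "\<eta> \<in> {0<..\<epsilon>0}" "F \<epsilon> = F \<eta>"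
    then have "P1 \<epsilon> 0 = P1 \<eta> 0 \<and> P2 \<epsilon> 0 = P2 \<eta> 0" by (auto simp: F_def fun_eq_iff)
    then show "\<epsilon> = \<eta>" using sol(4)[OF e(1)] sol(4)[OF e(2)] wne by auto
  qed
  \<comment> \<open>One control interval serves the whole family, since \<open>B\<close> depends on
    the slopes and not on \<open>\<epsilon>\<close>.\<close>
  let ?N = "{(\<alpha>1, \<alpha>2). nash_feedback h1 h2 {- B..B} {- B..B} \<alpha>1 \<alpha>2 \<and>
                   (\<exists>u. admissible_solution h1 h2 u \<and> feedback_of u \<alpha>1 \<alpha>2)}"
  have "F \<epsilon> \<in> ?N" if \<epsilon>: "\<epsilon> \<in> {0<..\<epsilon>0}" for \<epsilon>
  proof -
    have "- P1 \<epsilon> x \<in> {- B..B}" "- P2 \<epsilon> x \<in> {- B..B}" for x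
      using sol(3)[OF \<epsilon>, of x] unfolding atLeastAtMost_iff by linarith+
    then have ran: "range (\<lambda>x. - P1 \<epsilon> x) \<subseteq> {- B..B}" "range (\<lambda>x. - P2 \<epsilon> x) \<subseteq> {- B..B}"
      by (intro image_subsetI; simp)+
    have "nash_feedback h1 h2 {- B..B} {- B..B} (\<lambda>x. - P1 \<epsilon> x) (\<lambda>x. - P2 \<epsilon> x)"
      using part2[OF sol(1)[OF \<epsilon>] sol(2)[OF \<epsilon>]] ran by (meson compact_Icc)
    then show ?thesis
      unfolding F_def mem_Collect_eq prod.case using sol(1)[OF \<epsilon>] sol(2)[OF \<epsilon>] by (intro conjI exI)
  qed
  then have sub: "F ` {0<..\<epsilon>0} \<subseteq> ?N" by (rule image_subsetI)
  have "infinite (F ` {0<..\<epsilon>0})" using inf finite_imageD[OF _ inj_F] by blast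
  from infinite_super[OF sub this] have part3: "\<exists>U1 U2. compact U1 \<and> compact U2 \<and>
       infinite {(\<alpha>1, \<alpha>2). nash_feedback h1 h2 U1 U2 \<alpha>1 \<alpha>2 \<and>
                   (\<exists>u. admissible_solution h1 h2 u \<and> feedback_of u \<alpha>1 \<alpha>2)}"
    by (intro exI[of _ "{- B..B}"] conjI compact_Icc)
  have "\<forall>u \<alpha>1 \<alpha>2. admissible_solution h1 h2 u \<and> feedback_of u \<alpha>1 \<alpha>2 \<longrightarrow>
       bounded (range \<alpha>1) \<and> bounded (range \<alpha>2) \<and>
       (\<forall>U1 U2. compact U1 \<and> compact U2 \<and> range \<alpha>1 \<subseteq> U1 \<and> range \<alpha>2 \<subseteq> U2
          \<longrightarrow> nash_feedback h1 h2 U1 U2 \<alpha>1 \<alpha>2)"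
    by (intro allI impI, elim conjE, rule part2)
  with part1 part3 show ?thesis by (intro conjI)
qed

end
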